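(* Let $\mathcal{G}$ be an addable, minor-closed class of graphs other than the class of all graphs, and for each $n$ let $C_n$ be chosen uniformly at random from $\mathcal{C}_n$, the set of connected graphs in $\mathcal{G}$ with vertex set $\{1,\dots,n\}$. Then $C_n$ obeys the MSO zero-one law: for every sentence $\varphi$ of monadic second-order logic, $\lim_{n\to\infty}\Pr(C_n\models\varphi)$ exists and equals $0$ or $1$.
   Context: A class of graphs is closed under isomorphism. It is minor-closed if every minor of a graph in the class is in the class. It is decomposable if a graph belongs to the class if and only if all of its connected components do. It is addable if it is decomposable and, whenever $G$ is in the class, adding an edge between two vertices in distinct components of $G$ produces a graph in the class. Monadic second-order logic (MSO) of graphs is first-order logic (variables over vertices, quantifiers, connectives, $=$, and adjacency $\sim$) enriched with variables ranging over sets of vertices, quantification over them, and the membership relation $x\in X$. *)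

theory Defs
  imports
    "HOL-Probability.Probability_Mass_Function"
    "Graph_Theory.Graph_Theory"
begin

text \<open>
  A finite simple graph is a \<open>pair_graph\<close>: a finite vertex set together with a symmetric,
  loop-free adjacency relation on it (each undirected edge is stored as two arcs). The null graph
  is allowed as a graph; it is not connected and has no components. Since every finite graph is
  isomorphic to one whose vertices are natural numbers, an isomorphism-closed class of graphs is
  represented by its members with vertices in \<open>nat\<close>.
\<close>

type_synonym ngraph = "nat pair_pre_digraph"

definition graph_class :: "ngraph set \<Rightarrow> bool" where
  "graph_class \<G> \<longleftrightarrow>
     (\<forall>G\<in>\<G>. pair_graph G) \<and>
     (\<forall>G\<in>\<G>. \<forall>H. digraph_iso (with_proj G) (with_proj H) \<longrightarrow> H \<in> \<G>)"

definition delete_vertex :: "'a \<Rightarrow> 'a pair_pre_digraph \<Rightarrow> 'a pair_pre_digraph" where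
  "delete_vertex v G =
     \<lparr> pverts = pverts G - {v}, parcs = {(x, y) \<in> parcs G. x \<noteq> v \<and> y \<noteq> v} \<rparr>"

definition delete_edge :: "'a \<Rightarrow> 'a \<Rightarrow> 'a pair_pre_digraph \<Rightarrow> 'a pair_pre_digraph" where
  "delete_edge u v G = \<lparr> pverts = pverts G, parcs = parcs G - {(u, v), (v, u)} \<rparr>"

definition add_edge :: "'a \<Rightarrow> 'a \<Rightarrow> 'a pair_pre_digraph \<Rightarrow> 'a pair_pre_digraph" where
  "add_edge u v G = \<lparr> pverts = pverts G, parcs = parcs G \<union> {(u, v), (v, u)} \<rparr>"

text \<open>
  The vertex resulting from contracting the edge \<open>uv\<close> is called \<open>u\<close>. Parallel edges are merged
  automatically; subtracting the identity relation removes the loop that \<open>uv\<close> becomes.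
\<close>

definition contract_edge :: "'a \<Rightarrow> 'a \<Rightarrow> 'a pair_pre_digraph \<Rightarrow> 'a pair_pre_digraph" where
  "contract_edge u v G =
     \<lparr> pverts = pverts G - {v}, parcs = map_prod (id(v := u)) (id(v := u)) ` parcs G - Id \<rparr>"

inductive minor_step :: "'a pair_pre_digraph \<Rightarrow> 'a pair_pre_digraph \<Rightarrow> bool" where
  vertex_deletion: "v \<in> pverts G \<Longrightarrow> minor_step G (delete_vertex v G)"
| edge_deletion: "(u, v) \<in> parcs G \<Longrightarrow> minor_step G (delete_edge u v G)"
| edge_contraction: "(u, v) \<in> parcs G \<Longrightarrow> minor_step G (contract_edge u v G)"

definition is_minor :: "'b pair_pre_digraph \<Rightarrow> 'a pair_pre_digraph \<Rightarrow> bool" where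
  "is_minor H G \<longleftrightarrow> (\<exists>K. minor_step\<^sup>*\<^sup>* G K \<and> digraph_iso (with_proj K) (with_proj H))"

definition minor_closed :: "ngraph set \<Rightarrow> bool" where
  "minor_closed \<G> \<longleftrightarrow> (\<forall>G\<in>\<G>. \<forall>H. is_minor H G \<longrightarrow> H \<in> \<G>)"

text \<open>
  As adjacency is symmetric, the strongly connected components of a \<open>pair_graph\<close> are its connected
  components.
\<close>

definition components :: "'a pair_pre_digraph \<Rightarrow> 'a pair_pre_digraph set" where
  "components G = {K. with_proj K \<in> pre_digraph.sccs (with_proj G)}"

definition decomposable :: "ngraph set \<Rightarrow> bool" where
  "decomposable \<G> \<longleftrightarrow> (\<forall>G. pair_graph G \<longrightarrow> (G \<in> \<G> \<longleftrightarrow> components G \<subseteq> \<G>))"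

definition addable :: "ngraph set \<Rightarrow> bool" where
  "addable \<G> \<longleftrightarrow> decomposable \<G> \<and>
     (\<forall>G\<in>\<G>. \<forall>A\<in>components G. \<forall>B\<in>components G. A \<noteq> B \<longrightarrow>
        (\<forall>u\<in>pverts A. \<forall>v\<in>pverts B. add_edge u v G \<in> \<G>))"

definition connected_members :: "ngraph set \<Rightarrow> nat \<Rightarrow> ngraph set" where
  "connected_members \<G> n =
     {G \<in> \<G>. pverts G = {1..n} \<and> Digraph_Component.connected (with_proj G)}"

text \<open>
  Vertex variables and set variables are both named by natural numbers, in separate name spaces:
  in \<open>Mem x X\<close> the number \<open>x\<close> names a vertex variable and \<open>X\<close> a set variable.
\<close>

datatype mso =
    Eq nat nat
  | Adj nat nat
  | Mem nat nat
  | Neg mso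
  | Conj mso mso
  | Disj mso mso
  | Impl mso mso
  | ExV nat mso
  | AllV nat mso
  | ExS nat mso
  | AllS nat mso

primrec free_vertex_vars :: "mso \<Rightarrow> nat set" where
  "free_vertex_vars (Eq x y) = {x, y}"
| "free_vertex_vars (Adj x y) = {x, y}"
| "free_vertex_vars (Mem x X) = {x}"
| "free_vertex_vars (Neg \<phi>) = free_vertex_vars \<phi>"
| "free_vertex_vars (Conj \<phi> \<psi>) = free_vertex_vars \<phi> \<union> free_vertex_vars \<psi>"
| "free_vertex_vars (Disj \<phi> \<psi>) = free_vertex_vars \<phi> \<union> free_vertex_vars \<psi>"
| "free_vertex_vars (Impl \<phi> \<psi>) = free_vertex_vars \<phi> \<union> free_vertex_vars \<psi>"
| "free_vertex_vars (ExV x \<phi>) = free_vertex_vars \<phi> - {x}"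
| "free_vertex_vars (AllV x \<phi>) = free_vertex_vars \<phi> - {x}"
| "free_vertex_vars (ExS X \<phi>) = free_vertex_vars \<phi>"
| "free_vertex_vars (AllS X \<phi>) = free_vertex_vars \<phi>"

primrec free_set_vars :: "mso \<Rightarrow> nat set" where
  "free_set_vars (Eq x y) = {}"
| "free_set_vars (Adj x y) = {}"
| "free_set_vars (Mem x X) = {X}"
| "free_set_vars (Neg \<phi>) = free_set_vars \<phi>"
| "free_set_vars (Conj \<phi> \<psi>) = free_set_vars \<phi> \<union> free_set_vars \<psi>"
| "free_set_vars (Disj \<phi> \<psi>) = free_set_vars \<phi> \<union> free_set_vars \<psi>"
| "free_set_vars (Impl \<phi> \<psi>) = free_set_vars \<phi> \<union> free_set_vars \<psi>"
| "free_set_vars (ExV x \<phi>) = free_set_vars \<phi>"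
| "free_set_vars (AllV x \<phi>) = free_set_vars \<phi>"
| "free_set_vars (ExS X \<phi>) = free_set_vars \<phi> - {X}"
| "free_set_vars (AllS X \<phi>) = free_set_vars \<phi> - {X}"

definition mso_sentence :: "mso \<Rightarrow> bool" where
  "mso_sentence \<phi> \<longleftrightarrow> free_vertex_vars \<phi> = {} \<and> free_set_vars \<phi> = {}"

primrec mso_sat ::
    "'a pair_pre_digraph \<Rightarrow> (nat \<Rightarrow> 'a) \<Rightarrow> (nat \<Rightarrow> 'a set) \<Rightarrow> mso \<Rightarrow> bool" where
  "mso_sat G s S (Eq x y) \<longleftrightarrow> s x = s y"
| "mso_sat G s S (Adj x y) \<longleftrightarrow> (s x, s y) \<in> parcs G"
| "mso_sat G s S (Mem x X) \<longleftrightarrow> s x \<in> S X"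
| "mso_sat G s S (Neg \<phi>) \<longleftrightarrow> \<not> mso_sat G s S \<phi>"
| "mso_sat G s S (Conj \<phi> \<psi>) \<longleftrightarrow> mso_sat G s S \<phi> \<and> mso_sat G s S \<psi>"
| "mso_sat G s S (Disj \<phi> \<psi>) \<longleftrightarrow> mso_sat G s S \<phi> \<or> mso_sat G s S \<psi>"
| "mso_sat G s S (Impl \<phi> \<psi>) \<longleftrightarrow> (mso_sat G s S \<phi> \<longrightarrow> mso_sat G s S \<psi>)"
| "mso_sat G s S (ExV x \<phi>) \<longleftrightarrow> (\<exists>v\<in>pverts G. mso_sat G (s(x := v)) S \<phi>)"
| "mso_sat G s S (AllV x \<phi>) \<longleftrightarrow> (\<forall>v\<in>pverts G. mso_sat G (s(x := v)) S \<phi>)"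
| "mso_sat G s S (ExS X \<phi>) \<longleftrightarrow> (\<exists>A\<subseteq>pverts G. mso_sat G s (S(X := A)) \<phi>)"
| "mso_sat G s S (AllS X \<phi>) \<longleftrightarrow> (\<forall>A\<subseteq>pverts G. mso_sat G s (S(X := A)) \<phi>)"

text \<open>Only used for sentences, whose truth value does not depend on the assignments.\<close>

definition mso_models :: "'a pair_pre_digraph \<Rightarrow> mso \<Rightarrow> bool" (infix \<open>\<Turnstile>\<close> 50) where
  "G \<Turnstile> \<phi> \<longleftrightarrow> (\<forall>s S. mso_sat G s S \<phi>)"

end

theory Submission
  imports
    Defs
    "HOL-Library.FSet"
    "HOL-Real_Asymp.Real_Asymp"
begin

text \<open>
  Graphs of the class have no large complete minor, hence they are sparse, and each has linearly many
  pairs of vertices that are twins or adjacent and of bounded degree. A graph is determined up to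
  boundedly many choices by what remains after deleting a twin or contracting such an edge, so the
  class has at most \<open>n! C\<^sup>n\<close> graphs on \<open>n\<close> labels. Linking two connected graphs by an edge
  shows that the number of connected graphs, divided by \<open>n!\<close>, is supermultiplicative up to a linear
  factor, so it has a growth constant. If connected graphs without a pendant copy of a fixed rooted
  graph \<open>M\<close> were not rare, attaching copies of \<open>M\<close> to them would exceed that growth; hence a random
  connected graph contains a pendant copy of \<open>M\<close> with probability tending to 1.

  There are finitely many types of rooted graphs of a given quantifier rank, and the type of a root with
  branches attached depends only on the number of branches of each type, counted up to a threshold.
  Let \<open>M\<close> be a root carrying sufficiently many branches of each type that occurs in the class. A
  connected graph with a pendant copy of \<open>M\<close> arises from \<open>M\<close> by one further branch at the root, and
  so satisfies the same sentences of the given rank as \<open>M\<close>.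
\<close>

section \<open>Graphs and connectivity\<close>

text \<open>Joining two connected graphs by an edge can be undone: the joined graph with the linking
  arc marked determines both parts. A graph on n vertices has at most d n arcs to mark, and the ends
  can be chosen in all possible ways, so n c_n / (d n!) is supermultiplicative without any error
  term, where c_n counts connected graphs. The bound on the whole class only keeps the growth
  constant finite. Attaching j pendant copies with h vertices to graphs without any multiplies the
  normalised number of graphs by at least (n / (h! j))^j; for j near \<alpha> n with \<alpha> small,
  each copy gains more than the factor e^(L h) that growth rate L allows for h vertices. The
  attached copies must be recognisable afterwards: copies in a large connected graph are disjoint,
  and attaching only outside the earlier copies neither destroys one nor creates another. One
  pendant copy is enough for the logic, because the rest of the graph, however large, is a single
  branch at its root. The links at the root do not fit a composition theorem for disjoint unions;
  they are restored from two labels, one for the root and one for the attachment vertices.\<close>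

lemma pair_graph_iff:
  "pair_graph G \<longleftrightarrow> finite (pverts G) \<and> parcs G \<subseteq> pverts G \<times> pverts G \<and> sym (parcs G) \<and> irrefl (parcs G)"
proof
  assume "pair_graph G"
  then interpret pair_graph G .
  have "sym (parcs G)"
    using pair_sym_arcs by (simp add: symmetric_def)
  moreover have "irrefl (parcs G)"
    by (auto simp: irrefl_def dest: no_loops')
  ultimately show "finite (pverts G) \<and> parcs G \<subseteq> pverts G \<times> pverts G \<and> sym (parcs G) \<and> irrefl (parcs G)"
    using in_arcsD1 in_arcsD2 pair_finite_verts by auto
next
  assume "finite (pverts G) \<and> parcs G \<subseteq> pverts G \<times> pverts G \<and> sym (parcs G) \<and> irrefl (parcs G)"
  then show "pair_graph G"
    by unfold_locales
      (auto simp: symmetric_def irrefl_def intro: finite_subset[of _ "pverts G \<times> pverts G"])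
qed

lemma pair_graphD:
  assumes "pair_graph G"
  shows "finite (pverts G)" "finite (parcs G)" "\<And>x y. (x, y) \<in> parcs G \<Longrightarrow> x \<in> pverts G"
    "\<And>x y. (x, y) \<in> parcs G \<Longrightarrow> y \<in> pverts G" "\<And>x y. (x, y) \<in> parcs G \<Longrightarrow> (y, x) \<in> parcs G"
    "\<And>x y. (x, y) \<in> parcs G \<Longrightarrow> x \<noteq> y" "\<And>x. (x, x) \<notin> parcs G"
  using assms unfolding pair_graph_iff
  by (auto simp: sym_def irrefl_def intro: finite_subset[of _ "pverts G \<times> pverts G"])

lemmas pair_graph_arcD = pair_graphD(3-6)

lemma pair_graphI:
  assumes "finite (pverts G)" "\<And>x y. (x, y) \<in> parcs G \<Longrightarrow> x \<in> pverts G"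
    "\<And>x y. (x, y) \<in> parcs G \<Longrightarrow> (y, x) \<in> parcs G" "\<And>x. (x, x) \<notin> parcs G"
  shows "pair_graph G"
  using assms unfolding pair_graph_iff sym_def irrefl_def by auto

lemma graph_eqI:
  fixes G H :: "'a pair_pre_digraph"
  assumes "pverts G = pverts H" "parcs G = parcs H"
  shows "G = H"
  using assms by simp

definition relabel :: "('a \<Rightarrow> 'b) \<Rightarrow> 'a pair_pre_digraph \<Rightarrow> 'b pair_pre_digraph" where
  "relabel f G = \<lparr>pverts = f ` pverts G, parcs = map_prod f f ` parcs G\<rparr>"

lemma relabel_simps [simp]:
  "pverts (relabel f G) = f ` pverts G" "parcs (relabel f G) = map_prod f f ` parcs G"
  by (auto simp: relabel_def)

lemma parcs_relabel_iff:
  assumes "pair_graph G" "inj_on f (pverts G)" "x \<in> pverts G" "y \<in> pverts G"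
  shows "(f x, f y) \<in> parcs (relabel f G) \<longleftrightarrow> (x, y) \<in> parcs G"
proof
  assume "(f x, f y) \<in> parcs (relabel f G)"
  then obtain a b where ab: "(a, b) \<in> parcs G" "f x = f a" "f y = f b"
    by auto
  then have "x = a" "y = b"
    using inj_onD[OF assms(2)] assms(3,4) pair_graph_arcD(1,2)[OF assms(1) ab(1)] by blast+
  with ab show "(x, y) \<in> parcs G"
    by simp
qed auto

lemma pair_graph_relabel:
  assumes G: "pair_graph G" and f: "inj_on f (pverts G)"
  shows "pair_graph (relabel f G)"
proof (rule pair_graphI)
  show "finite (pverts (relabel f G))"
    using pair_graphD(1)[OF G] by simp
  show "x \<in> pverts (relabel f G)" "(y, x) \<in> parcs (relabel f G)" if "(x, y) \<in> parcs (relabel f G)" for x y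
    using that by (force dest: pair_graph_arcD[OF G])+
  show "(x, x) \<notin> parcs (relabel f G)" for x
    using inj_onD[OF f] by (auto dest: pair_graph_arcD[OF G])
qed

lemma relabel_relabel: "relabel g (relabel f G) = relabel (g \<circ> f) G"
  by (intro graph_eqI) (auto simp: image_comp map_prod.comp)

lemma relabel_cong:
  assumes "pair_graph G" "\<And>x. x \<in> pverts G \<Longrightarrow> f x = g x"
  shows "relabel f G = relabel g G"
  using pair_graphD[OF assms(1)] assms(2) by (intro graph_eqI) (auto intro!: image_cong)

lemma relabel_ident: "pair_graph G \<Longrightarrow> (\<And>x. x \<in> pverts G \<Longrightarrow> f x = x) \<Longrightarrow> relabel f G = G"
  using relabel_cong[of G f id] by (simp add: relabel_def id_def)

lemma digraph_iso_relabel: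
  assumes G: "pair_graph G" and f: "inj_on f (pverts G)"
  shows "digraph_iso (with_proj G) (with_proj (relabel f G))"
proof -
  let ?h = "\<lparr>iso_verts = f, iso_arcs = map_prod f f, iso_head = snd, iso_tail = fst\<rparr>"
  have "inj_on (map_prod f f) (parcs G)"
    using inj_onD[OF f] pair_graphD[OF G] by (auto simp: inj_on_def)
  moreover have "wf_digraph (with_proj G)"
    using pair_graphD[OF G] by unfold_locales auto
  ultimately have "pre_digraph.digraph_isomorphism (with_proj G) ?h"
    using f by (auto simp: pre_digraph.digraph_isomorphism_def)
  moreover have "with_proj (relabel f G) = app_iso ?h (with_proj G)"
    by (simp add: with_proj_def app_iso_def)
  ultimately show ?thesis
    unfolding digraph_iso_def by blast
qed

definition induce :: "'a set \<Rightarrow> 'a pair_pre_digraph \<Rightarrow> 'a pair_pre_digraph" where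
  "induce S G = \<lparr>pverts = pverts G \<inter> S, parcs = parcs G \<inter> S \<times> S\<rparr>"

lemma induce_simps [simp]:
  "pverts (induce S G) = pverts G \<inter> S" "parcs (induce S G) = parcs G \<inter> S \<times> S"
  by (auto simp: induce_def)

lemma pair_graph_induce: "pair_graph G \<Longrightarrow> pair_graph (induce S G)"
  by (intro pair_graphI) (auto dest: pair_graphD(1) pair_graph_arcD)

definition graph_union :: "'a pair_pre_digraph \<Rightarrow> 'a pair_pre_digraph \<Rightarrow> 'a pair_pre_digraph" where
  "graph_union G H = \<lparr>pverts = pverts G \<union> pverts H, parcs = parcs G \<union> parcs H\<rparr>"

lemma graph_union_simps [simp]:
  "pverts (graph_union G H) = pverts G \<union> pverts H" "parcs (graph_union G H) = parcs G \<union> parcs H"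
  by (auto simp: graph_union_def)

lemma pair_graph_union: "pair_graph G \<Longrightarrow> pair_graph H \<Longrightarrow> pair_graph (graph_union G H)"
  by (intro pair_graphI) (auto dest: pair_graphD(1) pair_graph_arcD)

lemma add_edge_simps [simp]:
  "pverts (add_edge u v G) = pverts G" "parcs (add_edge u v G) = parcs G \<union> {(u, v), (v, u)}"
  by (auto simp: add_edge_def)

lemma delete_vertex_simps [simp]:
  "pverts (delete_vertex v G) = pverts G - {v}"
  "parcs (delete_vertex v G) = {(x, y) \<in> parcs G. x \<noteq> v \<and> y \<noteq> v}"
  by (auto simp: delete_vertex_def)

lemma delete_edge_simps [simp]:
  "pverts (delete_edge u v G) = pverts G" "parcs (delete_edge u v G) = parcs G - {(u, v), (v, u)}"
  by (auto simp: delete_edge_def)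

lemma contract_edge_simps [simp]:
  "pverts (contract_edge u v G) = pverts G - {v}"
  "parcs (contract_edge u v G) = map_prod (id(v := u)) (id(v := u)) ` parcs G - Id"
  by (auto simp: contract_edge_def)

definition join :: "'a \<Rightarrow> 'a \<Rightarrow> 'a pair_pre_digraph \<Rightarrow> 'a pair_pre_digraph \<Rightarrow> 'a pair_pre_digraph" where
  "join u v G H = add_edge u v (graph_union G H)"

lemma join_simps [simp]:
  "pverts (join u v G H) = pverts G \<union> pverts H"
  "parcs (join u v G H) = parcs G \<union> parcs H \<union> {(u, v), (v, u)}"
  by (auto simp: join_def)

text \<open>Connectedness by cuts instead of walks: each use below picks a vertex set and obtains
  one arc leaving it. The null graph is excluded, as in the library notion.\<close>

definition cut_connected :: "'a pair_pre_digraph \<Rightarrow> bool" where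
  "cut_connected G \<longleftrightarrow> pverts G \<noteq> {} \<and>
     (\<forall>S. S \<noteq> {} \<longrightarrow> S \<subset> pverts G \<longrightarrow> (\<exists>u\<in>S. \<exists>v\<in>pverts G - S. (u, v) \<in> parcs G))"

lemma cut_connectedD:
  assumes "cut_connected G" "S \<noteq> {}" "S \<subset> pverts G"
  obtains u v where "u \<in> S" "v \<in> pverts G" "v \<notin> S" "(u, v) \<in> parcs G"
  using assms unfolding cut_connected_def by blast

text \<open>A walk from \<open>S\<close> to its complement contains an arc leaving \<open>S\<close>;
  conversely, no arc leaves the set reachable from \<open>u\<close>, so that set is
  everything.\<close>

lemma strongly_connected_iff_cut_connected:
  assumes "pair_wf_digraph G"
  shows "strongly_connected (with_proj G) \<longleftrightarrow> cut_connected G"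
proof
  assume sc: "strongly_connected (with_proj G)"
  have "\<exists>u\<in>S. \<exists>v\<in>pverts G - S. (u, v) \<in> parcs G" if S: "S \<noteq> {}" "S \<subset> pverts G" for S
  proof -
    obtain x y where xy: "x \<in> S" "y \<in> pverts G" "y \<notin> S"
      using S by blast
    then have "(x, y) \<in> rtrancl_on (pverts G) (parcs G)"
      using sc S unfolding strongly_connected_def reachable_def by auto
    then have "y \<in> S \<or> (\<exists>u\<in>S. \<exists>v\<in>pverts G - S. (u, v) \<in> parcs G)"
      using xy(1) by (induction rule: rtrancl_on_induct) auto
    with xy show ?thesis by blast
  qed
  with sc show "cut_connected G"
    unfolding cut_connected_def strongly_connected_def by auto
next
  assume cc: "cut_connected G"
  show "strongly_connected (with_proj G)"
  proof
    show "verts (with_proj G) \<noteq> {}"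
      using cc by (auto simp: cut_connected_def)
    fix u v assume uv: "u \<in> verts (with_proj G)" "v \<in> verts (with_proj G)"
    define S where "S = {w \<in> pverts G. (u, w) \<in> rtrancl_on (pverts G) (parcs G)}"
    have "u \<in> S"
      using uv by (auto simp: S_def)
    have "S = pverts G"
    proof (rule ccontr)
      assume "S \<noteq> pverts G"
      with \<open>u \<in> S\<close> obtain a b where "a \<in> S" "b \<in> pverts G" "b \<notin> S" "(a, b) \<in> parcs G"
        using cut_connectedD[OF cc, of S] by (auto simp: S_def)
      then show False
        by (auto simp: S_def intro: rtrancl_on_into_rtrancl_on)
    qed
    with uv show "u \<rightarrow>\<^sup>*\<^bsub>with_proj G\<^esub> v"
      by (auto simp: S_def reachable_def)
  qed
qed

lemma connected_iff_cut_connected: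
  assumes "pair_graph G"
  shows "Digraph_Component.connected (with_proj G) \<longleftrightarrow> cut_connected G"
proof -
  have "(parcs G)\<^sup>s = parcs G"
    using assms by (auto simp: symcl_def pair_graph_iff sym_def)
  moreover have "pair_wf_digraph G"
    using assms by (simp add: pair_graph_def pair_digraph_def pair_fin_digraph_def)
  ultimately show ?thesis
    using strongly_connected_iff_cut_connected[of G]
    by (simp add: connected_conv strongly_connected_def reachable_def)
qed

lemma induced_subgraph_with_proj_iff:
  assumes "pair_graph G"
  shows "induced_subgraph K (with_proj G) \<longleftrightarrow> verts K \<subseteq> pverts G \<and> K = with_proj (induce (verts K) G)"
proof -
  have [simp]: "wf_digraph (with_proj H)" if "pair_graph H" for H :: "'a pair_pre_digraph"
    using pair_graphD[OF that] by unfold_locales auto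
  have "K = with_proj (induce (verts K) G) \<longleftrightarrow>
      verts K \<subseteq> pverts G \<and> arcs K = parcs G \<inter> verts K \<times> verts K \<and> tail K = fst \<and> head K = snd"
    by (cases K) (auto simp: with_proj_def)
  moreover have "wf_digraph K" if "K = with_proj (induce (verts K) G)"
    by (subst that) (simp add: assms pair_graph_induce)
  ultimately show ?thesis
    unfolding induced_subgraph_def subgraph_def compatible_def
    using assms by (auto simp: pair_graph_induce)
qed

lemma with_proj_inj [simp]: "with_proj G = with_proj H \<longleftrightarrow> G = H"
  by (cases G; cases H) (auto simp: with_proj_def)

text \<open>Replaces the library components by maximal connected vertex sets, the form in which the
  components of a disjoint union can be computed.\<close>

lemma components_conv:
  assumes "pair_graph G"
  shows "components G = {induce S G | S. S \<subseteq> pverts G \<and> cut_connected (induce S G) \<and>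
     (\<forall>T. S \<subset> T \<longrightarrow> T \<subseteq> pverts G \<longrightarrow> \<not> cut_connected (induce T G))}" (is "_ = ?R")
proof -
  have sc: "strongly_connected (with_proj (induce S G)) \<longleftrightarrow> cut_connected (induce S G)" for S
    using pair_graph_induce[OF assms]
    by (intro strongly_connected_iff_cut_connected) (simp add: pair_graph_def pair_digraph_def pair_fin_digraph_def)
  have max: "(\<exists>c. induced_subgraph c (with_proj G) \<and> strongly_connected c \<and> S \<subset> verts c) \<longleftrightarrow>
      (\<exists>T. S \<subset> T \<and> T \<subseteq> pverts G \<and> cut_connected (induce T G))" for S
    unfolding induced_subgraph_with_proj_iff[OF assms]
  proof (rule iffI; elim exE conjE)
    fix T assume "S \<subset> T" "T \<subseteq> pverts G" "cut_connected (induce T G)"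
    then show "\<exists>c. (verts c \<subseteq> pverts G \<and> c = with_proj (induce (verts c) G)) \<and> strongly_connected c \<and> S \<subset> verts c"
      by (intro exI[of _ "with_proj (induce T G)"]) (auto simp: sc Int_absorb1)
  next
    fix c :: "('a, 'a \<times> 'a) pre_digraph"
    assume c: "verts c \<subseteq> pverts G" "c = with_proj (induce (verts c) G)" "strongly_connected c" "S \<subset> verts c"
    then have "cut_connected (induce (verts c) G)"
      using sc[of "verts c"] by (simp only:)
    with c(1,4) show "\<exists>T. S \<subset> T \<and> T \<subseteq> pverts G \<and> cut_connected (induce T G)"
      by blast
  qed
  have comp: "K \<in> components G \<longleftrightarrow> (pverts K \<subseteq> pverts G \<and> K = induce (pverts K) G) \<and> cut_connected K \<and>
      \<not> (\<exists>T. pverts K \<subset> T \<and> T \<subseteq> pverts G \<and> cut_connected (induce T G))" for K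
  proof -
    have "K \<in> components G \<longleftrightarrow> induced_subgraph (with_proj K) (with_proj G) \<and>
        strongly_connected (with_proj K) \<and>
        \<not> (\<exists>c. induced_subgraph c (with_proj G) \<and> strongly_connected c \<and> pverts K \<subset> verts c)"
      by (simp add: components_def pre_digraph.sccs_def)
    also have "\<dots> \<longleftrightarrow> (pverts K \<subseteq> pverts G \<and> K = induce (pverts K) G) \<and> strongly_connected (with_proj K) \<and>
        \<not> (\<exists>T. pverts K \<subset> T \<and> T \<subseteq> pverts G \<and> cut_connected (induce T G))"
      unfolding max by (simp only: induced_subgraph_with_proj_iff[OF assms] with_proj_inj with_proj_simps)
    finally show ?thesis
      using sc[of "pverts K"] by metis
  qed
  show ?thesis
  proof (intro set_eqI iffI)
    fix K assume "K \<in> components G"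
    then have K: "pverts K \<subseteq> pverts G" "K = induce (pverts K) G" "cut_connected K"
      "\<forall>T. pverts K \<subset> T \<longrightarrow> T \<subseteq> pverts G \<longrightarrow> \<not> cut_connected (induce T G)"
      unfolding comp by blast+
    have "cut_connected (induce (pverts K) G)"
      by (rule subst[OF K(2), of cut_connected, OF K(3)])
    with K show "K \<in> ?R"
      by blast
  next
    fix K assume "K \<in> ?R"
    then obtain S where "K = induce S G" "pverts K = S" "S \<subseteq> pverts G" "cut_connected (induce S G)"
      "\<forall>T. S \<subset> T \<longrightarrow> T \<subseteq> pverts G \<longrightarrow> \<not> cut_connected (induce T G)"
      by (auto simp: Int_absorb1)
    then show "K \<in> components G"
      unfolding comp by simp
  qed
qed

lemma cut_connected_disjoint_union_cases:
  assumes "cut_connected (induce S (graph_union G H))" "S \<subseteq> pverts G \<union> pverts H"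
    and "pair_graph G" "pair_graph H" "pverts G \<inter> pverts H = {}"
  shows "S \<subseteq> pverts G \<or> S \<subseteq> pverts H"
proof (rule ccontr)
  assume "\<not> ?thesis"
  then have *: "S \<inter> pverts G \<noteq> {}" "S \<inter> pverts G \<subset> pverts (induce S (graph_union G H))"
    using assms(2) by auto
  obtain u v where "u \<in> S \<inter> pverts G" "v \<in> S" "v \<notin> S \<inter> pverts G" "(u, v) \<in> parcs G \<union> parcs H"
    by (rule cut_connectedD[OF assms(1) *]) auto
  then show False
    using assms(5) by (auto dest: pair_graph_arcD[OF assms(3)] pair_graph_arcD[OF assms(4)])
qed

text \<open>The bridge to the hypotheses on the class: decomposability then places the disjoint
  union in it, and addability allows an edge between the two components.\<close>

lemma components_disjoint_union:
  assumes G: "pair_graph G" "cut_connected G" and H: "pair_graph H" "cut_connected H"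
    and disj: "pverts G \<inter> pverts H = {}"
  shows "components (graph_union G H) = {G, H}"
proof -
  let ?U = "graph_union G H"
  have iG: "induce (pverts G) ?U = G"
    using disj by (intro graph_eqI) (auto dest: pair_graph_arcD[OF G(1)] pair_graph_arcD[OF H(1)])
  have iH: "induce (pverts H) ?U = H"
    using disj by (intro graph_eqI) (auto dest: pair_graph_arcD[OF G(1)] pair_graph_arcD[OF H(1)])
  have cases: "S \<subseteq> pverts G \<or> S \<subseteq> pverts H" if "cut_connected (induce S ?U)" "S \<subseteq> pverts ?U" for S
    using cut_connected_disjoint_union_cases[OF that(1) _ G(1) H(1) disj] that(2) by simp
  have ne: "pverts G \<noteq> {}" "pverts H \<noteq> {}"
    using G H by (auto simp: cut_connected_def)
  show ?thesis
    unfolding components_conv[OF pair_graph_union[OF G(1) H(1)]]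
  proof (intro set_eqI iffI)
    fix K
    assume "K \<in> {induce S ?U |S. S \<subseteq> pverts ?U \<and> cut_connected (induce S ?U) \<and>
       (\<forall>T. S \<subset> T \<longrightarrow> T \<subseteq> pverts ?U \<longrightarrow> \<not> cut_connected (induce T ?U))}"
    then obtain S where S: "K = induce S ?U" "S \<subseteq> pverts ?U" "cut_connected (induce S ?U)"
      "\<And>T. S \<subset> T \<Longrightarrow> T \<subseteq> pverts ?U \<Longrightarrow> \<not> cut_connected (induce T ?U)"
      by blast
    have "S = pverts G \<or> S = pverts H"
      using cases[OF S(3,2)] S(4)[of "pverts G"] S(4)[of "pverts H"] iG iH G(2) H(2) by auto
    then show "K \<in> {G, H}"
      using iG iH S(1) by auto
  next
    fix K assume K: "K \<in> {G, H}"
    have G_max: "\<not> cut_connected (induce T ?U)" if "pverts G \<subset> T" "T \<subseteq> pverts ?U" for T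
      using cases[OF _ that(2)] that disj ne by blast
    have H_max: "\<not> cut_connected (induce T ?U)" if "pverts H \<subset> T" "T \<subseteq> pverts ?U" for T
      using cases[OF _ that(2)] that disj ne by blast
    have "G = induce (pverts G) ?U \<and> pverts G \<subseteq> pverts ?U \<and> cut_connected (induce (pverts G) ?U)"
      "H = induce (pverts H) ?U \<and> pverts H \<subseteq> pverts ?U \<and> cut_connected (induce (pverts H) ?U)"
      unfolding iG iH using G(2) H(2) by auto
    with K G_max H_max show "K \<in> {induce S ?U |S. S \<subseteq> pverts ?U \<and> cut_connected (induce S ?U) \<and>
       (\<forall>T. S \<subset> T \<longrightarrow> T \<subseteq> pverts ?U \<longrightarrow> \<not> cut_connected (induce T ?U))}"
      by blast
  qed
qed

lemma cut_connected_join: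
  assumes G: "cut_connected G" and H: "cut_connected H" and u: "u \<in> pverts G" and v: "v \<in> pverts H"
  shows "cut_connected (join u v G H)"
  unfolding cut_connected_def
proof (intro conjI allI impI)
  show "pverts (join u v G H) \<noteq> {}"
    using u by auto
  fix S assume S: "S \<noteq> {}" "S \<subset> pverts (join u v G H)"
  \<comment> \<open>If \<open>S\<close> splits neither vertex set, it equals one of them, and the
    link between \<open>u\<close> and \<open>v\<close> crosses the cut.\<close>
  consider "S \<inter> pverts G \<noteq> {}" "S \<inter> pverts G \<subset> pverts G" | "S \<inter> pverts H \<noteq> {}" "S \<inter> pverts H \<subset> pverts H"
    | "u \<in> S" "v \<notin> S" | "u \<notin> S" "v \<in> S"
    using S u v by auto
  then show "\<exists>a\<in>S. \<exists>b\<in>pverts (join u v G H) - S. (a, b) \<in> parcs (join u v G H)"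
  proof cases
    case 1
    then show ?thesis
      by (rule cut_connectedD[OF G]) auto
  next
    case 2
    then show ?thesis
      by (rule cut_connectedD[OF H]) auto
  qed (use u v in auto)
qed

lemma cut_connected_relabel:
  assumes "pair_graph G" "cut_connected G" "inj_on f (pverts G)"
  shows "cut_connected (relabel f G)"
  unfolding cut_connected_def
proof (intro conjI allI impI)
  show "pverts (relabel f G) \<noteq> {}"
    using assms by (auto simp: cut_connected_def)
  fix S assume S: "S \<noteq> {}" "S \<subset> pverts (relabel f G)"
  let ?S = "{x \<in> pverts G. f x \<in> S}"
  have "?S \<noteq> {}" "?S \<subset> pverts G"
    using S by auto
  then obtain u v where "u \<in> ?S" "v \<in> pverts G" "v \<notin> ?S" "(u, v) \<in> parcs G"
    by (rule cut_connectedD[OF assms(2)])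
  then have "f u \<in> S" "f v \<in> pverts (relabel f G) - S" "(f u, f v) \<in> parcs (relabel f G)"
    by (auto intro: map_prod_imageI)
  then show "\<exists>a\<in>S. \<exists>b\<in>pverts (relabel f G) - S. (a, b) \<in> parcs (relabel f G)"
    by blast
qed

section \<open>Minor-closed sets of graphs\<close>

text \<open>Kept free of the class \<open>\<G>\<close>: the induction on dense graphs passes to
  another set, the graphs that have a cone in the given one.\<close>

locale minor_closed_set =
  fixes P :: "'a pair_pre_digraph set"
  assumes graph: "\<And>G. G \<in> P \<Longrightarrow> pair_graph G"
    and minor: "\<And>G H. G \<in> P \<Longrightarrow> minor_step G H \<Longrightarrow> H \<in> P"
begin

lemma induce_mem:
  assumes "G \<in> P"
  shows "induce S G \<in> P"
proof -
  have "induce (- T) G \<in> P" if "finite T" "T \<subseteq> pverts G" for T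
    using that
  proof (induction T rule: finite_induct)
    case empty
    have "induce (- {}) G = G" by (intro graph_eqI) auto
    then show ?case using assms by metis
  next
    case (insert v T)
    have "minor_step (induce (- T) G) (delete_vertex v (induce (- T) G))"
      using insert by (intro vertex_deletion) auto
    moreover have "delete_vertex v (induce (- T) G) = induce (- insert v T) G"
      by (intro graph_eqI) auto
    ultimately show ?case
      using insert minor by auto
  qed
  from this[of "pverts G - S"] have "induce (- (pverts G - S)) G \<in> P"
    using pair_graphD(1)[OF graph[OF assms]] by simp
  moreover have "induce (- (pverts G - S)) G = induce S G"
    using pair_graphD[OF graph[OF assms]] by (intro graph_eqI) auto
  ultimately show ?thesis by simp
qed

lemma spanning_subgraph_mem:
  assumes "G \<in> P" "pair_graph H" "pverts H = pverts G" "parcs H \<subseteq> parcs G"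
  shows "H \<in> P"
  using assms(1,3,4)
proof (induction "card (parcs G - parcs H)" arbitrary: G rule: less_induct)
  case less
  note G = pair_graphD[OF graph[OF less.prems(1)]]
  show ?case
  proof (cases "parcs G = parcs H")
    case True
    then show ?thesis using less.prems by (metis graph_eqI)
  next
    case False
    then obtain u v where uv: "(u, v) \<in> parcs G" "(u, v) \<notin> parcs H"
      using less.prems by auto
    let ?G = "delete_edge u v G"
    have "(v, u) \<notin> parcs H"
      using uv pair_graphD(5)[OF assms(2)] by blast
    with uv less.prems have "parcs H \<subseteq> parcs ?G" "(u, v) \<in> parcs G - parcs H" "(u, v) \<notin> parcs ?G - parcs H"
      by auto
    moreover from this have "card (parcs ?G - parcs H) < card (parcs G - parcs H)"
      using G(2) by (intro psubset_card_mono) auto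
    moreover have "?G \<in> P"
      using minor[OF less.prems(1) edge_deletion[OF uv(1)]] .
    ultimately show ?thesis
      using less.hyps[of ?G] less.prems by simp
  qed
qed

end

section \<open>Proper minor-closed classes are small\<close>

lemma pair_graph_minor_step:
  assumes G: "pair_graph G" and step: "minor_step G H"
  shows "pair_graph H"
  using step
proof cases
  case (vertex_deletion v)
  then show ?thesis
    using pair_graphD(1)[OF G] by (intro pair_graphI) (auto dest: pair_graph_arcD[OF G])
next
  case (edge_deletion u v)
  then show ?thesis
    using pair_graphD(1)[OF G] by (intro pair_graphI) (auto dest: pair_graph_arcD[OF G])
next
  case (edge_contraction u v)
  have uv: "u \<in> pverts G" "u \<noteq> v"
    using pair_graph_arcD[OF G edge_contraction(2)] by auto
  show ?thesis
    unfolding edge_contraction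
  proof (rule pair_graphI)
    show "finite (pverts (contract_edge u v G))"
      using pair_graphD(1)[OF G] by simp
    fix x y assume "(x, y) \<in> parcs (contract_edge u v G)"
    then obtain a b where ab: "(a, b) \<in> parcs G" "x = (id(v := u)) a" "y = (id(v := u)) b" "x \<noteq> y"
      by auto
    then show "x \<in> pverts (contract_edge u v G)"
      using uv by (auto dest: pair_graph_arcD[OF G])
    have "(b, a) \<in> parcs G"
      using ab(1) by (rule pair_graph_arcD[OF G])
    then have "map_prod (id(v := u)) (id(v := u)) (b, a) \<in> map_prod (id(v := u)) (id(v := u)) ` parcs G"
      by (rule imageI)
    then show "(y, x) \<in> parcs (contract_edge u v G)"
      using ab(2-4) by simp
  qed simp
qed

section \<open>Complete minors in dense graphs\<close>

text \<open>The cone over \<open>G\<close> with tip \<open>w\<close>. A vertex together with its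
  neighbourhood contains such a cone, and the cone over a complete graph is complete with one vertex
  more.\<close>

definition apex :: "'a \<Rightarrow> 'a pair_pre_digraph \<Rightarrow> 'a pair_pre_digraph" where
  "apex w G = \<lparr>pverts = insert w (pverts G), parcs = parcs G \<union> {w} \<times> pverts G \<union> pverts G \<times> {w}\<rparr>"

lemma apex_simps [simp]:
  "pverts (apex w G) = insert w (pverts G)"
  "parcs (apex w G) = parcs G \<union> {w} \<times> pverts G \<union> pverts G \<times> {w}"
  by (auto simp: apex_def)

lemma parcs_contract_edgeI:
  assumes "(p, q) \<in> parcs G" "x = (id(v := u)) p" "y = (id(v := u)) q" "x \<noteq> y"
  shows "(x, y) \<in> parcs (contract_edge u v G)"
  using imageI[OF assms(1), of "map_prod (id(v := u)) (id(v := u))"] assms(2-4) by simp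

lemma image_map_prod_times: "map_prod f g ` (A \<times> B) = (f ` A) \<times> (g ` B)"
  by force

text \<open>A step on \<open>G\<close> never deletes or merges \<open>w\<close>, so the same step
  performed on the cone yields the cone over the result. Hence the graphs with a cone in a
  minor-closed set again form such a set.\<close>

lemma minor_step_apex:
  assumes G: "pair_graph G" and w: "w \<notin> pverts G" and step: "minor_step G H"
  shows "minor_step (apex w G) (apex w H) \<and> w \<notin> pverts H"
  using step
proof cases
  case (vertex_deletion v)
  then have "apex w H = delete_vertex v (apex w G)"
    using w by (intro graph_eqI) (auto dest: pair_graph_arcD[OF G])
  then show ?thesis
    using vertex_deletion w by (auto intro: minor_step.vertex_deletion)
next
  case (edge_deletion u v)
  then have "apex w H = delete_edge u v (apex w G)"
    using w by (intro graph_eqI) (auto dest: pair_graph_arcD[OF G])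
  then show ?thesis
    using edge_deletion w by (auto intro: minor_step.edge_deletion)
next
  case (edge_contraction u v)
  let ?f = "id(v := u)"
  have uv: "u \<in> pverts G" "v \<in> pverts G" "u \<noteq> v" "w \<noteq> u" "w \<noteq> v"
    using pair_graph_arcD[OF G edge_contraction(2)] w by auto
  have img: "?f ` pverts G = pverts G - {v}"
    using uv by (force simp: image_iff)
  have "map_prod ?f ?f ` ({w} \<times> pverts G) = {w} \<times> (pverts G - {v})"
    "map_prod ?f ?f ` (pverts G \<times> {w}) = (pverts G - {v}) \<times> {w}"
    unfolding image_map_prod_times img using uv by auto
  then have "apex w H = contract_edge u v (apex w G)"
    using uv w unfolding edge_contraction
    by (intro graph_eqI) (simp_all add: image_Un, auto)
  then show ?thesis
    using edge_contraction w by (auto intro: minor_step.edge_contraction)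
qed

definition complete :: "'a set \<Rightarrow> 'a pair_pre_digraph" where
  "complete S = \<lparr>pverts = S, parcs = S \<times> S - Id\<rparr>"

lemma complete_simps [simp]: "pverts (complete S) = S" "parcs (complete S) = S \<times> S - Id"
  by (auto simp: complete_def)

abbreviation nbrs :: "'a pair_pre_digraph \<Rightarrow> 'a \<Rightarrow> 'a set" where
  "nbrs G v \<equiv> parcs G `` {v}"

lemma card_parcs: "pair_graph G \<Longrightarrow> card (parcs G) = (\<Sum>v\<in>pverts G. card (nbrs G v))"
proof -
  assume G: "pair_graph G"
  have "parcs G = (SIGMA v:pverts G. nbrs G v)"
    by (auto dest: pair_graph_arcD[OF G])
  then have "card (parcs G) = card (SIGMA v:pverts G. nbrs G v)"
    by (rule arg_cong)
  also have "\<dots> = (\<Sum>v\<in>pverts G. card (nbrs G v))"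
    using pair_graphD(1,2)[OF G] by (intro card_SigmaI) (auto intro: finite_Image)
  finally show ?thesis .
qed

text \<open>Each edge counts as two arcs. The contraction loses \<open>uv\<close> itself, and for
  each common neighbour two edges merge into one; the other neighbours of \<open>v\<close> survive
  as new neighbours of \<open>u\<close>.\<close>

lemma card_parcs_contract_edge:
  assumes G: "pair_graph G" and uv: "(u, v) \<in> parcs G"
  shows "card (parcs G) \<le> card (parcs (contract_edge u v G)) + 2 + 2 * card (nbrs G u \<inter> nbrs G v)"
proof -
  note [simp] = pair_graphD(2)[OF G]
  have vu: "(v, u) \<in> parcs G" "u \<noteq> v"
    using pair_graph_arcD[OF G uv] by auto
  have no_loop: "(x, x) \<notin> parcs G" for x
    using pair_graphD(7)[OF G] .
  let ?E = "{(x, y) \<in> parcs G. x \<noteq> v \<and> y \<noteq> v}"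
  let ?C = "nbrs G u \<inter> nbrs G v"
  let ?D = "nbrs G v - nbrs G u - {u}"
  have fin: "finite (nbrs G x)" for x
    by (rule finite_Image) simp
  have finE: "finite ?E"
    by (rule finite_subset[of _ "parcs G"]) auto
  have N: "nbrs G v = {u} \<union> ?C \<union> ?D"
    using vu by auto
  have "card (nbrs G v) = card ({u} \<union> ?C) + card ?D"
    by (subst N, rule card_Un_disjoint) (auto simp: fin)
  also have "card ({u} \<union> ?C) = 1 + card ?C"
    by (subst card_Un_disjoint) (auto simp: fin no_loop)
  finally have cN: "card (nbrs G v) = 1 + card ?C + card ?D" .
  have "parcs G = ?E \<union> {v} \<times> nbrs G v \<union> nbrs G v \<times> {v}"
    by (auto dest: pair_graph_arcD[OF G])
  then have "card (parcs G) \<le> card ?E + card ({v} \<times> nbrs G v) + card (nbrs G v \<times> {v})"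
    by (metis (no_types, lifting) add_le_mono1 card_Un_le order_trans)
  then have 1: "card (parcs G) \<le> card ?E + 2 * (1 + card ?C + card ?D)"
    using cN by (simp add: card_cartesian_product)
  have "?E \<union> {u} \<times> ?D \<union> ?D \<times> {u} \<subseteq> parcs (contract_edge u v G)"
  proof -
    have "(x, y) \<in> parcs (contract_edge u v G)" if "(x, y) \<in> ?E" for x y
      by (rule parcs_contract_edgeI[of x y]) (use that no_loop in auto)
    moreover have "(u, y) \<in> parcs (contract_edge u v G)" if "y \<in> ?D" for y
      by (rule parcs_contract_edgeI[of v y]) (use that no_loop in auto)
    moreover have "(y, u) \<in> parcs (contract_edge u v G)" if "y \<in> ?D" for y
    proof -
      have "(y, v) \<in> parcs G"
        using that by (auto dest: pair_graph_arcD[OF G])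
      then show ?thesis
        by (rule parcs_contract_edgeI) (use that no_loop in auto)
    qed
    ultimately show ?thesis by blast
  qed
  then have "card (?E \<union> {u} \<times> ?D \<union> ?D \<times> {u}) \<le> card (parcs (contract_edge u v G))"
    by (intro card_mono) auto
  moreover have "card (?E \<union> {u} \<times> ?D \<union> ?D \<times> {u}) = card ?E + card ({u} \<times> ?D) + card (?D \<times> {u})"
    by (subst card_Un_disjoint card_Un_disjoint;
        use vu no_loop in \<open>auto simp: fin finE dest: pair_graph_arcD[OF G]\<close>)+
  ultimately show ?thesis
    using 1 by (simp add: card_cartesian_product)
qed

text \<open>Mader's argument: in a dense graph with fewest vertices, every edge lies in many triangles,
  as contracting it would otherwise keep the graph dense. So the neighbourhood of a vertex is again
  dense, and by induction it has a complete minor.\<close>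

lemma dense_imp_complete:
  assumes "minor_closed_set P" "G \<in> P" "pverts G \<noteq> {}" "2 ^ t * card (pverts G) \<le> card (parcs G)"
  shows "\<exists>S. finite S \<and> card S = t \<and> complete S \<in> P"
  using assms
proof (induction t arbitrary: P G)
  case 0
  then interpret minor_closed_set P by simp
  have "induce {} G = complete {}"
    by (intro graph_eqI) auto
  then show ?case
    using induce_mem[OF 0(2), of "{}"] by (intro exI[of _ "{}"]) (simp del: induce_simps)
next
  case (Suc t)
  interpret minor_closed_set P by fact
  define dense where
    "dense H \<longleftrightarrow> H \<in> P \<and> pverts H \<noteq> {} \<and> 2 ^ Suc t * card (pverts H) \<le> card (parcs H)" for H
  have "dense G"
    using Suc.prems by (auto simp: dense_def)
  then obtain H where H: "dense H" and min: "\<And>K. dense K \<Longrightarrow> card (pverts H) \<le> card (pverts K)"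
    using ex_has_least_nat[of dense G "\<lambda>H. card (pverts H)"] by blast
  have HP: "H \<in> P"
    using H by (simp add: dense_def)
  note Hg = graph[OF HP]
  note fin = pair_graphD(1,2)[OF Hg]
  have "card (pverts H) > 0"
    using H fin by (auto simp: dense_def)
  then have "card (parcs H) > 0"
    using H by (auto simp: dense_def intro!: gr0I)
  then obtain u v0 where uv0: "(u, v0) \<in> parcs H"
    by (metis all_not_in_conv card_gt_0_iff surj_pair)
  have triangles: "2 ^ t \<le> card (nbrs H u \<inter> nbrs H v)" if "(u, v) \<in> parcs H" for v
  proof -
    let ?K = "contract_edge u v H"
    have uv: "u \<in> pverts H" "v \<in> pverts H" "u \<noteq> v"
      using pair_graph_arcD[OF Hg that] by auto
    then have card: "card (pverts ?K) = card (pverts H) - 1" "card (pverts ?K) < card (pverts H)"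
      using fin card_Diff1_less[OF fin(1) uv(2)] by auto
    have "?K \<in> P"
      using minor[OF HP edge_contraction[OF that]] .
    moreover have "pverts ?K \<noteq> {}"
      using uv by auto
    moreover have "\<not> dense ?K"
      using min[of ?K] card by auto
    ultimately have "card (parcs ?K) < 2 ^ Suc t * (card (pverts H) - 1)"
      using card by (auto simp: dense_def)
    moreover have "2 ^ Suc t * card (pverts H) \<le> card (parcs H)"
      using H by (simp add: dense_def)
    moreover have "2 ^ Suc t * card (pverts H) = 2 ^ Suc t * (card (pverts H) - 1) + 2 ^ Suc t"
      using \<open>card (pverts H) > 0\<close> by (cases "card (pverts H)") auto
    ultimately have "2 ^ Suc t < 2 + 2 * card (nbrs H u \<inter> nbrs H v)"
      using card_parcs_contract_edge[OF Hg that] by linarith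
    then show ?thesis by simp
  qed
  let ?N = "nbrs H u"
  let ?K = "induce ?N H"
  have NV: "?N \<subseteq> pverts H" "u \<notin> ?N" "v0 \<in> ?N"
    using uv0 by (auto dest: pair_graph_arcD[OF Hg])
  \<comment> \<open>The induction hypothesis is applied to this set: a complete graph found in it
    extends by its tip \<open>w\<close> to one in \<open>P\<close> with \<open>Suc t\<close>
    vertices.\<close>
  define Q where "Q = {K. pair_graph K \<and> (\<exists>w. w \<notin> pverts K \<and> apex w K \<in> P)}"
  have "minor_closed_set Q"
    by (rule minor_closed_set.intro)
      (auto simp: Q_def dest: pair_graph_minor_step minor_step_apex intro: minor)
  moreover have "apex u ?K = induce (insert u ?N) H"
    using NV by (intro graph_eqI) (auto dest: pair_graph_arcD[OF Hg])
  then have "?K \<in> Q"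
    using induce_mem[OF HP, of "insert u ?N"] NV pair_graph_induce[OF Hg]
    by (auto simp: Q_def intro!: exI[of _ u])
  moreover have "2 ^ t * card (pverts ?K) \<le> card (parcs ?K)"
  proof -
    have "2 ^ t * card (pverts ?K) = (\<Sum>v\<in>pverts ?K. 2 ^ t)"
      by simp
    also have "\<dots> \<le> (\<Sum>v\<in>pverts ?K. card (nbrs ?K v))"
    proof (rule sum_mono)
      fix v assume v: "v \<in> pverts ?K"
      then have "nbrs ?K v = nbrs H u \<inter> nbrs H v"
        by auto
      then show "2 ^ t \<le> card (nbrs ?K v)"
        using triangles[of v] v by simp
    qed
    finally show ?thesis
      using card_parcs[OF pair_graph_induce[OF Hg], of ?N] by simp
  qed
  moreover have "pverts ?K \<noteq> {}"
    using NV by auto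
  ultimately obtain S where S: "finite S" "card S = t" "complete S \<in> Q"
    using Suc.IH by blast
  then obtain w where w: "w \<notin> S" "apex w (complete S) \<in> P"
    by (auto simp: Q_def)
  have "apex w (complete S) = complete (insert w S)"
    using w by (intro graph_eqI) auto
  with w S show ?case
    by (intro exI[of _ "insert w S"]) auto
qed

lemma (in minor_closed_set) few_arcs:
  assumes "\<And>S. finite S \<Longrightarrow> card S = t \<Longrightarrow> complete S \<notin> P" "G \<in> P"
  shows "card (parcs G) \<le> 2 ^ t * card (pverts G)"
proof (cases "pverts G = {}")
  case True
  then have "parcs G = {}"
    by (auto dest: pair_graph_arcD[OF graph[OF assms(2)]])
  then show ?thesis by simp
next
  case False
  have "minor_closed_set P" by unfold_locales
  from dense_imp_complete[OF this assms(2) False, of t] assms(1) show ?thesis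
    by (meson linear)
qed

section \<open>Twins and low-degree edges in sparse graphs\<close>

definition cliques :: "'a pair_pre_digraph \<Rightarrow> 'a set set" where
  "cliques G = {Q. Q \<subseteq> pverts G \<and> (\<forall>x\<in>Q. \<forall>y\<in>Q. x \<noteq> y \<longrightarrow> (x, y) \<in> parcs G)}"

lemma card_subset_Diff: "finite B \<Longrightarrow> A \<subseteq> B \<Longrightarrow> card B = card A + card (B - A)"
  using card_Int_Diff[of B A] by (simp add: Int_absorb1)

text \<open>One representative is kept in every fibre, which accounts for the image; every other
  element forms a collision with the representative of its fibre.\<close>

lemma card_le_card_image_plus_collisions:
  assumes "finite B"
  shows "card B \<le> card (f ` B) + card {(x, y) \<in> B \<times> B. x \<noteq> y \<and> f x = f y}"
proof -
  define r where "r y = (SOME x. x \<in> B \<and> f x = y)" for y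
  have r: "r (f x) \<in> B" "f (r (f x)) = f x" if "x \<in> B" for x
    using someI[of "\<lambda>z. z \<in> B \<and> f z = f x" x] that by (auto simp: r_def)
  let ?R = "{x \<in> B. r (f x) = x}"
  have "card B = card ?R + card (B - ?R)"
    using assms by (intro card_subset_Diff) auto
  moreover have "card ?R \<le> card (f ` B)"
    by (rule card_inj_on_le[OF inj_on_inverseI[of _ r]]) (use assms in auto)
  moreover have "card (B - ?R) \<le> card {(x, y) \<in> B \<times> B. x \<noteq> y \<and> f x = f y}"
  proof (rule card_inj_on_le[of "\<lambda>x. (x, r (f x))"])
    show "inj_on (\<lambda>x. (x, r (f x))) (B - ?R)"
      by (rule inj_onI) simp
    show "(\<lambda>x. (x, r (f x))) ` (B - ?R) \<subseteq> {(x, y) \<in> B \<times> B. x \<noteq> y \<and> f x = f y}"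
      using r by (auto simp: eq_commute)
    show "finite {(x, y) \<in> B \<times> B. x \<noteq> y \<and> f x = f y}"
      by (rule finite_subset[of _ "B \<times> B"]) (use assms in auto)
  qed
  ultimately show ?thesis by linarith
qed

text \<open>Sparsity is required of all members, so it survives every deletion and contraction; this
  is what bounds the contraction process below.\<close>

locale sparse_minor_closed_set = minor_closed_set +
  fixes d :: nat
  assumes sparse: "\<And>G. G \<in> P \<Longrightarrow> card (parcs G) \<le> d * card (pverts G)"
begin

text \<open>The average degree is at most \<open>d\<close>, so some vertex \<open>v\<close> has
  degree at most \<open>d\<close>. A clique avoids \<open>v\<close> or is \<open>v\<close> with a
  subset of its neighbours, which costs \<open>2 ^ d\<close> per deleted vertex; the
  \<open>+ 1\<close> is the empty clique.\<close>

lemma card_cliques: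
  assumes "G \<in> P"
  shows "card (cliques G) \<le> 2 ^ d * card (pverts G) + 1"
  using assms
proof (induction "card (pverts G)" arbitrary: G)
  case 0
  then have "pverts G = {}"
    using pair_graphD(1)[OF graph[OF 0(2)]] by simp
  then have "cliques G = {{}}"
    by (auto simp: cliques_def)
  then show ?case by simp
next
  case (Suc n)
  note G = graph[OF Suc.prems]
  note fin = pair_graphD(1,2)[OF G]
  have "\<exists>v\<in>pverts G. card (nbrs G v) \<le> d"
  proof (rule ccontr)
    assume "\<not> ?thesis"
    moreover have "pverts G \<noteq> {}"
      using Suc.hyps by auto
    ultimately have "(\<Sum>v\<in>pverts G. d) < (\<Sum>v\<in>pverts G. card (nbrs G v))"
      using fin by (intro sum_strict_mono) auto
    then show False
      using sparse[OF Suc.prems] card_parcs[OF G] by (simp add: mult.commute)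
  qed
  then obtain v where v: "v \<in> pverts G" "card (nbrs G v) \<le> d"
    by blast
  let ?H = "delete_vertex v G"
  have fin_nbrs: "finite (nbrs G v)"
    using fin by (intro finite_Image)
  have fin_cl: "finite (cliques ?H)"
    using fin by (intro finite_subset[of "cliques ?H" "Pow (pverts ?H)"]) (auto simp: cliques_def)
  have "cliques G \<subseteq> cliques ?H \<union> insert v ` Pow (nbrs G v)"
  proof
    fix Q assume Q: "Q \<in> cliques G"
    show "Q \<in> cliques ?H \<union> insert v ` Pow (nbrs G v)"
    proof (cases "v \<in> Q")
      case True
      then have "Q = insert v (Q - {v})" "Q - {v} \<subseteq> nbrs G v"
        using Q by (auto simp: cliques_def)
      then show ?thesis by blast
    qed (use Q in \<open>auto simp: cliques_def\<close>)
  qed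
  then have "card (cliques G) \<le> card (cliques ?H \<union> insert v ` Pow (nbrs G v))"
    using fin_cl fin_nbrs by (intro card_mono) auto
  also have "\<dots> \<le> card (cliques ?H) + card (Pow (nbrs G v))"
    by (meson add_le_mono card_Un_le card_image_le fin_nbrs finite_Pow_iff le_refl order_trans)
  also have "card (cliques ?H) \<le> 2 ^ d * n + 1"
    using Suc.hyps(1)[of ?H] Suc.hyps(2)[symmetric] minor[OF Suc.prems vertex_deletion[OF v(1)]] v fin
    by simp
  also have "card (Pow (nbrs G v)) \<le> 2 ^ d"
    using v(2) fin_nbrs by (simp add: card_Pow)
  finally show ?case
    using Suc.hyps(2)[symmetric] by simp
qed

text \<open>Contract vertices of \<open>B\<close> into \<open>A\<close> as long as this creates a new edge inside \<open>A\<close>; by sparsity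
  this stops soon, and then the neighbourhoods of the remaining vertices are cliques.\<close>

lemma few_nbhds:
  assumes "G \<in> P" "A \<union> B \<subseteq> pverts G" "A \<inter> B = {}" "\<And>b. b \<in> B \<Longrightarrow> nbrs G b \<subseteq> A"
  obtains B' where "B' \<subseteq> B" "card (B - B') \<le> d * card A" "card (nbrs G ` B') \<le> 2 ^ d * card A + 1"
proof -
  have finV: "finite (pverts G)"
    using pair_graphD(1)[OF graph[OF assms(1)]] .
  then have finA: "finite A" and finB: "finite B"
    using assms(2) by (auto intro: finite_subset)
  \<comment> \<open>The last conjunct is the invariant of the process: every vertex of
    \<open>B\<close> used up so far is paid for by an arc inside \<open>A\<close>. Sparsity of the
    graph induced on \<open>A\<close> therefore bounds their number by
    \<open>d * card A\<close>.\<close>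
  define good where "good = (\<lambda>(H, B'). H \<in> P \<and> B' \<subseteq> B \<and> A \<union> B' \<subseteq> pverts H \<and>
    (\<forall>b\<in>B'. nbrs H b = nbrs G b) \<and> card (B - B') \<le> card (parcs (induce A H)))"
  define f where "f = (\<lambda>(H :: 'a pair_pre_digraph, B' :: 'a set). card (parcs (induce A H)))"
  have bound: "f (H, B') \<le> d * card A" if "good (H, B')" for H B'
  proof -
    have "H \<in> P" "pverts (induce A H) = A"
      using that by (auto simp: good_def)
    then show ?thesis
      using sparse[OF induce_mem, of H A] by (simp add: f_def)
  qed
  have "good (G, B)"
    using assms by (auto simp: good_def)
  then obtain x where "good x" "\<And>y. good y \<Longrightarrow> f y \<le> f x"
    using ex_has_greatest_nat[of good "(G, B)" f "d * card A + 1"] bound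
    by (metis (no_types, lifting) add.commute less_Suc_eq_le plus_1_eq_Suc surj_pair le_SucI)
  then obtain H B' where HB: "good (H, B')" and max: "\<And>y. good y \<Longrightarrow> f y \<le> f (H, B')"
    by (cases x) auto
  have H: "H \<in> P" "B' \<subseteq> B" "A \<union> B' \<subseteq> pverts H" "\<And>b. b \<in> B' \<Longrightarrow> nbrs H b = nbrs G b"
    "card (B - B') \<le> card (parcs (induce A H))"
    using HB by (auto simp: good_def)
  note Hg = graph[OF H(1)]
  have "nbrs G b \<in> cliques (induce A H)" if b: "b \<in> B'" for b
  proof (rule ccontr)
    assume "\<not> ?thesis"
    moreover have bA: "nbrs G b \<subseteq> A"
      using assms(4) b H(2) by blast
    ultimately obtain x y where xy: "x \<in> nbrs G b" "y \<in> nbrs G b" "x \<noteq> y" "(x, y) \<notin> parcs H"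
      using H(3) by (auto simp: cliques_def)
    let ?K = "contract_edge x b H"
    let ?g = "id(b := x)"
    have arcs: "(b, x) \<in> parcs H" "(b, y) \<in> parcs H" "(x, b) \<in> parcs H"
      using xy H(4)[OF b] pair_graph_arcD(3)[OF Hg] by auto
    have xyA: "x \<in> A" "y \<in> A"
      using xy bA by auto
    have bnA: "b \<notin> A"
      using b H(2) assms(3) by blast
    have keep: "(p, q) \<in> parcs ?K" if "(p, q) \<in> parcs H" "p \<noteq> b" "q \<noteq> b" for p q
      by (rule parcs_contract_edgeI[OF that(1)]) (use that pair_graph_arcD(4)[OF Hg that(1)] in auto)
    have new: "(x, y) \<in> parcs ?K"
      by (rule parcs_contract_edgeI[OF arcs(2)]) (use xy bnA xyA in auto)
    have sub: "insert (x, y) (parcs (induce A H)) \<subseteq> parcs (induce A ?K)"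
      using keep new bnA xyA by auto
    have "finite (parcs (induce A ?K))" 
      using finA by (auto intro: finite_subset[of _ "A \<times> A"])
    then have less: "card (parcs (induce A H)) < card (parcs (induce A ?K))"
      using sub xy by (intro psubset_card_mono) (auto simp del: contract_edge_simps)
    have "nbrs ?K b' = nbrs G b'" if b': "b' \<in> B' - {b}" for b'
    proof -
      have "nbrs H b' \<subseteq> A"
        using H(4)[of b'] b' assms(4)[of b'] H(2) by auto
      moreover have "b' \<notin> A" 
        using b' H(2) assms(3) by blast
      moreover have "b' \<noteq> x"
        using \<open>b' \<notin> A\<close> xyA by auto
      ultimately have "nbrs ?K b' = nbrs H b'"
      proof (intro set_eqI iffI)
        fix z assume "z \<in> nbrs ?K b'"
        then obtain p q where "(p, q) \<in> parcs H" "b' = ?g p" "z = ?g q" "b' \<noteq> z"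
          by auto
        with \<open>b' \<noteq> x\<close> \<open>nbrs H b' \<subseteq> A\<close> bnA show "z \<in> nbrs H b'"
          by (auto split: if_splits)
      next
        fix z assume "z \<in> nbrs H b'"
        moreover from this have "z \<noteq> b"
          using \<open>nbrs H b' \<subseteq> A\<close> bnA by blast
        ultimately show "z \<in> nbrs ?K b'"
          using keep[of b' z] b' by auto
      qed
      then show ?thesis
        using H(4) b' by auto
    qed
    moreover have "card (B - (B' - {b})) = Suc (card (B - B'))"
    proof -
      have "B - (B' - {b}) = insert b (B - B')"
        using b H(2) by auto
      then show ?thesis
        using b finB by simp
    qed
    moreover have "?K \<in> P"
      using minor[OF H(1) edge_contraction[OF arcs(3)]] .
    ultimately have "good (?K, B' - {b})"
      using H less bnA unfolding good_def by auto
    then show False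
      using max less by (fastforce simp: f_def)
  qed
  then have "nbrs G ` B' \<subseteq> cliques (induce A H)"
    by blast
  moreover have "finite (cliques (induce A H))"
    using finA by (intro finite_subset[of "cliques (induce A H)" "Pow A"]) (auto simp: cliques_def)
  ultimately have "card (nbrs G ` B') \<le> card (cliques (induce A H))"
    by (intro card_mono)
  also have "\<dots> \<le> 2 ^ d * card A + 1"
    using card_cliques[OF induce_mem[OF H(1)], of A] H(3) by (simp add: Int_absorb1)
  finally have "card (nbrs G ` B') \<le> 2 ^ d * card A + 1" .
  moreover have "card (B - B') \<le> d * card A"
    using H(5) bound[OF HB] by (simp add: f_def)
  ultimately show ?thesis
    using that H(2) by blast
qed

end

text \<open>Two local patterns that can be removed with bounded loss of information: an edge with
  both ends of degree at most \<open>D\<close>, to be contracted, and twins, one of which is to be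
  deleted. Pairs are ordered.\<close>

definition good_pairs :: "nat \<Rightarrow> 'a pair_pre_digraph \<Rightarrow> ('a \<times> 'a) set" where
  "good_pairs D G = {(u, v). u \<in> pverts G \<and> v \<in> pverts G \<and> u \<noteq> v \<and>
     ((u, v) \<in> parcs G \<and> card (nbrs G u) \<le> D \<and> card (nbrs G v) \<le> D \<or> nbrs G u = nbrs G v)}"

text \<open>The high-degree vertices \<open>A\<close> are few by sparsity. A low-degree vertex with
  a low-degree neighbour lies in a good pair. The remaining vertices \<open>B\<close> have all
  neighbours in \<open>A\<close>; by \<open>few_nbhds\<close>, apart from few exceptions, they show
  few distinct neighbourhoods, so the excess gives twins.\<close>

lemma (in sparse_minor_closed_set) many_good_pairs:
  assumes "G \<in> P" "4 \<le> card (pverts G)"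
  shows "card (pverts G) \<le> 8 * card (good_pairs (2 * d * (1 + d + 2 ^ d)) G)"
proof -
  \<comment> \<open>Chosen so that sparsity makes \<open>(1 + d + 2 ^ d) * card A\<close> at most
    half the number of vertices; the three terms pay for \<open>A\<close> itself, for the exceptions
    in \<open>B\<close>, and for the distinct neighbourhoods.\<close>
  define D where "D = 2 * d * (1 + d + 2 ^ d)"
  let ?V = "pverts G"
  note G = graph[OF assms(1)]
  note fin = pair_graphD(1,2)[OF G]
  define A where "A = {v \<in> ?V. D < card (nbrs G v)}"
  define L where "L = ?V - A"
  define B where "B = {v \<in> L. nbrs G v \<subseteq> A}"
  have sub: "A \<subseteq> ?V" "L \<subseteq> ?V" "B \<subseteq> L" "A \<inter> B = {}"
    by (auto simp: A_def L_def B_def)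
  have finAL: "finite A" "finite L" "finite B"
    using fin sub by (auto intro: finite_subset)
  have fin_gp: "finite (good_pairs D G)"
    using fin by (intro finite_subset[of "good_pairs D G" "?V \<times> ?V"]) (auto simp: good_pairs_def)
  have "card A * (D + 1) = (\<Sum>v\<in>A. D + 1)"
    by simp
  also have "\<dots> \<le> (\<Sum>v\<in>A. card (nbrs G v))"
    by (intro sum_mono) (auto simp: A_def)
  also have "\<dots> \<le> (\<Sum>v\<in>?V. card (nbrs G v))"
    using fin sub by (intro sum_mono2) auto
  also have "\<dots> \<le> d * card ?V"
    using sparse[OF assms(1)] card_parcs[OF G] by simp
  finally have cardA: "card A * (D + 1) \<le> d * card ?V" .
  have A_small: "2 * (1 + d + 2 ^ d) * card A \<le> card ?V"
  proof (cases "d = 0")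
    case True
    with cardA show ?thesis by simp
  next
    case False
    have "d * (2 * (1 + d + 2 ^ d) * card A) \<le> d * card ?V"
      using cardA by (simp add: D_def algebra_simps)
    with False show ?thesis by simp
  qed
  have LB: "card (L - B) \<le> card (good_pairs D G)"
  proof -
    have "\<exists>w. w \<in> nbrs G v \<and> w \<notin> A" if "v \<in> L - B" for v
      using that by (auto simp: B_def)
    then obtain w where w: "\<And>v. v \<in> L - B \<Longrightarrow> w v \<in> nbrs G v \<and> w v \<notin> A"
      by metis
    have "(v, w v) \<in> good_pairs D G" if "v \<in> L - B" for v
      using w[OF that] that by (auto simp: good_pairs_def L_def A_def dest: pair_graph_arcD[OF G])
    then show ?thesis
      using fin_gp by (intro card_inj_on_le[of "\<lambda>v. (v, w v)"]) (auto intro: inj_onI)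
  qed
  obtain B' where B': "B' \<subseteq> B" "card (B - B') \<le> d * card A" "card (nbrs G ` B') \<le> 2 ^ d * card A + 1"
    by (rule few_nbhds[OF assms(1), of A B]) (use sub in \<open>auto simp: B_def\<close>)
  have "card {(x, y) \<in> B' \<times> B'. x \<noteq> y \<and> nbrs G x = nbrs G y} \<le> card (good_pairs D G)"
    using fin_gp B'(1) sub by (intro card_mono) (auto simp: good_pairs_def)
  then have "card B' \<le> 2 ^ d * card A + 1 + card (good_pairs D G)"
    using card_le_card_image_plus_collisions[of B' "nbrs G"] B'(1,3) finAL finite_subset by fastforce
  moreover have "card B = card B' + card (B - B')"
    using finAL B'(1) by (intro card_subset_Diff) auto
  moreover have "card L = card B + card (L - B)"
    using finAL sub by (intro card_subset_Diff) auto
  moreover have "card ?V = card A + card L"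
    unfolding L_def using fin finAL sub by (intro card_subset_Diff) auto
  ultimately have "card ?V \<le> (1 + d + 2 ^ d) * card A + 1 + 2 * card (good_pairs D G)"
    using LB B'(2) by (simp add: algebra_simps)
  \<comment> \<open>The term with \<open>A\<close> takes at most half of the vertices, and the stray
    1 at most a quarter because there are at least 4. The last quarter is at most twice the number
    of good pairs.\<close>
  then show ?thesis
    using A_small assms(2) unfolding D_def[symmetric] by linarith
qed

section \<open>The number of labelled graphs\<close>

definition graphs_on :: "'a set \<Rightarrow> 'a pair_pre_digraph set \<Rightarrow> 'a pair_pre_digraph set" where
  "graphs_on V P = {G \<in> P. pverts G = V}"

locale relabel_closed_set =
  fixes P :: "'a pair_pre_digraph set"
  assumes pair_graph_mem: "\<And>G. G \<in> P \<Longrightarrow> pair_graph G"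
    and relabel_mem: "\<And>G f. G \<in> P \<Longrightarrow> inj_on f (pverts G) \<Longrightarrow> relabel f G \<in> P"
begin

lemma finite_graphs_on: "finite V \<Longrightarrow> finite (graphs_on V P)"
proof -
  assume "finite V"
  moreover have "inj_on parcs (graphs_on V P)"
    by (auto intro!: inj_onI graph_eqI simp: graphs_on_def)
  moreover have "parcs ` graphs_on V P \<subseteq> Pow (V \<times> V)"
    by (auto simp: graphs_on_def dest: pair_graph_mem pair_graph_arcD)
  ultimately show ?thesis
    using finite_imageD finite_subset by (metis finite_Pow_iff finite_SigmaI)
qed

lemma card_graphs_on_le:
  assumes "finite V" "finite W" "card V = card W"
  shows "card (graphs_on V P) \<le> card (graphs_on W P)"
proof -
  obtain f where f: "bij_betw f V W"
    using assms finite_same_card_bij by blast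
  have inj: "inj_on f V" "f ` V = W"
    using f by (auto simp: bij_betw_def)
  have "inj_on (relabel f) (graphs_on V P)"
  proof (rule inj_onI)
    fix G H assume GH: "G \<in> graphs_on V P" "H \<in> graphs_on V P" "relabel f G = relabel f H"
    have "(x, y) \<in> parcs G \<longleftrightarrow> (x, y) \<in> parcs H" if "x \<in> V" "y \<in> V" for x y
      using GH that inj parcs_relabel_iff[of G f x y] parcs_relabel_iff[of H f x y]
      by (auto simp: graphs_on_def pair_graph_mem simp del: relabel_simps)
    moreover have "parcs G \<subseteq> V \<times> V" "parcs H \<subseteq> V \<times> V"
      using GH by (auto simp: graphs_on_def dest: pair_graph_mem pair_graph_arcD)
    ultimately show "G = H"
      using GH by (intro graph_eqI) (auto simp: graphs_on_def)
  qed
  moreover have "relabel f ` graphs_on V P \<subseteq> graphs_on W P"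
    using inj by (auto simp: graphs_on_def relabel_mem)
  ultimately show ?thesis
    using finite_graphs_on[OF assms(2)] by (intro card_inj_on_le)
qed

lemma card_graphs_on_cong:
  "finite V \<Longrightarrow> finite W \<Longrightarrow> card V = card W \<Longrightarrow> card (graphs_on V P) = card (graphs_on W P)"
  using card_graphs_on_le[of V W] card_graphs_on_le[of W V] by simp

end

lemma card_Sigma_le:
  assumes "finite X" "\<And>x. x \<in> X \<Longrightarrow> finite (F x)" "\<And>x. x \<in> X \<Longrightarrow> card (F x) \<le> k"
  shows "card (Sigma X F) \<le> card X * k"
proof -
  have "card (Sigma X F) = (\<Sum>x\<in>X. card (F x))"
    using assms by (intro card_SigmaI) auto
  also have "\<dots> \<le> (\<Sum>x\<in>X. k)"
    using assms by (intro sum_mono) auto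
  finally show ?thesis by simp
qed

lemma card_sum_swap:
  assumes "finite X" "finite Y"
  shows "(\<Sum>x\<in>X. card {y \<in> Y. R x y}) = (\<Sum>y\<in>Y. card {x \<in> X. R x y})"
proof -
  have "card {y \<in> Y. R x y} = (\<Sum>y\<in>Y. if R x y then 1 else 0)" for x
    using assms(2) by (simp add: sum.If_cases Int_def conj_commute)
  moreover have "card {x \<in> X. R x y} = (\<Sum>x\<in>X. if R x y then 1 else 0)" for y
    using assms(1) by (simp add: sum.If_cases Int_def conj_commute)
  ultimately show ?thesis
    using sum.swap by simp
qed

locale small_class = sparse_minor_closed_set + relabel_closed_set
begin

text \<open>A graph with the good pair \<open>(u, v)\<close> can be recovered from the graph obtained by contracting the
  edge \<open>uv\<close> or deleting the twin \<open>v\<close>, up to boundedly many choices.\<close>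

lemma card_good_pair:
  assumes V: "finite V" "u \<in> V" "v \<in> V"
  shows "card {G \<in> graphs_on V P. (u, v) \<in> good_pairs D G} \<le>
    (4 ^ (2 * D + 2) + 1) * card (graphs_on (V - {v}) P)" (is "card ?S \<le> _")
proof -
  let ?W = "graphs_on (V - {v}) P"
  have finW: "finite ?W"
    using V by (intro finite_graphs_on) auto
  have G: "pair_graph G" if "G \<in> graphs_on V P" for G
    using that by (auto simp: graphs_on_def graph)
  let ?S1 = "{G \<in> graphs_on V P. (u, v) \<in> parcs G \<and> card (nbrs G u) \<le> D \<and> card (nbrs G v) \<le> D}"
  let ?S2 = "{G \<in> graphs_on V P. u \<noteq> v \<and> nbrs G u = nbrs G v}"
  \<comment> \<open>Candidates for the neighbourhoods of \<open>u\<close> and \<open>v\<close>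
    before the contraction to \<open>H\<close>: both lie in \<open>nbrs H u\<close> with
    \<open>u\<close> and \<open>v\<close> added, a set of size at most \<open>2 * D + 2\<close>. The
    two subsets give the factor \<open>4 ^ (2 * D + 2)\<close>; the \<open>+ 1\<close> in the claim
    is for twins.\<close>
  define F where "F H = (if card (nbrs H u) \<le> 2 * D
    then Pow (nbrs H u \<union> {u, v}) \<times> Pow (nbrs H u \<union> {u, v}) else {})" for H
  have finF: "finite (nbrs H u)" if "H \<in> ?W" for H
    using that pair_graphD(2)[OF graph, of H] by (auto simp: graphs_on_def)
  have cardF: "card (F H) \<le> 4 ^ (2 * D + 2)" if "H \<in> ?W" for H
  proof (cases "card (nbrs H u) \<le> 2 * D")
    case True
    have "card (nbrs H u \<union> {u, v}) \<le> card (nbrs H u) + card {u, v}"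
      by (rule card_Un_le)
    also have "\<dots> \<le> 2 * D + 2"
      using True by (auto simp: card_insert_if)
    finally have "2 ^ card (nbrs H u \<union> {u, v}) \<le> (2 ^ (2 * D + 2) :: nat)"
      by (intro power_increasing) auto
    then have "card (Pow (nbrs H u \<union> {u, v})) \<le> 2 ^ (2 * D + 2)"
      using finF[OF that] by (simp only: card_Pow finite_Un finite_insert finite.emptyI)
    then have "card (F H) \<le> 2 ^ (2 * D + 2) * 2 ^ (2 * D + 2)"
      using True by (simp only: F_def if_True card_cartesian_product) (rule mult_le_mono)
    then show ?thesis
      by (simp add: power_mult_distrib[symmetric])
  qed (simp add: F_def)
  let ?h = "\<lambda>G. (contract_edge u v G, nbrs G u, nbrs G v)"
  have "inj_on ?h ?S1"
  proof (rule inj_onI)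
    fix G H assume GH: "G \<in> ?S1" "H \<in> ?S1" "?h G = ?h H"
    have sub: "(x, y) \<in> parcs H" if "(x, y) \<in> parcs G" "G \<in> ?S1" "H \<in> ?S1" "?h G = ?h H" for x y G H
    proof -
      note arcH = pair_graph_arcD[OF G[of H]] and arcG = pair_graph_arcD[OF G[of G]]
      have mem: "G \<in> graphs_on V P" "H \<in> graphs_on V P"
        using that by auto
      have nb: "nbrs G u = nbrs H u" "nbrs G v = nbrs H v"
        using that by auto
      consider "x \<in> {u, v}" | "y \<in> {u, v}" | "x \<notin> {u, v}" "y \<notin> {u, v}"
        by blast
      then show ?thesis
      proof cases
        case 1
        then show ?thesis
          using that(1) nb by auto
      next
        case 2
        then have "(y, x) \<in> parcs H"
          using arcG(3)[OF mem(1) that(1)] nb by auto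
        then show ?thesis
          using arcH(3)[OF mem(2)] by blast
      next
        case 3
        have "(x, y) \<in> parcs (contract_edge u v G)"
          by (rule parcs_contract_edgeI[OF that(1)]) (use 3 arcG(4)[OF mem(1) that(1)] in auto)
        then have "(x, y) \<in> parcs (contract_edge u v H)"
          using that(4) by (simp del: contract_edge_simps)
        then show ?thesis
          using 3 by (auto split: if_splits)
      qed
    qed
    show "G = H"
    proof (rule graph_eqI)
      show "pverts G = pverts H"
        using GH by (simp add: graphs_on_def)
      show "parcs G = parcs H"
        by (intro equalityI subrelI) (rule sub[OF _ GH] sub[OF _ GH(2,1) GH(3)[symmetric]], assumption)+
    qed
  qed
  moreover have "?h ` ?S1 \<subseteq> Sigma ?W F"
  proof safe
    fix G assume GV: "G \<in> graphs_on V P" and uv: "(u, v) \<in> parcs G"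
      and deg: "card (nbrs G u) \<le> D" "card (nbrs G v) \<le> D"
    note Gg = G[OF GV]
    have GP: "G \<in> P" "pverts G = V"
      using GV by (auto simp: graphs_on_def)
    let ?K = "contract_edge u v G"
    show "?K \<in> ?W"
      using minor[OF GP(1) edge_contraction[OF uv]] GP(2) by (simp add: graphs_on_def)
    have ne: "u \<noteq> v"
      using pair_graph_arcD(4)[OF Gg uv] .
    have no_loop: "(x, x) \<notin> parcs G" for x
      using pair_graphD(7)[OF Gg] .
    have "x \<in> nbrs G u \<union> nbrs G v" if "x \<in> nbrs ?K u" for x
      using that ne by (auto split: if_splits)
    then have "nbrs ?K u \<subseteq> nbrs G u \<union> nbrs G v"
      by blast
    then have "card (nbrs ?K u) \<le> card (nbrs G u \<union> nbrs G v)"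
      by (rule card_mono[rotated]) (use pair_graphD(2)[OF Gg] in auto)
    also have "\<dots> \<le> 2 * D"
      using card_Un_le[of "nbrs G u" "nbrs G v"] deg by linarith
    finally have small: "card (nbrs ?K u) \<le> 2 * D" .
    have "x \<in> nbrs ?K u \<union> {u, v}" if "(u, x) \<in> parcs G" for x
    proof (cases "x = u \<or> x = v")
      case False
      then have "(u, x) \<in> parcs ?K"
        by (intro parcs_contract_edgeI[OF that]) auto
      then show ?thesis by blast
    qed auto
    moreover have "x \<in> nbrs ?K u \<union> {u, v}" if "(v, x) \<in> parcs G" for x
    proof (cases "x = u \<or> x = v")
      case False
      then have "(u, x) \<in> parcs ?K"
        by (intro parcs_contract_edgeI[OF that]) auto
      then show ?thesis by blast
    qed auto
    ultimately show "(nbrs G u, nbrs G v) \<in> F ?K"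
      using small unfolding F_def by (simp only: if_True) blast
  qed
  moreover have "finite (Sigma ?W F)"
    using finW finF by (intro finite_SigmaI) (auto simp: F_def)
  ultimately have "card ?S1 \<le> card (Sigma ?W F)"
    by (rule card_inj_on_le)
  also have "\<dots> \<le> card ?W * 4 ^ (2 * D + 2)"
    using finW finF cardF by (intro card_Sigma_le) (auto simp: F_def)
  finally have S1: "card ?S1 \<le> card ?W * 4 ^ (2 * D + 2)" .
  \<comment> \<open>The lost neighbourhood of \<open>v\<close> is that of its twin \<open>u\<close>,
    which survives the deletion.\<close>
  have "inj_on (delete_vertex v) ?S2"
  proof (rule inj_onI)
    fix G H assume GH: "G \<in> ?S2" "H \<in> ?S2" "delete_vertex v G = delete_vertex v H"
    have sub: "(x, y) \<in> parcs H" if "(x, y) \<in> parcs G" "G \<in> ?S2" "H \<in> ?S2" "delete_vertex v G = delete_vertex v H" for x y G H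
    proof -
      have mem: "G \<in> graphs_on V P" "H \<in> graphs_on V P"
        using that by auto
      note arcH = pair_graph_arcD[OF G[OF mem(2)]] and arcG = pair_graph_arcD[OF G[OF mem(1)]]
      have nb: "nbrs G u = nbrs G v" "nbrs H u = nbrs H v" "u \<noteq> v"
        using that by auto
      have same: "(p, q) \<in> parcs H" if "(p, q) \<in> parcs G" "p \<noteq> v" "q \<noteq> v" for p q
      proof -
        have "(p, q) \<in> parcs (delete_vertex v G)"
          using that by simp
        then show ?thesis
          unfolding \<open>delete_vertex v G = delete_vertex v H\<close> by simp
      qed
      note xy = that(1)
      consider "x \<noteq> v" "y \<noteq> v" | "x = v" "y \<noteq> v" | "y = v" "x \<noteq> v"
        using arcG(4)[OF xy] by blast
      then show ?thesis
      proof cases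
        case 2
        then have "(u, y) \<in> parcs G"
          using xy nb by blast
        then have "(u, y) \<in> parcs H"
          using same nb 2 by blast
        then show ?thesis
          using nb 2 by blast
      next
        case 3
        then have "(u, x) \<in> parcs G"
          using arcG(3)[OF xy] nb by blast
        then have "(u, x) \<in> parcs H"
          using same nb 3 by blast
        then have "(v, x) \<in> parcs H"
          using nb by blast
        then show ?thesis
          using arcH(3) 3 by blast
      qed (use same xy in blast)
    qed
    show "G = H"
    proof (rule graph_eqI)
      show "pverts G = pverts H"
        using GH by (simp add: graphs_on_def)
      show "parcs G = parcs H"
        by (intro equalityI subrelI) (rule sub[OF _ GH] sub[OF _ GH(2,1) GH(3)[symmetric]], assumption)+
    qed
  qed
  moreover have "delete_vertex v ` ?S2 \<subseteq> ?W"
    using minor[OF _ vertex_deletion] V(3) by (auto simp: graphs_on_def)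
  ultimately have S2: "card ?S2 \<le> card ?W"
    using finW by (intro card_inj_on_le)
  have "?S \<subseteq> ?S1 \<union> ?S2"
    by (auto simp: good_pairs_def)
  then have "card ?S \<le> card (?S1 \<union> ?S2)"
    using finite_graphs_on[OF V(1)] by (intro card_mono) auto
  also have "\<dots> \<le> card ?S1 + card ?S2"
    by (rule card_Un_le)
  finally show ?thesis
    using S1 S2 by (simp add: algebra_simps)
qed

text \<open>Double counting of graphs with a good pair: every graph on \<open>V\<close> has at least
  \<open>card V / 8\<close> of them, and each of the \<open>card V * card V\<close> pairs is good in
  at most a constant times as many graphs as there are on one vertex less. The surviving factor
  \<open>card V\<close> builds up the factorial.\<close>

lemma card_graphs_on_Suc_le:
  obtains K where "\<And>V v. finite V \<Longrightarrow> v \<in> V \<Longrightarrow> 4 \<le> card V \<Longrightarrow>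
    card (graphs_on V P) \<le> K * card V * card (graphs_on (V - {v}) P)"
proof
  define D where "D = 2 * d * (1 + d + 2 ^ d)"
  define k :: nat where "k = 4 ^ (2 * D + 2) + 1"
  fix V :: "'a set" and v
  assume V: "finite V" "v \<in> V" "4 \<le> card V"
  let ?X = "graphs_on V P"
  have "card V * card ?X = (\<Sum>G\<in>?X. card V)"
    by simp
  also have "\<dots> \<le> (\<Sum>G\<in>?X. 8 * card {x \<in> V \<times> V. x \<in> good_pairs D G})"
  proof (rule sum_mono)
    fix G assume G: "G \<in> ?X"
    then have "{x \<in> V \<times> V. x \<in> good_pairs D G} = good_pairs D G"
      by (auto simp: graphs_on_def good_pairs_def)
    then show "card V \<le> 8 * card {x \<in> V \<times> V. x \<in> good_pairs D G}"
      using many_good_pairs[of G] G V by (simp add: graphs_on_def D_def)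
  qed
  also have "\<dots> = 8 * (\<Sum>x\<in>V \<times> V. card {G \<in> ?X. x \<in> good_pairs D G})"
    using V finite_graphs_on by (subst card_sum_swap[symmetric]) (auto simp: sum_distrib_left)
  also have "(\<Sum>x\<in>V \<times> V. card {G \<in> ?X. x \<in> good_pairs D G}) \<le>
      (\<Sum>x\<in>V \<times> V. k * card (graphs_on (V - {v}) P))"
  proof (rule sum_mono)
    fix x assume "x \<in> V \<times> V"
    then obtain a b where ab: "x = (a, b)" "a \<in> V" "b \<in> V"
      by auto
    have "card (graphs_on (V - {b}) P) = card (graphs_on (V - {v}) P)"
      using V ab by (intro card_graphs_on_cong) auto
    then show "card {G \<in> ?X. x \<in> good_pairs D G} \<le> k * card (graphs_on (V - {v}) P)"
      using card_good_pair[OF V(1) ab(2,3), of D] ab(1) by (simp add: k_def)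
  qed
  finally have "card V * card ?X \<le> 8 * (card V * card V * (k * card (graphs_on (V - {v}) P)))"
    by (simp add: card_cartesian_product)
  also have "\<dots> = card V * (8 * k * card V * card (graphs_on (V - {v}) P))"
    by (simp add: algebra_simps)
  finally show "card ?X \<le> 8 * k * card V * card (graphs_on (V - {v}) P)"
    using V by (simp add: mult_le_cancel1)
qed

lemma small:
  obtains C :: nat where "C \<ge> 1" "\<And>V. finite V \<Longrightarrow> card (graphs_on V P) \<le> fact (card V) * C ^ (card V + 1)"
proof -
  obtain K where K: "\<And>V v. finite V \<Longrightarrow> v \<in> V \<Longrightarrow> 4 \<le> card V \<Longrightarrow>
      card (graphs_on V P) \<le> K * card V * card (graphs_on (V - {v}) P)"
    using card_graphs_on_Suc_le by metis
  define C where "C = K + 2 ^ 9 + 1"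
  have few: "card (graphs_on V P) \<le> 2 ^ 9" if V: "finite V" "card V \<le> 3" for V
  proof -
    have "inj_on parcs (graphs_on V P)"
      by (auto intro!: inj_onI graph_eqI simp: graphs_on_def)
    moreover have "parcs ` graphs_on V P \<subseteq> Pow (V \<times> V)"
      by (auto simp: graphs_on_def dest: pair_graph_mem pair_graph_arcD)
    ultimately have "card (graphs_on V P) \<le> card (Pow (V \<times> V))"
      using V by (intro card_inj_on_le) auto
    also have "\<dots> = 2 ^ (card V * card V)"
      using V by (simp add: card_Pow card_cartesian_product)
    also have "\<dots> \<le> 2 ^ (3 * 3)"
      using V by (intro power_increasing mult_le_mono) auto
    finally show ?thesis by simp
  qed
  have "card (graphs_on V P) \<le> fact (card V) * C ^ (card V + 1)" if "finite V" for V
    using that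
  proof (induction "card V" arbitrary: V rule: less_induct)
    case less
    show ?case
    proof (cases "card V \<le> 3")
      case True
      have "card (graphs_on V P) \<le> C"
        using few[OF less.prems True] by (simp add: C_def)
      also have "\<dots> \<le> C ^ (card V + 1)"
        by (rule self_le_power) (auto simp: C_def)
      also have "\<dots> \<le> fact (card V) * C ^ (card V + 1)"
        using fact_ge_1[of "card V", where 'a = nat] by (metis mult_1 mult_le_mono1)
      finally show ?thesis .
    next
      case False
      then obtain v where v: "v \<in> V"
        by fastforce
      have c: "card (V - {v}) = card V - 1" "card V > 0"
        using v less.prems False by auto
      have "card (graphs_on V P) \<le> K * card V * card (graphs_on (V - {v}) P)"
        using K[OF less.prems v] False by simp
      also have "\<dots> \<le> C * card V * (fact (card V - 1) * C ^ (card V - 1 + 1))"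
        using less.hyps[of "V - {v}"] c less.prems by (intro mult_le_mono) (auto simp: C_def)
      also have "\<dots> = fact (card V) * C ^ (card V + 1)"
        using c(2) by (simp add: fact_reduce[of "card V"] algebra_simps)
      finally show ?thesis .
    qed
  qed
  then show ?thesis
    using that[of C] by (simp add: C_def)
qed

end

section \<open>Types of monadic second-order logic\<close>

text \<open>Hintikka types as values: atomic information, and the types of one rank less that a
  single quantifier move reaches, each with the variable rebound. Finite sets \<open>fset\<close>
  make the nested recursion a datatype.\<close>

datatype 'v ty = Ty (ty_atoms: "('v \<times> 'v) set \<times> ('v \<times> 'v) set \<times> 'v set") (ty_steps: "('v \<times> 'v ty) fset")

text \<open>With vertices as singletons, a common element expresses both equality and membership,
  and an arc between two sets expresses adjacency. The third component singles out the sets that can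
  stand for vertices.\<close>

definition atoms :: "'v set \<Rightarrow> 'a rel \<Rightarrow> ('v \<Rightarrow> 'a set) \<Rightarrow> ('v \<times> 'v) set \<times> ('v \<times> 'v) set \<times> 'v set" where
  "atoms U E e =
     ({p \<in> U \<times> U. e (fst p) \<inter> e (snd p) \<noteq> {}},
      {p \<in> U \<times> U. \<exists>u\<in>e (fst p). \<exists>v\<in>e (snd p). (u, v) \<in> E},
      {X \<in> U. \<exists>x. e X = {x}})"

lemma atoms_cong:
  assumes "\<And>X Y. X \<in> U \<Longrightarrow> Y \<in> U \<Longrightarrow> e X \<inter> e Y \<noteq> {} \<longleftrightarrow> e' X \<inter> e' Y \<noteq> {}"
    and "\<And>X Y. X \<in> U \<Longrightarrow> Y \<in> U \<Longrightarrow>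
      (\<exists>u\<in>e X. \<exists>v\<in>e Y. (u, v) \<in> E) \<longleftrightarrow> (\<exists>u\<in>e' X. \<exists>v\<in>e' Y. (u, v) \<in> E')"
    and "\<And>X. X \<in> U \<Longrightarrow> (\<exists>x. e X = {x}) \<longleftrightarrow> (\<exists>x. e' X = {x})"
  shows "atoms U E e = atoms U E' e'"
  unfolding atoms_def
  by (intro arg_cong2[where f = Pair] Collect_cong conj_cong refl assms) (simp_all only: mem_Times_iff)

text \<open>Types know only set variables, a vertex being a singleton. Quantifier steps may rebind any
  variable of \<open>U\<close>, so that formulas reusing variable names need no renaming.\<close>

primrec tp :: "nat \<Rightarrow> 'v set \<Rightarrow> 'a set \<Rightarrow> 'a rel \<Rightarrow> ('v \<Rightarrow> 'a set) \<Rightarrow> 'v ty" where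
  "tp 0 U V E e = Ty (atoms U E e) {||}"
| "tp (Suc k) U V E e =
     Ty (atoms U E e) (Abs_fset ((\<lambda>(X, A). (X, tp k U V E (e(X := A)))) ` (U \<times> Pow V)))"

lemma ty_atoms_tp [simp]: "ty_atoms (tp k U V E e) = atoms U E e"
  by (cases k) auto

lemma image_pairs_subset_iff:
  "(\<lambda>(X, A). (X, f X A)) ` (U \<times> Pow V) \<subseteq> (\<lambda>(X, A). (X, g X A)) ` (U \<times> Pow V') \<longleftrightarrow>
    (\<forall>X\<in>U. \<forall>A. A \<subseteq> V \<longrightarrow> (\<exists>B\<subseteq>V'. f X A = g X B))" (is "?L \<longleftrightarrow> ?R")
proof
  assume L: ?L
  show ?R
  proof (intro ballI allI impI)
    fix X A assume "X \<in> U" "A \<subseteq> V"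
    then have "(X, f X A) \<in> (\<lambda>(X, A). (X, f X A)) ` (U \<times> Pow V)"
      by (intro image_eqI[of _ _ "(X, A)"]) auto
    then have "(X, f X A) \<in> (\<lambda>(X, A). (X, g X A)) ` (U \<times> Pow V')"
      using L by blast
    then show "\<exists>B\<subseteq>V'. f X A = g X B"
      by auto
  qed
next
  assume R: ?R
  show ?L
  proof safe
    fix X A assume "X \<in> U" "A \<subseteq> V"
    then obtain B where "B \<subseteq> V'" "f X A = g X B"
      using R by blast
    with \<open>X \<in> U\<close> show "(X, f X A) \<in> (\<lambda>(X, A). (X, g X A)) ` (U \<times> Pow V')"
      by (intro image_eqI[of _ _ "(X, B)"]) auto
  qed
qed

text \<open>The back-and-forth condition of the Ehrenfeucht-Fraisse game. Finiteness is needed to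
  cancel \<open>Abs_fset\<close>, which is faithful on finite sets only.\<close>

lemma tp_Suc_eq_iff:
  assumes "finite U" "finite V" "finite V'"
  shows "tp (Suc k) U V E e = tp (Suc k) U V' E' e' \<longleftrightarrow> atoms U E e = atoms U E' e' \<and>
    (\<forall>X\<in>U. \<forall>A. A \<subseteq> V \<longrightarrow> (\<exists>B\<subseteq>V'. tp k U V E (e(X := A)) = tp k U V' E' (e'(X := B)))) \<and>
    (\<forall>X\<in>U. \<forall>B. B \<subseteq> V' \<longrightarrow> (\<exists>A\<subseteq>V. tp k U V E (e(X := A)) = tp k U V' E' (e'(X := B))))"
proof -
  let ?S = "(\<lambda>(X, A). (X, tp k U V E (e(X := A)))) ` (U \<times> Pow V)"
  let ?S' = "(\<lambda>(X, A). (X, tp k U V' E' (e'(X := A)))) ` (U \<times> Pow V')"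
  have "Abs_fset ?S = Abs_fset ?S' \<longleftrightarrow> ?S = ?S'"
    using assms by (intro Abs_fset_inject) auto
  also have "\<dots> \<longleftrightarrow> ?S \<subseteq> ?S' \<and> ?S' \<subseteq> ?S"
    by blast
  also have "?S \<subseteq> ?S' \<longleftrightarrow>
      (\<forall>X\<in>U. \<forall>A. A \<subseteq> V \<longrightarrow> (\<exists>B\<subseteq>V'. tp k U V E (e(X := A)) = tp k U V' E' (e'(X := B))))"
    by (rule image_pairs_subset_iff)
  also have "?S' \<subseteq> ?S \<longleftrightarrow>
      (\<forall>X\<in>U. \<forall>B. B \<subseteq> V' \<longrightarrow> (\<exists>A\<subseteq>V. tp k U V E (e(X := A)) = tp k U V' E' (e'(X := B))))"
    unfolding image_pairs_subset_iff by metis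
  finally show ?thesis
    by (simp only: tp.simps ty.inject)
qed

lemma tp_step:
  assumes "tp (Suc k) U V E e = tp (Suc k) U V' E' e'" "finite U" "finite V" "finite V'" "X \<in> U" "A \<subseteq> V"
  obtains B where "B \<subseteq> V'" "tp k U V E (e(X := A)) = tp k U V' E' (e'(X := B))"
  using assms(1,5,6) unfolding tp_Suc_eq_iff[OF assms(2-4)] by blast

text \<open>The bound comes from \<open>U\<close> and the rank: there are finitely many atomic parts
  over \<open>U\<close>, and the steps form a subset of \<open>U\<close> times the finitely many
  types one rank below.\<close>

lemma finite_types:
  assumes "finite U"
  shows "finite {tp k U V E e | (V :: 'a set) E e. finite V}"
proof (induction k)
  case 0
  have "{tp 0 U V E e | (V :: 'a set) E e. finite V} \<subseteq>
      (\<lambda>a. Ty a {||}) ` (Pow (U \<times> U) \<times> Pow (U \<times> U) \<times> Pow U)"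
    by (auto simp: atoms_def)
  then show ?case
    by (rule finite_subset) (use assms in auto)
next
  case (Suc k)
  let ?T = "{tp k U V E e | (V :: 'a set) E e. finite V}"
  let ?F = "{F. fset F \<subseteq> U \<times> ?T}"
  have "finite (fset ` ?F)"
    by (rule finite_subset[of _ "Pow (U \<times> ?T)"]) (use Suc assms in auto)
  then have "finite ?F"
    by (rule finite_imageD) (simp add: inj_on_def fset_inject)
  moreover have "{tp (Suc k) U V E e | (V :: 'a set) E e. finite V} \<subseteq>
      (\<lambda>(a, F). Ty a F) ` ((Pow (U \<times> U) \<times> Pow (U \<times> U) \<times> Pow U) \<times> ?F)"
  proof safe
    fix V :: "'a set" and E :: "'a rel" and e :: "'b \<Rightarrow> 'a set"
    assume V: "finite V"
    let ?S = "(\<lambda>(X, A). (X, tp k U V E (e(X := A)))) ` (U \<times> Pow V)"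
    have "fset (Abs_fset ?S) = ?S"
      using assms V by (intro Abs_fset_inverse) auto
    then have "Abs_fset ?S \<in> ?F"
      using V by auto
    moreover have "atoms U E e \<in> Pow (U \<times> U) \<times> Pow (U \<times> U) \<times> Pow U"
      by (auto simp: atoms_def)
    ultimately have "(atoms U E e, Abs_fset ?S) \<in> (Pow (U \<times> U) \<times> Pow (U \<times> U) \<times> Pow U) \<times> ?F"
      by (rule SigmaI[rotated])
    then show "tp (Suc k) U V E e \<in> (\<lambda>(a, F). Ty a F) ` ((Pow (U \<times> U) \<times> Pow (U \<times> U) \<times> Pow U) \<times> ?F)"
      by (rule rev_image_eqI) simp
  qed
  ultimately show ?case
    using assms by (meson finite_SigmaI finite_Pow_iff finite_imageI finite_subset)
qed

lemma tp_relabel: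
  assumes "finite U" "finite V" "inj_on f V" "E \<subseteq> V \<times> V" "\<And>X. X \<in> U \<Longrightarrow> e X \<subseteq> V"
  shows "tp k U (f ` V) (map_prod f f ` E) (\<lambda>X. f ` e X) = tp k U V E e"
  using assms(5)
proof (induction k arbitrary: e)
  have sing: "(\<exists>y. f ` A = {y}) \<longleftrightarrow> (\<exists>x. A = {x})" if "A \<subseteq> V" for A
  proof
    assume "\<exists>y. f ` A = {y}"
    then obtain y where y: "f ` A = {y}" ..
    then obtain x where "x \<in> A" by blast
    have "A = {x}"
    proof (intro equalityI subsetI)
      fix z assume "z \<in> A"
      then have "f z = f x"
        using imageI[of z A f] imageI[of x A f] y \<open>x \<in> A\<close> by auto
      then show "z \<in> {x}"
        using inj_onD[OF assms(3), of z x] that \<open>z \<in> A\<close> \<open>x \<in> A\<close> by blast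
    qed (use \<open>x \<in> A\<close> in auto)
    then show "\<exists>x. A = {x}" ..
  qed auto
  have meet: "f ` A \<inter> f ` B \<noteq> {} \<longleftrightarrow> A \<inter> B \<noteq> {}" if "A \<subseteq> V" "B \<subseteq> V" for A B
    using inj_on_image_Int[OF assms(3) that] by (metis image_is_empty)
  have edge: "(\<exists>u\<in>f ` A. \<exists>v\<in>f ` B. (u, v) \<in> map_prod f f ` E) \<longleftrightarrow> (\<exists>u\<in>A. \<exists>v\<in>B. (u, v) \<in> E)"
    if AB: "A \<subseteq> V" "B \<subseteq> V" for A B
  proof
    assume "\<exists>u\<in>f ` A. \<exists>v\<in>f ` B. (u, v) \<in> map_prod f f ` E"
    then obtain a b p q where "a \<in> A" "b \<in> B" "(p, q) \<in> E" "f a = f p" "f b = f q"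
      by auto
    moreover from this have "a = p" "b = q"
      using AB assms(4) inj_onD[OF assms(3), of a p] inj_onD[OF assms(3), of b q] by blast+
    ultimately show "\<exists>u\<in>A. \<exists>v\<in>B. (u, v) \<in> E"
      by blast
  qed force
  have at: "atoms U (map_prod f f ` E) (\<lambda>X. f ` e X) = atoms U E e" if e: "\<And>X. X \<in> U \<Longrightarrow> e X \<subseteq> V" for e
    by (rule atoms_cong) (use e meet edge sing in simp_all)
  {
    case 0
    then show ?case
      using at by simp
  next
    case (Suc k)
    have upd: "(\<lambda>X. f ` e X)(X := f ` A) = (\<lambda>Y. f ` (e(X := A)) Y)" for X A
      by (auto simp: fun_eq_iff)
    have IH: "tp k U (f ` V) (map_prod f f ` E) ((\<lambda>X. f ` e X)(X := f ` A)) = tp k U V E (e(X := A))"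
      if "A \<subseteq> V" for X A
      unfolding upd by (rule Suc.IH) (use Suc.prems that in auto)
    have fin: "finite (f ` V)"
      using assms(2) by simp
    show ?case
      unfolding tp_Suc_eq_iff[OF assms(1) fin assms(2)]
    proof (intro conjI ballI allI impI)
      show "atoms U (map_prod f f ` E) (\<lambda>X. f ` e X) = atoms U E e"
        using Suc.prems by (rule at)
    next
      fix X B assume "X \<in> U" "B \<subseteq> f ` V"
      then obtain A where "A \<subseteq> V" "B = f ` A"
        by (auto simp: subset_image_iff)
      then show "\<exists>A\<subseteq>V. tp k U (f ` V) (map_prod f f ` E) ((\<lambda>X. f ` e X)(X := B)) = tp k U V E (e(X := A))"
        using IH by blast
    next
      fix X A assume "X \<in> U" "A \<subseteq> V"
      then show "\<exists>B\<subseteq>f ` V. tp k U (f ` V) (map_prod f f ` E) ((\<lambda>X. f ` e X)(X := B)) = tp k U V E (e(X := A))"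
        using IH by blast
    qed
  }
qed

section \<open>Composition of types over disjoint unions\<close>

text \<open>Colours will be the types of the parts of a disjoint union, whose multiplicities matter
  only up to a threshold.\<close>

definition agree :: "nat \<Rightarrow> ('i \<Rightarrow> 'c) \<Rightarrow> 'i set \<Rightarrow> ('j \<Rightarrow> 'c) \<Rightarrow> 'j set \<Rightarrow> bool" where
  "agree t f I g J \<longleftrightarrow> (\<forall>\<tau>. min t (card {i \<in> I. f i = \<tau>}) = min t (card {j \<in> J. g j = \<tau>}))"

lemma agreeD: "agree t f I g J \<Longrightarrow> min t (card {i \<in> I. f i = \<tau>}) = min t (card {j \<in> J. g j = \<tau>})"
  by (simp add: agree_def)

lemma agree_sym: "agree t f I g J \<Longrightarrow> agree t g J f I"
  by (simp add: agree_def)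

lemma agree_mono: "agree t f I g J \<Longrightarrow> s \<le> t \<Longrightarrow> agree s f I g J"
proof -
  assume "agree t f I g J" and s: "s \<le> t"
  then have "min s (card {i \<in> I. f i = \<tau>}) = min s (card {j \<in> J. g j = \<tau>})" for \<tau>
    using agreeD[of t f I g J \<tau>] by linarith
  then show ?thesis
    by (simp add: agree_def)
qed

lemma agree_ex:
  assumes "agree t f I g J" "1 \<le> t" "finite I" "finite J" "i \<in> I"
  obtains j where "j \<in> J" "g j = f i"
proof -
  have "card {i' \<in> I. f i' = f i} > 0"
    using assms(3,5) by (auto simp: card_gt_0_iff)
  then have "card {j \<in> J. g j = f i} > 0"
    using agreeD[OF assms(1), of "f i"] assms(2) by (auto simp: min_def split: if_splits)
  then show ?thesis
    using that by (auto simp: card_gt_0_iff)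
qed

text \<open>If the index sets have the same size, \<open>f\<close> is transported by a bijection.
  Otherwise both exceed \<open>card T * t\<close>, so some colour \<open>\<tau>0\<close> occurs more
  than \<open>t\<close> times on \<open>I\<close>; up to \<open>t\<close> elements of each colour
  are copied to \<open>J\<close>, and the rest of \<open>J\<close> gets colour
  \<open>\<tau>0\<close>, which has reached the threshold anyway.\<close>

lemma agree_refine_uniform:
  assumes fin: "finite I" "finite J" "finite T" "f ` I \<subseteq> T"
    and card: "min (card T * t + 1) (card I) = min (card T * t + 1) (card J)"
  shows "\<exists>g. g ` J \<subseteq> f ` I \<and> agree t f I g J"
proof (cases "card I = card J")
  case True
  then obtain h where h: "bij_betw h J I"
    using fin finite_same_card_bij by metis
  have "card {j \<in> J. f (h j) = \<tau>} = card {i \<in> I. f i = \<tau>}" for \<tau>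
  proof (rule bij_betw_same_card[of h])
    show "bij_betw h {j \<in> J. f (h j) = \<tau>} {i \<in> I. f i = \<tau>}"
      using h by (auto simp: bij_betw_def inj_on_def)
  qed
  then have "agree t f I (f \<circ> h) J"
    by (simp add: agree_def)
  moreover have "(f \<circ> h) ` J \<subseteq> f ` I"
    using h by (auto simp: bij_betw_def)
  ultimately show ?thesis by blast
next
  case False
  then have big: "card T * t < card I" "card T * t < card J"
    using card by linarith+
  define fib where "fib \<tau> = {i \<in> I. f i = \<tau>}" for \<tau>
  have fin_fib: "finite (fib \<tau>)" for \<tau>
    using fin by (simp add: fib_def)
  have "\<exists>\<tau>\<in>T. t < card (fib \<tau>)"
  proof (rule ccontr)
    assume "\<not> ?thesis"
    then have "card (\<Union>\<tau>\<in>T. fib \<tau>) \<le> (\<Sum>\<tau>\<in>T. t)"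
      using fin by (intro order_trans[OF card_UN_le] sum_mono) auto
    moreover have "(\<Union>\<tau>\<in>T. fib \<tau>) = I"
      using fin by (auto simp: fib_def)
    ultimately show False
      using big by simp
  qed
  then obtain \<tau>0 where \<tau>0: "\<tau>0 \<in> T" "t < card (fib \<tau>0)"
    by blast
  then have "fib \<tau>0 \<noteq> {}" by auto
  then have \<tau>0_img: "\<tau>0 \<in> f ` I"
    by (auto simp: fib_def)
  have "\<exists>S. S \<subseteq> fib \<tau> \<and> card S = min t (card (fib \<tau>))" for \<tau>
    by (meson min.cobounded2 obtain_subset_with_card_n)
  then obtain S where S: "\<And>\<tau>. S \<tau> \<subseteq> fib \<tau>" "\<And>\<tau>. card (S \<tau>) = min t (card (fib \<tau>))"
    by metis
  define I' where "I' = (\<Union>\<tau>\<in>T. S \<tau>)"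
  have I'_sub: "I' \<subseteq> I"
    using S(1) by (auto simp: I'_def fib_def)
  then have finI': "finite I'"
    using fin finite_subset by blast
  have I'_fib: "{i \<in> I'. f i = \<tau>} = S \<tau>" for \<tau>
    using S(1) fin(4) by (fastforce simp: I'_def fib_def)
  have "card I' \<le> (\<Sum>\<tau>\<in>T. t)"
    unfolding I'_def using fin S(2) by (intro order_trans[OF card_UN_le] sum_mono) auto
  then have "card I' \<le> card J"
    using big by simp
  then obtain h where h: "inj_on h I'" "h ` I' \<subseteq> J"
    using card_le_inj[OF finI' fin(2)] by blast
  define g where "g j = (if j \<in> h ` I' then f (the_inv_into I' h j) else \<tau>0)" for j
  have gh: "g (h i) = f i" if "i \<in> I'" for i
    using that h by (simp add: g_def the_inv_into_f_f)
  have "min t (card {i \<in> I. f i = \<tau>}) = min t (card {j \<in> J. g j = \<tau>})" for \<tau>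
  proof -
    have sub: "h ` S \<tau> \<subseteq> {j \<in> J. g j = \<tau>}"
      unfolding I'_fib[of \<tau>, symmetric] using h gh by auto
    have cardS: "card (h ` S \<tau>) = min t (card (fib \<tau>))"
      using S(2) I'_fib[of \<tau>] h(1) by (subst card_image) (auto intro: inj_on_subset)
    show ?thesis
    proof (cases "\<tau> = \<tau>0")
      case True
      have "card (h ` S \<tau>) \<le> card {j \<in> J. g j = \<tau>}"
        using fin sub by (intro card_mono) auto
      then show ?thesis
        using cardS \<tau>0 True by (simp add: fib_def)
    next
      case False
      have "{j \<in> J. g j = \<tau>} \<subseteq> h ` S \<tau>"
        using False gh I'_fib[of \<tau>] by (auto simp: g_def split: if_splits)
      then have "{j \<in> J. g j = \<tau>} = h ` S \<tau>"
        using sub by blast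
      then show ?thesis
        using cardS by (simp add: fib_def)
    qed
  qed
  moreover have "g ` J \<subseteq> f ` I"
    using \<tau>0_img gh I'_sub by (auto simp: g_def)
  ultimately show ?thesis
    by (auto simp: agree_def)
qed

lemma min_sum_cong:
  assumes "finite S" "\<And>x. x \<in> S \<Longrightarrow> min t (a x) = min t (b x)"
  shows "min t (sum a S) = min t (sum b S :: nat)"
  using assms
proof (induction S rule: finite_induct)
  case (insert x F)
  then have "min t (sum a F) = min t (sum b F)" "min t (a x) = min t (b x)"
    by auto
  then have "min t (a x + sum a F) = min t (b x + sum b F)"
    by linarith
  then show ?case
    using insert.hyps by simp
qed simp

text \<open>The previous construction inside each class of \<open>f\<close>. In the game this is the
  reply to a move: the move recolours the parts of \<open>I\<close> by \<open>f'\<close>, and each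
  part of \<open>J\<close> copies some part of \<open>I\<close> with the same old colour. The drop
  of the threshold is the price.\<close>

lemma agree_refine:
  assumes fin: "finite I" "finite J" "finite T" "f' ` I \<subseteq> T"
    and agree: "agree (card T * t + 1) f I g J"
  shows "\<exists>g'. (\<forall>j\<in>J. \<exists>i\<in>I. f i = g j \<and> f' i = g' j) \<and> agree t f' I g' J"
proof -
  define Is where "Is \<sigma> = {i \<in> I. f i = \<sigma>}" for \<sigma>
  define Js where "Js \<sigma> = {j \<in> J. g j = \<sigma>}" for \<sigma>
  have "\<exists>h. h ` Js \<sigma> \<subseteq> f' ` Is \<sigma> \<and> agree t f' (Is \<sigma>) h (Js \<sigma>)" for \<sigma>
    by (rule agree_refine_uniform[OF _ _ fin(3)])
      (use fin agreeD[OF agree, of \<sigma>] in \<open>auto simp: Is_def Js_def\<close>)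
  then obtain h where h: "\<And>\<sigma>. h \<sigma> ` Js \<sigma> \<subseteq> f' ` Is \<sigma>" "\<And>\<sigma>. agree t f' (Is \<sigma>) (h \<sigma>) (Js \<sigma>)"
    by metis
  define g' where "g' j = h (g j) j" for j
  have "\<exists>i\<in>I. f i = g j \<and> f' i = g' j" if "j \<in> J" for j
  proof -
    have "g' j \<in> f' ` Is (g j)"
      using h(1)[of "g j"] that by (auto simp: g'_def Js_def)
    then show ?thesis
      by (auto simp: Is_def)
  qed
  moreover have "min t (card {i \<in> I. f' i = \<tau>}) = min t (card {j \<in> J. g' j = \<tau>})" for \<tau>
  proof -
    let ?S = "f ` I \<union> g ` J"
    have "{i \<in> I. f' i = \<tau>} = (\<Union>\<sigma>\<in>?S. {i \<in> Is \<sigma>. f' i = \<tau>})"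
      by (auto simp: Is_def)
    also have "card \<dots> = (\<Sum>\<sigma>\<in>?S. card {i \<in> Is \<sigma>. f' i = \<tau>})"
      using fin by (intro card_UN_disjoint) (auto simp: Is_def)
    finally have 1: "card {i \<in> I. f' i = \<tau>} = (\<Sum>\<sigma>\<in>?S. card {i \<in> Is \<sigma>. f' i = \<tau>})" .
    have "{j \<in> J. g' j = \<tau>} = (\<Union>\<sigma>\<in>?S. {j \<in> Js \<sigma>. h \<sigma> j = \<tau>})"
      by (auto simp: Js_def g'_def)
    also have "card \<dots> = (\<Sum>\<sigma>\<in>?S. card {j \<in> Js \<sigma>. h \<sigma> j = \<tau>})"
      using fin by (intro card_UN_disjoint) (auto simp: Js_def)
    finally have 2: "card {j \<in> J. g' j = \<tau>} = (\<Sum>\<sigma>\<in>?S. card {j \<in> Js \<sigma>. h \<sigma> j = \<tau>})" .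
    show ?thesis
      unfolding 1 2 using fin by (intro min_sum_cong agreeD[OF h(2)]) auto
  qed
  ultimately show ?thesis
    by (auto simp: agree_def)
qed

definition parts :: "'i set \<Rightarrow> ('i \<Rightarrow> 'a set) \<Rightarrow> ('i \<Rightarrow> 'a rel) \<Rightarrow> bool" where
  "parts I V E \<longleftrightarrow> finite I \<and> disjoint_family_on V I \<and> (\<forall>i\<in>I. finite (V i) \<and> E i \<subseteq> V i \<times> V i)"

text \<open>Common elements and arcs each live inside one part, so a single part of equal type
  supplies them. Being a singleton concerns all parts: exactly one of them meets the set, and in one
  vertex. This needs counting up to 2.\<close>

lemma atoms_union_mono:
  assumes I: "parts I V E" "\<forall>X\<in>U. e X \<subseteq> (\<Union>i\<in>I. V i)"
    and J: "parts J V' E'" "\<forall>X\<in>U. e' X \<subseteq> (\<Union>j\<in>J. V' j)"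
    and agree: "agree t (\<lambda>i. tp k U (V i) (E i) (\<lambda>X. e X \<inter> V i)) I
      (\<lambda>j. tp k U (V' j) (E' j) (\<lambda>X. e' X \<inter> V' j)) J" "2 \<le> t"
  shows "X \<in> U \<Longrightarrow> Y \<in> U \<Longrightarrow> e X \<inter> e Y \<noteq> {} \<Longrightarrow> e' X \<inter> e' Y \<noteq> {}"
    and "X \<in> U \<Longrightarrow> Y \<in> U \<Longrightarrow> \<exists>u\<in>e X. \<exists>v\<in>e Y. (u, v) \<in> (\<Union>i\<in>I. E i) \<Longrightarrow>
      \<exists>u\<in>e' X. \<exists>v\<in>e' Y. (u, v) \<in> (\<Union>j\<in>J. E' j)"
    and "X \<in> U \<Longrightarrow> \<exists>x. e X = {x} \<Longrightarrow> \<exists>x. e' X = {x}"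
proof -
  let ?f = "\<lambda>i. tp k U (V i) (E i) (\<lambda>X. e X \<inter> V i)"
  let ?g = "\<lambda>j. tp k U (V' j) (E' j) (\<lambda>X. e' X \<inter> V' j)"
  have fin: "finite I" "finite J"
    using I(1) J(1) by (auto simp: parts_def)
  have same: "atoms U (E i) (\<lambda>X. e X \<inter> V i) = atoms U (E' j) (\<lambda>X. e' X \<inter> V' j)" if "?g j = ?f i" for i j
    using arg_cong[OF that, of ty_atoms] by simp
  have ex: "\<exists>j\<in>J. ?g j = ?f i" if "i \<in> I" for i
    by (rule agree_ex[OF agree(1) _ fin that]) (use agree(2) in auto)
  have ex': "\<exists>i\<in>I. ?f i = ?g j" if "j \<in> J" for j
    by (rule agree_ex[OF agree_sym[OF agree(1)] _ fin(2,1) that]) (use agree(2) in auto)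
  show "e' X \<inter> e' Y \<noteq> {}" if XY: "X \<in> U" "Y \<in> U" "e X \<inter> e Y \<noteq> {}"
  proof -
    obtain x i where x: "x \<in> e X" "x \<in> e Y" "i \<in> I" "x \<in> V i"
      using XY I(2) by blast
    obtain j where j: "j \<in> J" "?g j = ?f i"
      using ex x by blast
    have "(X, Y) \<in> fst (atoms U (E i) (\<lambda>X. e X \<inter> V i))"
      using XY x by (auto simp: atoms_def)
    then show ?thesis
      unfolding same[OF j(2)] by (auto simp: atoms_def)
  qed
  show "\<exists>u\<in>e' X. \<exists>v\<in>e' Y. (u, v) \<in> (\<Union>j\<in>J. E' j)"
    if XY: "X \<in> U" "Y \<in> U" "\<exists>u\<in>e X. \<exists>v\<in>e Y. (u, v) \<in> (\<Union>i\<in>I. E i)"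
  proof -
    obtain u v i where x: "u \<in> e X" "v \<in> e Y" "i \<in> I" "(u, v) \<in> E i"
      using XY by blast
    have uv: "u \<in> V i" "v \<in> V i"
      using I(1) x by (auto simp: parts_def)
    obtain j where j: "j \<in> J" "?g j = ?f i"
      using ex x by blast
    have "(X, Y) \<in> fst (snd (atoms U (E i) (\<lambda>X. e X \<inter> V i)))"
      using XY x uv by (auto simp: atoms_def)
    then show ?thesis
      using j(1) unfolding same[OF j(2)] by (auto simp: atoms_def)
  qed
  show "\<exists>x. e' X = {x}" if X: "X \<in> U" "\<exists>x. e X = {x}"
  proof -
    obtain x where x: "e X = {x}"
      using X by blast
    then have "x \<in> (\<Union>i\<in>I. V i)"
      using I(2) X(1) by blast
    then obtain i where i: "i \<in> I" "x \<in> V i"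
      by blast
    have only_i: "i' = i" if "i' \<in> I" "e X \<inter> V i' \<noteq> {}" for i'
      using that i x I(1) by (auto simp: parts_def disjoint_family_on_def)
    have nonempty_iff: "e' X \<inter> V' j \<noteq> {} \<longleftrightarrow> e X \<inter> V i' \<noteq> {}" if "?g j = ?f i'" for i' j
    proof -
      have "(X, X) \<in> fst (atoms U (E i') (\<lambda>X. e X \<inter> V i')) \<longleftrightarrow> (X, X) \<in> fst (atoms U (E' j) (\<lambda>X. e' X \<inter> V' j))"
        using same[OF that] by simp
      then show ?thesis
        using X(1) by (simp add: atoms_def)
    qed
    obtain j where j: "j \<in> J" "?g j = ?f i"
      using ex i by blast
    \<comment> \<open>The part containing \<open>x\<close> is the only one of its type, since the
      type records that \<open>X\<close> meets it. Threshold 2 tells one from several, so its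
      partner in \<open>J\<close> is unique too.\<close>
    have "{i' \<in> I. ?f i' = ?f i} = {i}"
    proof (intro equalityI subsetI)
      fix i' assume "i' \<in> {i' \<in> I. ?f i' = ?f i}"
      then have "i' \<in> I" "e X \<inter> V i' \<noteq> {}"
        using nonempty_iff[OF j(2)] nonempty_iff[of j i'] j(2) i x by auto
      then show "i' \<in> {i}"
        using only_i by blast
    qed (use i in auto)
    then have "card {j' \<in> J. ?g j' = ?f i} = 1"
      using agreeD[OF agree(1), of "?f i"] agree(2) by (auto simp: min_def split: if_splits)
    then obtain j0 where "{j' \<in> J. ?g j' = ?f i} = {j0}"
      by (auto simp: card_1_singleton_iff)
    then have single: "p \<in> {j0} \<longleftrightarrow> p \<in> J \<and> ?g p = ?f i" for p
      by blast
    then have only_j: "j' = j" if "j' \<in> J" "?g j' = ?f i" for j'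
      using iffD2[OF single[of j]] iffD2[OF single[of j']] that j by blast
    have "X \<in> snd (snd (atoms U (E i) (\<lambda>X. e X \<inter> V i)))"
      using X x i by (auto simp: atoms_def)
    then obtain y where y: "e' X \<inter> V' j = {y}"
      unfolding same[OF j(2)] by (auto simp: atoms_def)
    have "e' X \<subseteq> V' j"
    proof
      fix z assume z: "z \<in> e' X"
      then obtain j' where j': "j' \<in> J" "z \<in> V' j'"
        using J(2) X(1) by blast
      obtain i' where i': "i' \<in> I" "?f i' = ?g j'"
        using ex'[OF j'(1)] by blast
      have "e X \<inter> V i' \<noteq> {}"
        using nonempty_iff[OF i'(2)[symmetric]] z j' by auto
      then have "i' = i"
        using only_i i' by blast
      then show "z \<in> V' j"
        using only_j[OF j'(1)] i' j' by simp
    qed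
    then show ?thesis
      using y by (auto simp: Int_absorb2)
  qed
qed

lemma atoms_union:
  assumes "parts I V E" "\<forall>X\<in>U. e X \<subseteq> (\<Union>i\<in>I. V i)"
    and "parts J V' E'" "\<forall>X\<in>U. e' X \<subseteq> (\<Union>j\<in>J. V' j)"
    and "agree t (\<lambda>i. tp k U (V i) (E i) (\<lambda>X. e X \<inter> V i)) I
      (\<lambda>j. tp k U (V' j) (E' j) (\<lambda>X. e' X \<inter> V' j)) J" "2 \<le> t"
  shows "atoms U (\<Union>i\<in>I. E i) e = atoms U (\<Union>j\<in>J. E' j) e'"
proof -
  note 1 = atoms_union_mono[OF assms]
  note 2 = atoms_union_mono[OF assms(3,4,1,2) agree_sym[OF assms(5)] assms(6)]
  show ?thesis
    by (rule atoms_cong; rule iffI) (fact 1 2)+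
qed

text \<open>A set move on a union is a family of simultaneous moves on the parts. By
  \<open>agree_refine\<close> the other side can reply part by part so that the types one rank lower
  agree up to a smaller threshold. The threshold must not depend on the unions compared, hence the
  quantifiers inside.\<close>

lemma threshold:
  fixes U :: "'v set"
  assumes U: "finite U"
  shows "\<exists>t\<ge>2. \<forall>(I :: 'i set) (V :: 'i \<Rightarrow> 'a set) E e (J :: 'i set) (V' :: 'i \<Rightarrow> 'a set) E' e'.
    parts I V E \<longrightarrow> (\<forall>X\<in>U. e X \<subseteq> (\<Union>i\<in>I. V i)) \<longrightarrow>
    parts J V' E' \<longrightarrow> (\<forall>X\<in>U. e' X \<subseteq> (\<Union>j\<in>J. V' j)) \<longrightarrow>
    agree t (\<lambda>i. tp k U (V i) (E i) (\<lambda>X. e X \<inter> V i)) I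
      (\<lambda>j. tp k U (V' j) (E' j) (\<lambda>X. e' X \<inter> V' j)) J \<longrightarrow>
    tp k U (\<Union>i\<in>I. V i) (\<Union>i\<in>I. E i) e = tp k U (\<Union>j\<in>J. V' j) (\<Union>j\<in>J. E' j) e'"
proof (induction k)
  case 0
  show ?case
  proof (intro exI[of _ 2] conjI allI impI)
    fix I J :: "'i set" and V V' :: "'i \<Rightarrow> 'a set" and E E' and e e' :: "'v \<Rightarrow> 'a set"
    assume "parts (I :: 'i set) V E" "\<forall>X\<in>U. e X \<subseteq> (\<Union>i\<in>I. V i)"
      "parts (J :: 'i set) V' E'" "\<forall>X\<in>U. e' X \<subseteq> (\<Union>j\<in>J. V' j)"
      "agree 2 (\<lambda>i. tp 0 U (V i) (E i) (\<lambda>X. e X \<inter> V i)) I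
        (\<lambda>j. tp 0 U (V' j) (E' j) (\<lambda>X. e' X \<inter> V' j)) J"
    then show "tp 0 U (\<Union>i\<in>I. V i) (\<Union>i\<in>I. E i) e = tp 0 U (\<Union>j\<in>J. V' j) (\<Union>j\<in>J. E' j) e'"
      using atoms_union[of I V E U e J V' E' e' 2 0] by simp
  qed simp
next
  case (Suc k)
  then obtain t where t: "2 \<le> t" and IH: "\<And>(I :: 'i set) (V :: 'i \<Rightarrow> 'a set) E e (J :: 'i set) (V' :: 'i \<Rightarrow> 'a set) E' e'.
    parts I V E \<Longrightarrow> \<forall>X\<in>U. e X \<subseteq> (\<Union>i\<in>I. V i) \<Longrightarrow>
    parts J V' E' \<Longrightarrow> \<forall>X\<in>U. e' X \<subseteq> (\<Union>j\<in>J. V' j) \<Longrightarrow>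
    agree t (\<lambda>i. tp k U (V i) (E i) (\<lambda>X. e X \<inter> V i)) I
      (\<lambda>j. tp k U (V' j) (E' j) (\<lambda>X. e' X \<inter> V' j)) J \<Longrightarrow>
    tp k U (\<Union>i\<in>I. V i) (\<Union>i\<in>I. E i) e = tp k U (\<Union>j\<in>J. V' j) (\<Union>j\<in>J. E' j) e'"
    by blast
  let ?T = "{tp k U V E e | (V :: 'a set) E e. finite V}"
  \<comment> \<open>\<open>card ?T * t + 1\<close> is what \<open>agree_refine\<close> requires; one
    more guarantees at least 2, as the atoms demand.\<close>
  define s where "s = card ?T * t + 2"
  have step: "\<exists>B\<subseteq>(\<Union>j\<in>J. V' j). tp k U (\<Union>i\<in>I. V i) (\<Union>i\<in>I. E i) (e(X := A)) =
      tp k U (\<Union>j\<in>J. V' j) (\<Union>j\<in>J. E' j) (e'(X := B))"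
    if I: "parts I V E" "\<forall>X\<in>U. e X \<subseteq> (\<Union>i\<in>I. V i)"
      and J: "parts J V' E'" "\<forall>X\<in>U. e' X \<subseteq> (\<Union>j\<in>J. V' j)"
      and agree: "agree s (\<lambda>i. tp (Suc k) U (V i) (E i) (\<lambda>X. e X \<inter> V i)) I
        (\<lambda>j. tp (Suc k) U (V' j) (E' j) (\<lambda>X. e' X \<inter> V' j)) J"
      and X: "X \<in> U" "A \<subseteq> (\<Union>i\<in>I. V i)"
    for I J :: "'i set" and V V' :: "'i \<Rightarrow> 'a set" and E E' e e' X A
  proof -
    let ?f = "\<lambda>i. tp (Suc k) U (V i) (E i) (\<lambda>X. e X \<inter> V i)"
    let ?g = "\<lambda>j. tp (Suc k) U (V' j) (E' j) (\<lambda>X. e' X \<inter> V' j)"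
    let ?f' = "\<lambda>i. tp k U (V i) (E i) ((\<lambda>X. e X \<inter> V i)(X := A \<inter> V i))"
    have fin: "finite I" "finite J" "\<And>i. i \<in> I \<Longrightarrow> finite (V i)" "\<And>j. j \<in> J \<Longrightarrow> finite (V' j)"
      using I(1) J(1) by (auto simp: parts_def)
    \<comment> \<open>The traces of \<open>A\<close> on the parts recolour \<open>I\<close>, and
      \<open>J\<close> is recoloured to match. Each \<open>j\<close> copies an \<open>i\<close> of
      equal type of rank \<open>Suc k\<close>, so \<open>tp_step\<close> can realise the new colour
      by a set in part \<open>j\<close>.\<close>
    have "\<exists>g'. (\<forall>j\<in>J. \<exists>i\<in>I. ?f i = ?g j \<and> ?f' i = g' j) \<and> agree t ?f' I g' J"
    proof (rule agree_refine[OF fin(1,2)])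
      show "finite ?T"
        by (rule finite_types[OF U])
      show "?f' ` I \<subseteq> ?T"
        using fin(3) by blast
      show "agree (card ?T * t + 1) ?f I ?g J"
        using agree_mono[OF agree] by (simp add: s_def)
    qed
    then obtain g' where g': "\<And>j. j \<in> J \<Longrightarrow> \<exists>i\<in>I. ?f i = ?g j \<and> ?f' i = g' j" "agree t ?f' I g' J"
      by blast
    have "\<exists>B\<subseteq>V' j. tp k U (V' j) (E' j) ((\<lambda>X. e' X \<inter> V' j)(X := B)) = g' j" if jJ: "j \<in> J" for j
    proof -
      obtain i where i: "i \<in> I" "?f i = ?g j" "?f' i = g' j"
        using g'(1)[OF \<open>j \<in> J\<close>] by blast
      obtain B where "B \<subseteq> V' j" "?f' i = tp k U (V' j) (E' j) ((\<lambda>X. e' X \<inter> V' j)(X := B))"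
        by (rule tp_step[OF i(2) U fin(3)[OF i(1)] fin(4)[OF jJ] X(1), of "A \<inter> V i"]) auto
      then show ?thesis
        using i(3) by metis
    qed
    then obtain B where B: "\<And>j. j \<in> J \<Longrightarrow> B j \<subseteq> V' j"
      "\<And>j. j \<in> J \<Longrightarrow> tp k U (V' j) (E' j) ((\<lambda>X. e' X \<inter> V' j)(X := B j)) = g' j"
      by metis
    let ?B = "\<Union>j\<in>J. B j"
    have restr: "(\<lambda>Y. (e(X := A)) Y \<inter> V i) = (\<lambda>X. e X \<inter> V i)(X := A \<inter> V i)" for i
      by (auto simp: fun_eq_iff)
    have restr': "(\<lambda>Y. (e'(X := ?B)) Y \<inter> V' j) = (\<lambda>X. e' X \<inter> V' j)(X := B j)" if "j \<in> J" for j
    proof -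
      have "?B \<inter> V' j = B j"
      proof (intro equalityI subsetI)
        fix x assume x: "x \<in> ?B \<inter> V' j"
        then obtain j' where j': "j' \<in> J" "x \<in> B j'"
          by blast
        then have "x \<in> V' j' \<inter> V' j"
          using B(1) x by blast
        then have "j' = j"
          using J(1) j'(1) that by (auto simp: parts_def disjoint_family_on_def)
        then show "x \<in> B j"
          using j'(2) by simp
      qed (use B(1)[OF that] that in blast)
      then show ?thesis
        by (auto simp: fun_eq_iff)
    qed
    have "agree t (\<lambda>i. tp k U (V i) (E i) (\<lambda>Y. (e(X := A)) Y \<inter> V i)) I
      (\<lambda>j. tp k U (V' j) (E' j) (\<lambda>Y. (e'(X := ?B)) Y \<inter> V' j)) J"
    proof -
      have "{j \<in> J. tp k U (V' j) (E' j) (\<lambda>Y. (e'(X := ?B)) Y \<inter> V' j) = \<tau>} = {j \<in> J. g' j = \<tau>}" for \<tau>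
        using B(2) restr' by auto
      then show ?thesis
        using g'(2) unfolding agree_def restr by (simp only: simp_thms)
    qed
    moreover have B_sub: "?B \<subseteq> (\<Union>j\<in>J. V' j)"
      using B(1) by blast
    have "\<forall>Y\<in>U. (e'(X := ?B)) Y \<subseteq> (\<Union>j\<in>J. V' j)"
      using J(2) B_sub by simp
    moreover
    have "\<forall>Y\<in>U. (e(X := A)) Y \<subseteq> (\<Union>i\<in>I. V i)"
      using I(2) X(2) by simp
    ultimately have "tp k U (\<Union>i\<in>I. V i) (\<Union>i\<in>I. E i) (e(X := A)) =
        tp k U (\<Union>j\<in>J. V' j) (\<Union>j\<in>J. E' j) (e'(X := ?B))"
      by (intro IH[OF I(1) _ J(1)])
    with B_sub show ?thesis by blast
  qed
  show ?case
  proof (intro exI[of _ s] conjI allI impI)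
    show "2 \<le> s"
      by (simp add: s_def)
    fix I J :: "'i set" and V V' :: "'i \<Rightarrow> 'a set" and E E' and e e' :: "'v \<Rightarrow> 'a set"
    assume I: "parts (I :: 'i set) V E" "\<forall>X\<in>U. e X \<subseteq> (\<Union>i\<in>I. V i)"
      and J: "parts (J :: 'i set) V' E'" "\<forall>X\<in>U. e' X \<subseteq> (\<Union>j\<in>J. V' j)"
      and agree: "agree s (\<lambda>i. tp (Suc k) U (V i) (E i) (\<lambda>X. e X \<inter> V i)) I
        (\<lambda>j. tp (Suc k) U (V' j) (E' j) (\<lambda>X. e' X \<inter> V' j)) J"
    have fin: "finite (\<Union>i\<in>I. V i)" "finite (\<Union>j\<in>J. V' j)"
      using I(1) J(1) by (auto simp: parts_def)
    have "atoms U (\<Union>i\<in>I. E i) e = atoms U (\<Union>j\<in>J. E' j) e'"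
      by (rule atoms_union[OF I(1) _ J(1) _ agree]) (use I(2) J(2) in \<open>auto simp: s_def\<close>)
    then show "tp (Suc k) U (\<Union>i\<in>I. V i) (\<Union>i\<in>I. E i) e = tp (Suc k) U (\<Union>j\<in>J. V' j) (\<Union>j\<in>J. E' j) e'"
      unfolding tp_Suc_eq_iff[OF U fin]
      using step[OF I J agree] step[OF J I agree_sym[OF agree]] by metis
  qed
qed

section \<open>Formulas and types\<close>

text \<open>Vertex variables are \<open>Inl\<close>, set variables \<open>Inr\<close> of
  \<open>Inl\<close>. The two further names are labels that no formula can rebind; they encode the
  edges at the root of a star.\<close>

type_synonym mso_var = "nat + nat + bool"

abbreviation "root_var \<equiv> (Inr (Inr True) :: mso_var)"
abbreviation "attached_var \<equiv> (Inr (Inr False) :: mso_var)"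

primrec quant_rank :: "mso \<Rightarrow> nat" where
  "quant_rank (Eq x y) = 0"
| "quant_rank (Adj x y) = 0"
| "quant_rank (Mem x X) = 0"
| "quant_rank (Neg \<phi>) = quant_rank \<phi>"
| "quant_rank (Conj \<phi> \<psi>) = max (quant_rank \<phi>) (quant_rank \<psi>)"
| "quant_rank (Disj \<phi> \<psi>) = max (quant_rank \<phi>) (quant_rank \<psi>)"
| "quant_rank (Impl \<phi> \<psi>) = max (quant_rank \<phi>) (quant_rank \<psi>)"
| "quant_rank (ExV x \<phi>) = Suc (quant_rank \<phi>)"
| "quant_rank (AllV x \<phi>) = Suc (quant_rank \<phi>)"
| "quant_rank (ExS X \<phi>) = Suc (quant_rank \<phi>)"
| "quant_rank (AllS X \<phi>) = Suc (quant_rank \<phi>)"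

primrec mso_vars :: "mso \<Rightarrow> mso_var set" where
  "mso_vars (Eq x y) = {Inl x, Inl y}"
| "mso_vars (Adj x y) = {Inl x, Inl y}"
| "mso_vars (Mem x X) = {Inl x, Inr (Inl X)}"
| "mso_vars (Neg \<phi>) = mso_vars \<phi>"
| "mso_vars (Conj \<phi> \<psi>) = mso_vars \<phi> \<union> mso_vars \<psi>"
| "mso_vars (Disj \<phi> \<psi>) = mso_vars \<phi> \<union> mso_vars \<psi>"
| "mso_vars (Impl \<phi> \<psi>) = mso_vars \<phi> \<union> mso_vars \<psi>"
| "mso_vars (ExV x \<phi>) = insert (Inl x) (mso_vars \<phi>)"
| "mso_vars (AllV x \<phi>) = insert (Inl x) (mso_vars \<phi>)"
| "mso_vars (ExS X \<phi>) = insert (Inr (Inl X)) (mso_vars \<phi>)"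
| "mso_vars (AllS X \<phi>) = insert (Inr (Inl X)) (mso_vars \<phi>)"

lemma finite_mso_vars: "finite (mso_vars \<phi>)"
  by (induction \<phi>) auto

text \<open>The environment \<open>e\<close> represents a vertex variable by a singleton; \<open>G\<close> is obtained from the arcs
  \<open>E\<close> by linking every vertex of \<open>e root_var\<close> to every vertex of \<open>e attached_var\<close>.\<close>

definition env_rel :: "mso \<Rightarrow> 'a pair_pre_digraph \<Rightarrow> 'a rel \<Rightarrow> (mso_var \<Rightarrow> 'a set) \<Rightarrow> (nat \<Rightarrow> 'a) \<Rightarrow> (nat \<Rightarrow> 'a set) \<Rightarrow> bool" where
  "env_rel \<phi> G E e s S \<longleftrightarrow> finite (pverts G) \<and>
     parcs G = E \<union> e root_var \<times> e attached_var \<union> e attached_var \<times> e root_var \<and>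
     (\<forall>x\<in>free_vertex_vars \<phi>. e (Inl x) = {s x}) \<and> (\<forall>X\<in>free_set_vars \<phi>. e (Inr (Inl X)) = S X)"

lemma env_rel_ExV: "env_rel (ExV x \<phi>) G E e s S \<Longrightarrow> env_rel \<phi> G E (e(Inl x := {v})) (s(x := v)) S"
  by (auto simp: env_rel_def)

lemma env_rel_AllV: "env_rel (AllV x \<phi>) G E e s S \<Longrightarrow> env_rel \<phi> G E (e(Inl x := {v})) (s(x := v)) S"
  by (auto simp: env_rel_def)

lemma env_rel_ExS: "env_rel (ExS X \<phi>) G E e s S \<Longrightarrow> env_rel \<phi> G E (e(Inr (Inl X) := A)) s (S(X := A))"
  by (auto simp: env_rel_def)

lemma env_rel_AllS: "env_rel (AllS X \<phi>) G E e s S \<Longrightarrow> env_rel \<phi> G E (e(Inr (Inl X) := A)) s (S(X := A))"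
  by (auto simp: env_rel_def)

lemma tp_eq_atoms:
  assumes "tp k U V E e = tp k U V' E' e'"
  shows "X \<in> U \<Longrightarrow> Y \<in> U \<Longrightarrow> e X \<inter> e Y \<noteq> {} \<longleftrightarrow> e' X \<inter> e' Y \<noteq> {}"
    and "X \<in> U \<Longrightarrow> Y \<in> U \<Longrightarrow> (\<exists>u\<in>e X. \<exists>v\<in>e Y. (u, v) \<in> E) \<longleftrightarrow> (\<exists>u\<in>e' X. \<exists>v\<in>e' Y. (u, v) \<in> E')"
    and "X \<in> U \<Longrightarrow> (\<exists>x. e X = {x}) \<longleftrightarrow> (\<exists>x. e' X = {x})"
proof -
  have eq: "atoms U E e = atoms U E' e'"
    using arg_cong[OF assms, of ty_atoms] by simp
  show "e X \<inter> e Y \<noteq> {} \<longleftrightarrow> e' X \<inter> e' Y \<noteq> {}" if "X \<in> U" "Y \<in> U"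
    using arg_cong[OF eq, of "\<lambda>a. (X, Y) \<in> fst a"] that by (simp add: atoms_def)
  show "(\<exists>u\<in>e X. \<exists>v\<in>e Y. (u, v) \<in> E) \<longleftrightarrow> (\<exists>u\<in>e' X. \<exists>v\<in>e' Y. (u, v) \<in> E')" if "X \<in> U" "Y \<in> U"
    using arg_cong[OF eq, of "\<lambda>a. (X, Y) \<in> fst (snd a)"] that by (simp add: atoms_def)
  show "(\<exists>x. e X = {x}) \<longleftrightarrow> (\<exists>x. e' X = {x})" if "X \<in> U"
    using arg_cong[OF eq, of "\<lambda>a. X \<in> snd (snd a)"] that by (simp add: atoms_def)
qed

text \<open>Singletons are visible in the atoms, so the reply to a vertex is again a vertex.\<close>

lemma tp_step_vertex:
  assumes "tp (Suc k) U V E e = tp (Suc k) U V' E' e'" "finite U" "finite V" "finite V'" "X \<in> U" "v \<in> V"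
  obtains w where "w \<in> V'" "tp k U V E (e(X := {v})) = tp k U V' E' (e'(X := {w}))"
proof -
  obtain B where B: "B \<subseteq> V'" "tp k U V E (e(X := {v})) = tp k U V' E' (e'(X := B))"
    using tp_step[OF assms(1-5), of "{v}"] assms(6) by auto
  obtain w where "B = {w}"
    using tp_eq_atoms(3)[OF B(2) assms(5)] by auto
  with B show ?thesis
    using that by auto
qed

lemma set_quantifier_transfer:
  assumes tp: "tp (Suc k) U V E e = tp (Suc k) U V' E' e'" and fin: "finite U" "finite V" "finite V'" and X: "X \<in> U"
    and iff: "\<And>A B. tp k U V E (e(X := A)) = tp k U V' E' (e'(X := B)) \<Longrightarrow> P A \<longleftrightarrow> Q B"
  shows "(\<exists>A\<subseteq>V. P A) \<longleftrightarrow> (\<exists>B\<subseteq>V'. Q B)" "(\<forall>A\<subseteq>V. P A) \<longleftrightarrow> (\<forall>B\<subseteq>V'. Q B)"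
proof -
  have "\<exists>B\<subseteq>V'. P A \<longleftrightarrow> Q B" if "A \<subseteq> V" for A
    by (rule tp_step[OF tp fin X that]) (use iff in blast)
  moreover have "\<exists>A\<subseteq>V. P A \<longleftrightarrow> Q B" if "B \<subseteq> V'" for B
    by (rule tp_step[OF tp[symmetric] fin(1,3,2) X that]) (use iff[OF sym] in blast)
  ultimately show "(\<exists>A\<subseteq>V. P A) \<longleftrightarrow> (\<exists>B\<subseteq>V'. Q B)" "(\<forall>A\<subseteq>V. P A) \<longleftrightarrow> (\<forall>B\<subseteq>V'. Q B)"
    by metis+
qed

lemma vertex_quantifier_transfer:
  assumes tp: "tp (Suc k) U V E e = tp (Suc k) U V' E' e'" and fin: "finite U" "finite V" "finite V'" and X: "X \<in> U"
    and iff: "\<And>v w. tp k U V E (e(X := {v})) = tp k U V' E' (e'(X := {w})) \<Longrightarrow> P v \<longleftrightarrow> Q w"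
  shows "(\<exists>v\<in>V. P v) \<longleftrightarrow> (\<exists>w\<in>V'. Q w)" "(\<forall>v\<in>V. P v) \<longleftrightarrow> (\<forall>w\<in>V'. Q w)"
proof -
  have "\<exists>w\<in>V'. P v \<longleftrightarrow> Q w" if "v \<in> V" for v
    by (rule tp_step_vertex[OF tp fin X that]) (use iff in blast)
  moreover have "\<exists>v\<in>V. P v \<longleftrightarrow> Q w" if "w \<in> V'" for w
    by (rule tp_step_vertex[OF tp[symmetric] fin(1,3,2) X that]) (use iff[OF sym] in blast)
  ultimately show "(\<exists>v\<in>V. P v) \<longleftrightarrow> (\<exists>w\<in>V'. Q w)" "(\<forall>v\<in>V. P v) \<longleftrightarrow> (\<forall>w\<in>V'. Q w)"
    by metis+
qed

text \<open>Each quantifier uses up one rank by back-and-forth. Adjacency in \<open>G\<close> is an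
  arc of \<open>E\<close> or a link between the two labels, and both are atomic information.\<close>

lemma sat_tp:
  assumes "tp k U (pverts G) E e = tp k U (pverts H) E' e'" "quant_rank \<phi> \<le> k"
    and "finite U" "mso_vars \<phi> \<union> {root_var, attached_var} \<subseteq> U"
    and "env_rel \<phi> G E e s S" "env_rel \<phi> H E' e' s' S'"
  shows "mso_sat G s S \<phi> \<longleftrightarrow> mso_sat H s' S' \<phi>"
  using assms
proof (induction \<phi> arbitrary: k e e' s s' S S')
  case (Eq x y)
  have "e (Inl x) = {s x}" "e (Inl y) = {s y}" "e' (Inl x) = {s' x}" "e' (Inl y) = {s' y}"
    using Eq.prems(5,6) by (auto simp: env_rel_def)
  moreover have "Inl x \<in> U" "Inl y \<in> U"
    using Eq.prems(4) by simp_all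
  ultimately show ?case
    using tp_eq_atoms(1)[OF Eq.prems(1), of "Inl y" "Inl x"] by simp
next
  case (Mem x X)
  have "e (Inl x) = {s x}" "e (Inr (Inl X)) = S X" "e' (Inl x) = {s' x}" "e' (Inr (Inl X)) = S' X"
    using Mem.prems(5,6) by (auto simp: env_rel_def)
  moreover have "Inl x \<in> U" "Inr (Inl X) \<in> U"
    using Mem.prems(4) by simp_all
  ultimately show ?case
    using tp_eq_atoms(1)[OF Mem.prems(1), of "Inl x" "Inr (Inl X)"] by simp
next
  case (Adj x y)
  have U: "Inl x \<in> U" "Inl y \<in> U" "root_var \<in> U" "attached_var \<in> U"
    using Adj.prems(4) by auto
  have G: "e (Inl x) = {s x}" "e (Inl y) = {s y}" "parcs G = E \<union> e root_var \<times> e attached_var \<union> e attached_var \<times> e root_var"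
    using Adj.prems(5) by (auto simp: env_rel_def)
  have H: "e' (Inl x) = {s' x}" "e' (Inl y) = {s' y}" "parcs H = E' \<union> e' root_var \<times> e' attached_var \<union> e' attached_var \<times> e' root_var"
    using Adj.prems(6) by (auto simp: env_rel_def)
  have mem: "s z \<in> e X \<longleftrightarrow> s' z \<in> e' X" if "z \<in> {x, y}" "X \<in> U" for z X
    using tp_eq_atoms(1)[OF Adj.prems(1), of "Inl z" X] U(1,2) G(1,2) H(1,2) that
    by (elim insertE emptyE) simp_all
  have "(s x, s y) \<in> E \<longleftrightarrow> (s' x, s' y) \<in> E'"
    using tp_eq_atoms(2)[OF Adj.prems(1) U(1,2)] G(1,2) H(1,2) by simp
  then show ?case
    using mem[of x] mem[of y] U(3,4) by (simp add: G(3) H(3))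
next
  case (Neg \<phi>)
  have "mso_sat G s S \<phi> \<longleftrightarrow> mso_sat H s' S' \<phi>"
    by (rule Neg.IH[OF Neg.prems(1)]) (use Neg.prems in \<open>auto simp: env_rel_def\<close>)
  then show ?case by simp
next
  case (Conj \<phi> \<psi>)
  have "mso_sat G s S \<phi> \<longleftrightarrow> mso_sat H s' S' \<phi>"
    by (rule Conj.IH(1)[OF Conj.prems(1)]) (use Conj.prems in \<open>auto simp: env_rel_def\<close>)
  moreover have "mso_sat G s S \<psi> \<longleftrightarrow> mso_sat H s' S' \<psi>"
    by (rule Conj.IH(2)[OF Conj.prems(1)]) (use Conj.prems in \<open>auto simp: env_rel_def\<close>)
  ultimately show ?case by simp
next
  case (Disj \<phi> \<psi>)
  have "mso_sat G s S \<phi> \<longleftrightarrow> mso_sat H s' S' \<phi>"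
    by (rule Disj.IH(1)[OF Disj.prems(1)]) (use Disj.prems in \<open>auto simp: env_rel_def\<close>)
  moreover have "mso_sat G s S \<psi> \<longleftrightarrow> mso_sat H s' S' \<psi>"
    by (rule Disj.IH(2)[OF Disj.prems(1)]) (use Disj.prems in \<open>auto simp: env_rel_def\<close>)
  ultimately show ?case by simp
next
  case (Impl \<phi> \<psi>)
  have "mso_sat G s S \<phi> \<longleftrightarrow> mso_sat H s' S' \<phi>"
    by (rule Impl.IH(1)[OF Impl.prems(1)]) (use Impl.prems in \<open>auto simp: env_rel_def\<close>)
  moreover have "mso_sat G s S \<psi> \<longleftrightarrow> mso_sat H s' S' \<psi>"
    by (rule Impl.IH(2)[OF Impl.prems(1)]) (use Impl.prems in \<open>auto simp: env_rel_def\<close>)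
  ultimately show ?case by simp
next
  case (ExV x \<phi>)
  obtain k' where k: "k = Suc k'" "quant_rank \<phi> \<le> k'"
    using ExV.prems(2) by (cases k) auto
  have U: "Inl x \<in> U" "mso_vars \<phi> \<union> {root_var, attached_var} \<subseteq> U"
    using ExV.prems(4) by auto
  have fin: "finite (pverts G)" "finite (pverts H)"
    using ExV.prems(5,6) by (auto simp: env_rel_def)
  note IH = ExV.IH[OF _ k(2) ExV.prems(3) U(2) env_rel_ExV[OF ExV.prems(5)] env_rel_ExV[OF ExV.prems(6)]]
  show ?case
    unfolding mso_sat.simps
    by (rule vertex_quantifier_transfer(1)[OF ExV.prems(1)[unfolded k(1)] ExV.prems(3) fin U(1) IH])
next
  case (AllV x \<phi>)
  obtain k' where k: "k = Suc k'" "quant_rank \<phi> \<le> k'"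
    using AllV.prems(2) by (cases k) auto
  have U: "Inl x \<in> U" "mso_vars \<phi> \<union> {root_var, attached_var} \<subseteq> U"
    using AllV.prems(4) by auto
  have fin: "finite (pverts G)" "finite (pverts H)"
    using AllV.prems(5,6) by (auto simp: env_rel_def)
  note IH = AllV.IH[OF _ k(2) AllV.prems(3) U(2) env_rel_AllV[OF AllV.prems(5)] env_rel_AllV[OF AllV.prems(6)]]
  show ?case
    unfolding mso_sat.simps
    by (rule vertex_quantifier_transfer(2)[OF AllV.prems(1)[unfolded k(1)] AllV.prems(3) fin U(1) IH])
next
  case (ExS X \<phi>)
  obtain k' where k: "k = Suc k'" "quant_rank \<phi> \<le> k'"
    using ExS.prems(2) by (cases k) auto
  have U: "Inr (Inl X) \<in> U" "mso_vars \<phi> \<union> {root_var, attached_var} \<subseteq> U"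
    using ExS.prems(4) by auto
  have fin: "finite (pverts G)" "finite (pverts H)"
    using ExS.prems(5,6) by (auto simp: env_rel_def)
  note IH = ExS.IH[OF _ k(2) ExS.prems(3) U(2) env_rel_ExS[OF ExS.prems(5)] env_rel_ExS[OF ExS.prems(6)]]
  show ?case
    unfolding mso_sat.simps
    by (rule set_quantifier_transfer(1)[OF ExS.prems(1)[unfolded k(1)] ExS.prems(3) fin U(1) IH])
next
  case (AllS X \<phi>)
  obtain k' where k: "k = Suc k'" "quant_rank \<phi> \<le> k'"
    using AllS.prems(2) by (cases k) auto
  have U: "Inr (Inl X) \<in> U" "mso_vars \<phi> \<union> {root_var, attached_var} \<subseteq> U"
    using AllS.prems(4) by auto
  have fin: "finite (pverts G)" "finite (pverts H)"
    using AllS.prems(5,6) by (auto simp: env_rel_def)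
  note IH = AllS.IH[OF _ k(2) AllS.prems(3) U(2) env_rel_AllS[OF AllS.prems(5)] env_rel_AllS[OF AllS.prems(6)]]
  show ?case
    unfolding mso_sat.simps
    by (rule set_quantifier_transfer(2)[OF AllS.prems(1)[unfolded k(1)] AllS.prems(3) fin U(1) IH])
qed

section \<open>Stars\<close>

definition star :: "'a pair_pre_digraph \<Rightarrow> 'a \<Rightarrow> 'i set \<Rightarrow> ('i \<Rightarrow> 'a pair_pre_digraph) \<Rightarrow> ('i \<Rightarrow> 'a) \<Rightarrow> bool" where
  "star G r I B x \<longleftrightarrow> finite I \<and> disjoint_family_on (\<lambda>i. pverts (B i)) I \<and>
     (\<forall>i\<in>I. pair_graph (B i) \<and> x i \<in> pverts (B i) \<and> r \<notin> pverts (B i)) \<and>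
     pverts G = insert r (\<Union>i\<in>I. pverts (B i)) \<and>
     parcs G = (\<Union>i\<in>I. parcs (B i)) \<union> {r} \<times> x ` I \<union> x ` I \<times> {r}"

text \<open>What the environment of a whole star restricts to on one branch: the root label is empty
  there, and the attachment label marks a single vertex.\<close>

definition rooted_type :: "nat \<Rightarrow> mso_var set \<Rightarrow> 'a pair_pre_digraph \<Rightarrow> 'a \<Rightarrow> mso_var ty" where
  "rooted_type k U H x = tp k U (pverts H) (parcs H) ((\<lambda>_. {})(attached_var := {x}))"

lemma rooted_type_relabel:
  assumes "finite U" "pair_graph H" "x \<in> pverts H" "inj_on f (pverts H)"
  shows "rooted_type k U (relabel f H) (f x) = rooted_type k U H x"
proof -
  have upd: "(\<lambda>Y. f ` ((\<lambda>_. {})(attached_var := {x})) Y) = (\<lambda>_. {})(attached_var := {f x})"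
    by (auto simp: fun_eq_iff)
  have "tp k U (f ` pverts H) (map_prod f f ` parcs H) (\<lambda>Y. f ` ((\<lambda>_. {})(attached_var := {x})) Y) =
      tp k U (pverts H) (parcs H) ((\<lambda>_. {})(attached_var := {x}))"
    by (rule tp_relabel[OF assms(1) pair_graphD(1)[OF assms(2)] assms(4)])
      (use assms(3) in \<open>auto dest: pair_graph_arcD[OF assms(2)]\<close>)
  then show ?thesis
    unfolding upd by (simp add: rooted_type_def)
qed

text \<open>Without its links a star is the disjoint union of its root and its branches, to which
  \<open>threshold\<close> applies. The links are definable from the two labels, so
  \<open>sat_tp\<close> covers the star itself.\<close>

lemma star_sat:
  fixes \<phi> :: mso
  assumes sentence: "mso_sentence \<phi>"
  obtains k U t where "finite U" "\<And>(G :: 'a pair_pre_digraph) (G' :: 'a pair_pre_digraph) r r' I J B B' x x'.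
    star G r (I :: 'i set) B x \<Longrightarrow> star G' r' (J :: 'i set) B' x' \<Longrightarrow>
    agree t (\<lambda>i. rooted_type k U (B i) (x i)) I (\<lambda>j. rooted_type k U (B' j) (x' j)) J \<Longrightarrow>
    G \<Turnstile> \<phi> \<longleftrightarrow> G' \<Turnstile> \<phi>"
proof -
  define U where "U = mso_vars \<phi> \<union> {root_var, attached_var}"
  define k where "k = quant_rank \<phi>"
  have U: "finite U"
    using finite_mso_vars by (simp add: U_def)
  obtain t where t: "\<And>(I :: 'i option set) (V :: 'i option \<Rightarrow> 'a set) E e (J :: 'i option set) (V' :: 'i option \<Rightarrow> 'a set) E' e'.
    parts I V E \<Longrightarrow> \<forall>X\<in>U. e X \<subseteq> (\<Union>i\<in>I. V i) \<Longrightarrow>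
    parts J V' E' \<Longrightarrow> \<forall>X\<in>U. e' X \<subseteq> (\<Union>j\<in>J. V' j) \<Longrightarrow>
    agree t (\<lambda>i. tp k U (V i) (E i) (\<lambda>X. e X \<inter> V i)) I
      (\<lambda>j. tp k U (V' j) (E' j) (\<lambda>X. e' X \<inter> V' j)) J \<Longrightarrow>
    tp k U (\<Union>i\<in>I. V i) (\<Union>i\<in>I. E i) e = tp k U (\<Union>j\<in>J. V' j) (\<Union>j\<in>J. E' j) e'"
    using threshold[OF U, of k, where 'i = "'i option" and 'a = 'a] by blast
  \<comment> \<open>\<open>None\<close> indexes the root as a part with one vertex and no arcs,
    \<open>Some j\<close> the branch \<open>j\<close>.\<close>
  define V where "V r B i = (case i of None \<Rightarrow> {r} | Some j \<Rightarrow> pverts (B j))"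
    for r :: 'a and B :: "'i \<Rightarrow> 'a pair_pre_digraph" and i
  define E where "E B i = (case i of None \<Rightarrow> {} | Some j \<Rightarrow> parcs (B j))"
    for B :: "'i \<Rightarrow> 'a pair_pre_digraph" and i
  define e where "e r I x = (\<lambda>_. {})(root_var := {r}, attached_var := x ` I)"
    for r :: 'a and I :: "'i set" and x :: "'i \<Rightarrow> 'a"
  have *: "parts (insert None (Some ` I)) (V r B) (E B) \<and>
      (\<forall>X\<in>U. e r I x X \<subseteq> (\<Union>i\<in>insert None (Some ` I). V r B i)) \<and>
      (\<Union>i\<in>insert None (Some ` I). V r B i) = pverts G \<and>
      (\<forall>s S. env_rel \<phi> G (\<Union>i\<in>insert None (Some ` I). E B i) (e r I x) s S) \<and>
      (\<forall>i\<in>I. tp k U (V r B (Some i)) (E B (Some i)) (\<lambda>X. e r I x X \<inter> V r B (Some i)) = rooted_type k U (B i) (x i)) \<and>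
      (\<lambda>X. e r I x X \<inter> V r B None) = (\<lambda>_. {})(root_var := {r})"
    if star: "star G r I B x" for G r I B x
  proof (intro conjI allI ballI)
    have S: "finite I" "disjoint_family_on (\<lambda>i. pverts (B i)) I"
      "\<And>i. i \<in> I \<Longrightarrow> pair_graph (B i)" "\<And>i. i \<in> I \<Longrightarrow> x i \<in> pverts (B i)" "\<And>i. i \<in> I \<Longrightarrow> r \<notin> pverts (B i)"
      "pverts G = insert r (\<Union>i\<in>I. pverts (B i))"
      "parcs G = (\<Union>i\<in>I. parcs (B i)) \<union> {r} \<times> x ` I \<union> x ` I \<times> {r}"
      using star by (auto simp: star_def)
    show "parts (insert None (Some ` I)) (V r B) (E B)"
      unfolding parts_def disjoint_family_on_def
      using S(1,2,5) S(3)[THEN pair_graphD(1)] S(3)[THEN pair_graph_arcD(1)] S(3)[THEN pair_graph_arcD(2)]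
      by (auto simp: V_def E_def disjoint_family_on_def)
    show verts: "(\<Union>i\<in>insert None (Some ` I). V r B i) = pverts G"
      by (auto simp: V_def S(6))
    show "e r I x X \<subseteq> (\<Union>i\<in>insert None (Some ` I). V r B i)" for X
      unfolding verts S(6) using S(4) by (auto simp: e_def)
    show "env_rel \<phi> G (\<Union>i\<in>insert None (Some ` I). E B i) (e r I x) s S'" for s S'
    proof -
      have "finite (pverts G)"
        using S(1,3,6) pair_graphD(1) by auto
      then show ?thesis
        using sentence by (auto simp: env_rel_def mso_sentence_def e_def E_def S(7))
    qed
    show "(\<lambda>X. e r I x X \<inter> V r B None) = (\<lambda>_. {})(root_var := {r})"
      using S(4,5) by (auto simp: e_def V_def fun_eq_iff)
    fix i assume i: "i \<in> I"
    \<comment> \<open>Branches are disjoint, so of all attachment vertices only \<open>x i\<close>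
      lies in branch \<open>i\<close>.\<close>
    have "j = i" if "j \<in> I" "x j \<in> pverts (B i)" for j
      using S(2) S(4)[OF that(1)] that i unfolding disjoint_family_on_def by blast
    then have "x ` I \<inter> pverts (B i) = {x i}"
      using S(4) i by auto
    then have "(\<lambda>X. e r I x X \<inter> V r B (Some i)) = (\<lambda>_. {})(attached_var := {x i})"
      using S(5)[OF i] by (auto simp: e_def V_def fun_eq_iff)
    then show "tp k U (V r B (Some i)) (E B (Some i)) (\<lambda>X. e r I x X \<inter> V r B (Some i)) = rooted_type k U (B i) (x i)"
      by (simp add: rooted_type_def V_def E_def)
  qed
  have root: "tp k U {r} {} ((\<lambda>_. {})(root_var := {r})) = tp k U {r'} {} ((\<lambda>_. {})(root_var := {r'}))" for r r' :: 'a
  proof -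
    have "(\<lambda>Y. (\<lambda>_. r) ` ((\<lambda>_. {})(root_var := {r'})) Y) = (\<lambda>_. {})(root_var := {r})"
      by (auto simp: fun_eq_iff)
    then show ?thesis
      using tp_relabel[OF U, of "{r'}" "\<lambda>_. r" "{}" "(\<lambda>_. {})(root_var := {r'})" k] by auto
  qed
  have count: "card {i \<in> insert None (Some ` I). h i = \<tau>} = card {i \<in> I. h (Some i) = \<tau>} + (if h None = \<tau> then 1 else 0)"
    if "finite I" for I :: "'i set" and h :: "'i option \<Rightarrow> mso_var ty" and \<tau>
  proof -
    have "{i \<in> insert None (Some ` I). h i = \<tau>} = Some ` {i \<in> I. h (Some i) = \<tau>} \<union> (if h None = \<tau> then {None} else {})"
      by auto
    also have "card \<dots> = card (Some ` {i \<in> I. h (Some i) = \<tau>}) + card (if h None = \<tau> then {None} else ({} :: 'i option set))"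
      using that by (intro card_Un_disjoint) auto
    finally show ?thesis
      by (simp add: card_image)
  qed
  have main: "G \<Turnstile> \<phi> \<longleftrightarrow> G' \<Turnstile> \<phi>"
    if st: "star G r I B x" "star G' r' J B' x'"
      and agree: "agree t (\<lambda>i. rooted_type k U (B i) (x i)) I (\<lambda>j. rooted_type k U (B' j) (x' j)) J"
    for G G' :: "'a pair_pre_digraph" and r r' and I J :: "'i set" and B B' x x'
  proof -
    note 1 = *[OF st(1)] and 2 = *[OF st(2)]
    have fin: "finite I" "finite J"
      using st by (auto simp: star_def)
    let ?f = "\<lambda>i. tp k U (V r B i) (E B i) (\<lambda>X. e r I x X \<inter> V r B i)"
    let ?g = "\<lambda>j. tp k U (V r' B' j) (E B' j) (\<lambda>X. e r' J x' X \<inter> V r' B' j)"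
    have None: "?f None = ?g None"
      using 1 2 root[of r r'] by (simp add: V_def E_def)
    have "{i \<in> I. ?f (Some i) = \<tau>} = {i \<in> I. rooted_type k U (B i) (x i) = \<tau>}"
      "{j \<in> J. ?g (Some j) = \<tau>} = {j \<in> J. rooted_type k U (B' j) (x' j) = \<tau>}" for \<tau>
      using 1 2 by auto
    then have "min t (card {i \<in> I. ?f (Some i) = \<tau>} + c) = min t (card {j \<in> J. ?g (Some j) = \<tau>} + c)" for \<tau> c
      using agreeD[OF agree, of \<tau>] by (simp only:)
    then have "agree t ?f (insert None (Some ` I)) ?g (insert None (Some ` J))"
      unfolding agree_def count[OF fin(1)] count[OF fin(2)] None by blast
    from t[OF conjunct1[OF 1] conjunct1[OF conjunct2[OF 1]] conjunct1[OF 2] conjunct1[OF conjunct2[OF 2]] this]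
    have "tp k U (pverts G) (\<Union>i\<in>insert None (Some ` I). E B i) (e r I x) =
        tp k U (pverts G') (\<Union>j\<in>insert None (Some ` J). E B' j) (e r' J x')"
      unfolding conjunct1[OF conjunct2[OF conjunct2[OF 1]]] conjunct1[OF conjunct2[OF conjunct2[OF 2]]] .
    note tp_eq = this
    have env: "env_rel \<phi> G (\<Union>i\<in>insert None (Some ` I). E B i) (e r I x) s S"
      "env_rel \<phi> G' (\<Union>j\<in>insert None (Some ` J). E B' j) (e r' J x') s S" for s S
      using 1 2 by blast+
    \<comment> \<open>The assignments on the two sides are independent, which lets the universal
      quantifier in the definition of \<open>\<Turnstile>\<close> pass through.\<close>
    have "mso_sat G s S \<phi> \<longleftrightarrow> mso_sat G' s' S' \<phi>" for s S s' S'
      by (rule sat_tp[OF tp_eq _ U _ env]) (simp_all add: k_def U_def)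
    then show ?thesis
      unfolding mso_models_def by blast
  qed
  show ?thesis
    by (rule that[OF U]) (rule main)
qed

section \<open>Graphs with a pendant star\<close>

text \<open>Only the vertex set \<open>W\<close> is recorded: a copy may admit several embeddings
  \<open>f\<close>, and copies are later counted as sets.\<close>

definition pendant :: "'a pair_pre_digraph \<Rightarrow> 'a \<Rightarrow> 'a pair_pre_digraph \<Rightarrow> 'a set \<Rightarrow> bool" where
  "pendant M r G W \<longleftrightarrow> (\<exists>f y. inj_on f (pverts M) \<and> W = f ` pverts M \<and> W \<subseteq> pverts G \<and>
     induce W G = relabel f M \<and> y \<in> pverts G - W \<and> parcs G \<inter> W \<times> (- W) = {(f r, y)})"

text \<open>A cut of the rest extends to a cut of \<open>G\<close> by putting \<open>W\<close> on
  the side of \<open>y\<close>; the arc crossing it then avoids \<open>W\<close>.\<close>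

lemma cut_connected_remove_pendant:
  assumes G: "pair_graph G" "cut_connected G" and W: "W \<subseteq> pverts G" "y \<in> pverts G - W"
    and arcs: "parcs G \<inter> W \<times> (- W) = {(w, y)}"
  shows "cut_connected (induce (- W) G)"
  unfolding cut_connected_def
proof (intro conjI allI impI)
  show "pverts (induce (- W) G) \<noteq> {}"
    using W by auto
  fix S assume S: "S \<noteq> {}" "S \<subset> pverts (induce (- W) G)"
  have arcsD: "a = w \<and> b = y" if "(a, b) \<in> parcs G" "a \<in> W" "b \<notin> W" for a b
    using arcs that by blast
  show "\<exists>u\<in>S. \<exists>v\<in>pverts (induce (- W) G) - S. (u, v) \<in> parcs (induce (- W) G)"
  proof (cases "y \<in> S")
    case True
    have ne: "S \<union> W \<noteq> {}" "S \<union> W \<subset> pverts G"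
      using S W by auto
    obtain u v where uv: "u \<in> S \<union> W" "v \<in> pverts G" "v \<notin> S \<union> W" "(u, v) \<in> parcs G"
      by (rule cut_connectedD[OF G(2) ne])
    have "u \<notin> W"
      using arcsD[of u v] uv True by auto
    then show ?thesis
      using uv S by (intro bexI[of _ u] bexI[of _ v]) auto
  next
    case False
    have ne: "S \<noteq> {}" "S \<subset> pverts G"
      using S by auto
    obtain u v where uv: "u \<in> S" "v \<in> pverts G" "v \<notin> S" "(u, v) \<in> parcs G"
      by (rule cut_connectedD[OF G(2) ne])
    have "v \<notin> W"
      using arcsD[of v u] pair_graph_arcD(3)[OF G(1) uv(4)] uv S False by auto
    then show ?thesis
      using uv S by (intro bexI[of _ u] bexI[of _ v]) auto
  qed
qed

lemma relabel_subgraph_parcs: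
  "parcs (relabel f H) \<subseteq> f ` pverts H \<times> f ` pverts H" if "pair_graph H"
  by (auto dest: pair_graph_arcD[OF that])

text \<open>The rest of the graph becomes branch number \<open>n\<close>, attached at
  \<open>y\<close>; the root of the copy serves as root of the whole graph.\<close>

lemma pendant_star:
  assumes M: "star M r {..<n} B x" and G: "pair_graph G" and f: "inj_on f (pverts M)"
    and W: "W = f ` pverts M" "W \<subseteq> pverts G" "induce W G = relabel f M" "y \<in> pverts G - W"
    and arcs: "parcs G \<inter> W \<times> (- W) = {(f r, y)}"
  shows "star G (f r) {..<Suc n} (\<lambda>i. if i < n then relabel f (B i) else induce (- W) G)
    (\<lambda>i. if i < n then f (x i) else y)"
proof -
  let ?B = "\<lambda>i. if i < n then relabel f (B i) else induce (- W) G"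
  let ?x = "\<lambda>i. if i < n then f (x i) else y"
  have S: "disjoint_family_on (\<lambda>i. pverts (B i)) {..<n}"
    "\<And>i. i < n \<Longrightarrow> pair_graph (B i)" "\<And>i. i < n \<Longrightarrow> x i \<in> pverts (B i)" "\<And>i. i < n \<Longrightarrow> r \<notin> pverts (B i)"
    "pverts M = insert r (\<Union>i<n. pverts (B i))"
    "parcs M = (\<Union>i<n. parcs (B i)) \<union> {r} \<times> x ` {..<n} \<union> x ` {..<n} \<times> {r}"
    using M by (auto simp: star_def)
  have sub: "pverts (B i) \<subseteq> pverts M" if "i < n" for i
    using S(5) that by auto
  have inj: "inj_on f (pverts (B i))" if "i < n" for i
    using f sub[OF that] by (rule inj_on_subset)
  have subW: "f ` pverts (B i) \<subseteq> W" if "i < n" for i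
    using sub[OF that] W(1) by auto
  have frW: "f r \<in> W"
    using W(1) S(5) by auto
  have "disjoint_family_on (\<lambda>i. pverts (?B i)) {..<Suc n}"
    unfolding disjoint_family_on_def
  proof (intro ballI impI)
    fix i j assume ij: "i \<in> {..<Suc n}" "j \<in> {..<Suc n}" "i \<noteq> j"
    consider "i < n" "j < n" | "i < n" "j = n" | "i = n" "j < n"
      using ij by fastforce
    then show "pverts (?B i) \<inter> pverts (?B j) = {}"
    proof cases
      case 1
      then have "pverts (B i) \<inter> pverts (B j) = {}"
        using S(1) ij by (auto simp: disjoint_family_on_def)
      then have "f ` pverts (B i) \<inter> f ` pverts (B j) = {}"
        using inj_on_image_Int[OF f sub[OF 1(1)] sub[OF 1(2)]] by simp
      then show ?thesis
        using 1 by simp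
    qed (use subW in auto)
  qed
  moreover have "pair_graph (?B i) \<and> ?x i \<in> pverts (?B i) \<and> f r \<notin> pverts (?B i)" if "i \<in> {..<Suc n}" for i
  proof (cases "i < n")
    case True
    have "f r \<notin> f ` pverts (B i)"
      using inj_on_image_mem_iff[OF f _ sub[OF True], of r] S(4,5) True by auto
    then show ?thesis
      using True S(2,3) pair_graph_relabel[OF S(2)[OF True] inj[OF True]] by simp
  next
    case False
    then show ?thesis
      using W(4) frW pair_graph_induce[OF G] by simp
  qed
  moreover have "pverts G = insert (f r) (\<Union>i<Suc n. pverts (?B i))"
  proof -
    have "(\<Union>i<Suc n. pverts (?B i)) = (\<Union>i<n. f ` pverts (B i)) \<union> (pverts G - W)"
      by (auto simp: lessThan_Suc)
    moreover have "W = insert (f r) (\<Union>i<n. f ` pverts (B i))"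
      using W(1) S(5) by auto
    ultimately show ?thesis
      using W(2) by auto
  qed
  moreover have "parcs G = (\<Union>i<Suc n. parcs (?B i)) \<union> {f r} \<times> ?x ` {..<Suc n} \<union> ?x ` {..<Suc n} \<times> {f r}"
  proof -
    have split: "parcs G = parcs (induce W G) \<union> parcs (induce (- W) G) \<union> {(f r, y), (y, f r)}"
    proof (intro equalityI subrelI)
      fix a b assume ab: "(a, b) \<in> parcs G"
      have "(b, a) \<in> parcs G"
        using pair_graph_arcD(3)[OF G ab] .
      then have "(a, b) = (f r, y)" if "a \<in> W" "b \<notin> W"
        using arcs ab that by blast
      moreover have "(b, a) = (f r, y)" if "a \<notin> W" "b \<in> W"
        using arcs \<open>(b, a) \<in> parcs G\<close> that by blast
      ultimately show "(a, b) \<in> parcs (induce W G) \<union> parcs (induce (- W) G) \<union> {(f r, y), (y, f r)}"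
        using ab by (cases "a \<in> W"; cases "b \<in> W") auto
    next
      fix a b assume ab: "(a, b) \<in> parcs (induce W G) \<union> parcs (induce (- W) G) \<union> {(f r, y), (y, f r)}"
      have "(f r, y) \<in> parcs G"
        using arcs by blast
      moreover from this have "(y, f r) \<in> parcs G"
        by (rule pair_graph_arcD(3)[OF G])
      ultimately show "(a, b) \<in> parcs G"
        using ab by auto
    qed
    have "parcs (induce W G) = (\<Union>i<n. parcs (relabel f (B i))) \<union> {f r} \<times> (\<lambda>i. f (x i)) ` {..<n} \<union> (\<lambda>i. f (x i)) ` {..<n} \<times> {f r}"
      unfolding W(3) relabel_simps S(6) image_Un image_UN image_map_prod_times by (simp add: image_image)
    moreover have "(\<Union>i<Suc n. parcs (?B i)) = (\<Union>i<n. parcs (relabel f (B i))) \<union> parcs (induce (- W) G)"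
      by (auto simp: lessThan_Suc simp del: relabel_simps induce_simps)
    moreover have "?x ` {..<Suc n} = insert y ((\<lambda>i. f (x i)) ` {..<n})"
      by (auto simp: lessThan_Suc)
    ultimately show ?thesis
      unfolding split by (simp only:) blast
  qed
  ultimately show ?thesis
    unfolding star_def by blast
qed

section \<open>The universal star\<close>

text \<open>The hypotheses in the form used below: \<open>join_mem\<close> combines decomposability
  with addability, and \<open>proper\<close> is the source of sparsity.\<close>

locale addable_class = minor_closed_set \<G> + relabel_closed_set \<G>
  for \<G> :: "nat pair_pre_digraph set" +
  assumes join_mem: "\<And>G H u v. G \<in> \<G> \<Longrightarrow> H \<in> \<G> \<Longrightarrow> cut_connected G \<Longrightarrow> cut_connected H \<Longrightarrow>
      pverts G \<inter> pverts H = {} \<Longrightarrow> u \<in> pverts G \<Longrightarrow> v \<in> pverts H \<Longrightarrow> join u v G H \<in> \<G>"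
    and nonempty: "\<exists>G\<in>\<G>. pverts G \<noteq> {}"
    and proper: "\<exists>G. pair_graph G \<and> G \<notin> \<G>"
begin

lemma singleton_mem: "\<lparr>pverts = {v}, parcs = {}\<rparr> \<in> \<G>"
proof -
  obtain G w where G: "G \<in> \<G>" "w \<in> pverts G"
    using nonempty by blast
  have "induce {w} G = \<lparr>pverts = {w}, parcs = {}\<rparr>"
    using G by (intro graph_eqI) (auto dest: pair_graph_arcD[OF graph[OF G(1)]])
  then have "\<lparr>pverts = {w}, parcs = {}\<rparr> \<in> \<G>"
    using induce_mem[OF G(1), of "{w}"] by (simp del: induce_simps)
  from relabel_mem[OF this, of "\<lambda>_. v"] show ?thesis
    by (simp add: relabel_def)
qed

lemma star_mem:
  fixes n :: nat
  assumes B: "\<And>i. i < n \<Longrightarrow> B i \<in> \<G>" "\<And>i. i < n \<Longrightarrow> cut_connected (B i)" "\<And>i. i < n \<Longrightarrow> x i \<in> pverts (B i)"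
    and r: "\<And>i. i < n \<Longrightarrow> r \<notin> pverts (B i)"
    and disj: "disjoint_family_on (\<lambda>i. pverts (B i)) {..<n}"
  shows "\<exists>M\<in>\<G>. cut_connected M \<and> star M r {..<n} B x"
  using assms
proof (induction n)
  case 0
  have "cut_connected \<lparr>pverts = {r}, parcs = {}\<rparr>"
    by (auto simp: cut_connected_def)
  then show ?case
    using singleton_mem[of r] by (intro bexI[of _ "\<lparr>pverts = {r}, parcs = {}\<rparr>"]) (auto simp: star_def disjoint_family_on_def)
next
  case (Suc n)
  have "disjoint_family_on (\<lambda>i. pverts (B i)) {..<n}"
    using Suc.prems(5) by (rule disjoint_family_on_mono[rotated]) auto
  then obtain M where M: "M \<in> \<G>" "cut_connected M" "star M r {..<n} B x"
    using Suc by fastforce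
  have S: "pverts M = insert r (\<Union>i<n. pverts (B i))"
    "parcs M = (\<Union>i<n. parcs (B i)) \<union> {r} \<times> x ` {..<n} \<union> x ` {..<n} \<times> {r}"
    using M(3) by (auto simp: star_def)
  have "pverts (B i) \<inter> pverts (B n) = {}" if "i < n" for i
    using Suc.prems(5) that by (auto simp: disjoint_family_on_def)
  then have disj: "pverts M \<inter> pverts (B n) = {}"
    using S(1) Suc.prems(4)[of n] by auto
  have Bn: "B n \<in> \<G>" "cut_connected (B n)" "x n \<in> pverts (B n)"
    using Suc.prems by auto
  have rM: "r \<in> pverts M"
    using S by simp
  let ?M = "join r (x n) M (B n)"
  have "?M \<in> \<G>"
    by (rule join_mem[OF M(1) Bn(1) M(2) Bn(2) disj rM Bn(3)])
  moreover have "cut_connected ?M"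
    by (rule cut_connected_join[OF M(2) Bn(2) rM Bn(3)])
  moreover have "star ?M r {..<Suc n} B x"
    unfolding star_def
  proof (intro conjI ballI)
    fix i assume "i \<in> {..<Suc n}"
    then show "pair_graph (B i)" "x i \<in> pverts (B i)" "r \<notin> pverts (B i)"
      using Suc.prems(1,3,4) graph by auto
  next
    show "pverts ?M = insert r (\<Union>i<Suc n. pverts (B i))"
      using S by (auto simp: lessThan_Suc)
    show "parcs ?M = (\<Union>i<Suc n. parcs (B i)) \<union> {r} \<times> x ` {..<Suc n} \<union> x ` {..<Suc n} \<times> {r}"
      unfolding join_simps S(2) lessThan_Suc by auto
  qed (use Suc.prems(5) in auto)
  ultimately show ?case by blast
qed

text \<open>The core of the zero-one law: the star \<open>M\<close> carries so many branches of every type that one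
  further branch, the rest of a graph with a pendant copy of \<open>M\<close>, goes unnoticed by \<open>\<phi>\<close>.\<close>

lemma universal_star:
  assumes "mso_sentence \<phi>"
  obtains M r where "M \<in> \<G>" "cut_connected M" "r \<in> pverts M"
    "\<And>G W. G \<in> \<G> \<Longrightarrow> cut_connected G \<Longrightarrow> pendant M r G W \<Longrightarrow> G \<Turnstile> \<phi> \<longleftrightarrow> M \<Turnstile> \<phi>"
proof (rule star_sat[OF assms, where 'a = nat and 'i = nat])
  fix k U t
  assume U: "finite U" and st: "\<And>(G :: nat pair_pre_digraph) (G' :: nat pair_pre_digraph) r r' I J B B' x x'.
    star G r (I :: nat set) B x \<Longrightarrow> star G' r' (J :: nat set) B' x' \<Longrightarrow>
    agree t (\<lambda>i. rooted_type k U (B i) (x i)) I (\<lambda>j. rooted_type k U (B' j) (x' j)) J \<Longrightarrow>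
    G \<Turnstile> \<phi> \<longleftrightarrow> G' \<Turnstile> \<phi>"
  define T where "T = {rooted_type k U H x | H x. H \<in> \<G> \<and> cut_connected H \<and> x \<in> pverts H}"
  have "T \<subseteq> {tp k U V E e | (V :: nat set) E e. finite V}"
    unfolding T_def rooted_type_def using pair_graphD(1)[OF graph] by blast
  then have finT: "finite T"
    using finite_types[OF U] finite_subset by blast
  then obtain h where h: "bij_betw h {0..<card T} T"
    using ex_bij_betw_nat_finite by blast
  have "\<exists>H x. H \<in> \<G> \<and> cut_connected H \<and> x \<in> pverts H \<and> rooted_type k U H x = \<tau>" if "\<tau> \<in> T" for \<tau>
    using that by (auto simp: T_def)
  then obtain H z where H: "\<And>\<tau>. \<tau> \<in> T \<Longrightarrow> H \<tau> \<in> \<G> \<and> cut_connected (H \<tau>) \<and> z \<tau> \<in> pverts (H \<tau>) \<and> rooted_type k U (H \<tau>) (z \<tau>) = \<tau>"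
    by metis
  define N where "N = card T"
  define n where "n = N * t"
  \<comment> \<open>Running cyclically through the \<open>N\<close> types over \<open>N * t\<close>
    indices gives each type \<open>t\<close> branches.\<close>
  define c where "c i = h (i mod N)" for i
  have cT: "c i \<in> T" if "i < n" for i
  proof -
    have "i mod N < N"
      using that by (intro mod_less_divisor) (auto simp: n_def intro: gr0I)
    then show ?thesis
      using h by (auto simp: c_def N_def bij_betw_def)
  qed
  \<comment> \<open>Pairing with the index makes the branches disjoint, and the successor keeps 0
    free for the root.\<close>
  define e where "e i v = Suc (prod_encode (i, v))" for i v
  have inj: "inj_on (e i) A" for i A
    by (auto simp: e_def inj_on_def)
  define B where "B i = relabel (e i) (H (c i))" for i
  define x where "x i = e i (z (c i))" for i
  have type: "rooted_type k U (B i) (x i) = c i" if "i < n" for i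
    using rooted_type_relabel[OF U graph _ inj] H[OF cT[OF that]] by (simp add: B_def x_def)
  have "\<exists>M\<in>\<G>. cut_connected M \<and> star M 0 {..<n} B x"
  proof (rule star_mem)
    fix i assume i: "i < n"
    show "B i \<in> \<G>" "cut_connected (B i)" "x i \<in> pverts (B i)"
      using H[OF cT[OF i]] relabel_mem[OF _ inj] cut_connected_relabel[OF graph _ inj]
      by (auto simp: B_def x_def)
    show "0 \<notin> pverts (B i)"
      by (auto simp: B_def e_def)
  next
    show "disjoint_family_on (\<lambda>i. pverts (B i)) {..<n}"
      by (auto simp: disjoint_family_on_def B_def e_def)
  qed
  then obtain M where M: "M \<in> \<G>" "cut_connected M" "star M 0 {..<n} B x"
    by blast
  have many: "t \<le> card {i \<in> {..<n}. rooted_type k U (B i) (x i) = \<tau>}" if "\<tau> \<in> T" for \<tau>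
  proof -
    have "\<tau> \<in> h ` {0..<N}"
      using h \<open>\<tau> \<in> T\<close> by (simp add: bij_betw_def N_def)
    then obtain j where j: "j < N" "h j = \<tau>"
      by auto
    have "j + N * a < n" if "a < t" for a
    proof -
      have "j + N * a < N * (a + 1)"
        using j by simp
      also have "\<dots> \<le> N * t"
        using that by (intro mult_le_mono2) simp
      finally show ?thesis
        by (simp add: n_def)
    qed
    then have "(\<lambda>a. j + N * a) ` {..<t} \<subseteq> {i \<in> {..<n}. rooted_type k U (B i) (x i) = \<tau>}"
      using type j by (auto simp: c_def)
    moreover have "inj_on (\<lambda>a. j + N * a) {..<t}"
      using j by (auto simp: inj_on_def)
    ultimately have "card {..<t} \<le> card {i \<in> {..<n}. rooted_type k U (B i) (x i) = \<tau>}"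
      by (intro card_inj_on_le) auto
    then show ?thesis by simp
  qed
  have "G \<Turnstile> \<phi> \<longleftrightarrow> M \<Turnstile> \<phi>" if G: "G \<in> \<G>" "cut_connected G" and pend: "pendant M 0 G W" for G W
  proof -
    obtain f y where f: "inj_on f (pverts M)" and W: "W = f ` pverts M" "W \<subseteq> pverts G" "induce W G = relabel f M" "y \<in> pverts G - W"
      and arcs: "parcs G \<inter> W \<times> (- W) = {(f 0, y)}"
      using pend unfolding pendant_def by blast
    let ?R = "induce (- W) G"
    let ?B = "\<lambda>i. if i < n then relabel f (B i) else ?R"
    let ?x = "\<lambda>i. if i < n then f (x i) else y"
    have star: "star G (f 0) {..<Suc n} ?B ?x"
      by (rule pendant_star[OF M(3) graph[OF G(1)] f W arcs])
    \<comment> \<open>The rest is itself a connected member of the class, so its type already occurs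
      at least \<open>t\<close> times among the branches of \<open>M\<close>; one more occurrence is
      invisible to \<open>agree t\<close>.\<close>
    have R: "rooted_type k U ?R y \<in> T"
      using induce_mem[OF G(1), of "- W"] cut_connected_remove_pendant[OF graph[OF G(1)] G(2) W(2,4) arcs] W(4)
      unfolding T_def mem_Collect_eq by (intro exI[of _ ?R] exI[of _ y]) auto
    have same: "rooted_type k U (?B i) (?x i) = rooted_type k U (B i) (x i)" if i: "i < n" for i
    proof -
      have Bi: "pair_graph (B i)" "x i \<in> pverts (B i)" "pverts (B i) \<subseteq> pverts M"
        using M(3) i by (auto simp: star_def)
      show ?thesis
        using rooted_type_relabel[OF U Bi(1,2) inj_on_subset[OF f Bi(3)]] i by simp
    qed
    have "agree t (\<lambda>i. rooted_type k U (?B i) (?x i)) {..<Suc n} (\<lambda>i. rooted_type k U (B i) (x i)) {..<n}"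
      unfolding agree_def
    proof
      fix \<tau>
      let ?C = "{i \<in> {..<n}. rooted_type k U (B i) (x i) = \<tau>}"
      have "{i \<in> {..<Suc n}. rooted_type k U (?B i) (?x i) = \<tau>} =
          {i \<in> {..<n}. rooted_type k U (?B i) (?x i) = \<tau>} \<union> (if rooted_type k U ?R y = \<tau> then {n} else {})"
        by (auto simp: lessThan_Suc)
      also have "{i \<in> {..<n}. rooted_type k U (?B i) (?x i) = \<tau>} = ?C"
        using same by (intro Collect_cong) auto
      finally have eq: "{i \<in> {..<Suc n}. rooted_type k U (?B i) (?x i) = \<tau>} =
          ?C \<union> (if rooted_type k U ?R y = \<tau> then {n} else {})" .
      show "min t (card {i \<in> {..<Suc n}. rooted_type k U (?B i) (?x i) = \<tau>}) = min t (card ?C)"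
      proof (cases "rooted_type k U ?R y = \<tau>")
        case True
        have "card ?C \<le> card {i \<in> {..<Suc n}. rooted_type k U (?B i) (?x i) = \<tau>}"
          unfolding eq by (intro card_mono) auto
        then show ?thesis
          using many[OF R[unfolded True]] by linarith
      next
        case False
        then show ?thesis
          unfolding eq by simp
      qed
    qed
    then show ?thesis
      by (rule st[OF star M(3)])
  qed
  moreover have "0 \<in> pverts M"
    using M(3) by (simp add: star_def)
  ultimately show thesis
    by (intro that[OF M(1,2)]) simp_all
qed

end

section \<open>Growth of addable classes\<close>

text \<open>\<open>L\<close> is the supremum of \<open>f n / n\<close>. For the lower bound, an
  \<open>m\<close> nearly attaining it is repeated \<open>q\<close> times, and the remainder costs
  only a constant.\<close>

lemma fekete:
  fixes f :: "nat \<Rightarrow> real"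
  assumes super: "\<And>m n. 1 \<le> m \<Longrightarrow> 1 \<le> n \<Longrightarrow> f m + f n \<le> f (m + n)"
    and bound: "\<And>n. 1 \<le> n \<Longrightarrow> f n \<le> K * real n"
  obtains L where "\<And>n. 1 \<le> n \<Longrightarrow> f n \<le> L * real n"
    "\<And>\<delta>. 0 < \<delta> \<Longrightarrow> \<forall>\<^sub>F n in sequentially. (L - \<delta>) * real n \<le> f n"
proof -
  let ?S = "(\<lambda>n. f n / real n) ` {1..}"
  define L where "L = Sup ?S"
  have bdd: "bdd_above ?S"
    using bound by (intro bdd_aboveI2[of _ _ K]) (auto simp: divide_le_eq)
  have upper: "f n \<le> L * real n" if "1 \<le> n" for n
  proof -
    have "f n / real n \<le> L"
      unfolding L_def using that bdd by (intro cSup_upper) auto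
    then show ?thesis
      using that by (simp add: divide_le_eq)
  qed
  have mult: "real q * f m + f r \<le> f (q * m + r)" if "1 \<le> m" "1 \<le> r" for q m r
  proof (induction q)
    case (Suc q)
    have "f m + f (q * m + r) \<le> f (m + (q * m + r))"
      using that by (intro super) auto
    then show ?case
      using Suc by (simp add: algebra_simps)
  qed simp
  have lower: "\<forall>\<^sub>F n in sequentially. (L - \<delta>) * real n \<le> f n" if \<delta>: "0 < \<delta>" for \<delta>
  proof -
    have "L - \<delta> / 2 < Sup ?S"
      using \<delta> by (simp add: L_def)
    then obtain m where m: "1 \<le> m" "L - \<delta> / 2 < f m / real m"
      using less_cSup_iff[OF _ bdd, of "L - \<delta> / 2"] by auto
    define c where "c = L - \<delta> / 2"
    define \<beta> where "\<beta> = Min (f ` {1..m})"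
    have fm: "c * real m \<le> f m"
      using m by (simp add: c_def field_simps)
    \<comment> \<open>From here on the second half of \<open>\<delta>\<close> outweighs the constant
      error caused by the remainder.\<close>
    define N where "N = nat \<lceil>(\<bar>c\<bar> * real m - \<beta>) / (\<delta> / 2)\<rceil> + 1"
    show ?thesis
      unfolding eventually_sequentially
    proof (intro exI[of _ N] allI impI)
      fix n assume n: "N \<le> n"
      then have n1: "1 \<le> n"
        by (simp add: N_def)
      \<comment> \<open>The shift by 1 makes the remainder \<open>r\<close> range over
        \<open>{1..m}\<close>, as superadditivity is assumed for positive arguments only.\<close>
      define q where "q = (n - 1) div m"
      define r where "r = (n - 1) mod m + 1"
      have n_eq: "n = q * m + r"
        using n1 by (simp add: q_def r_def)
      have r: "1 \<le> r" "r \<le> m"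
        using m(1) by (auto simp: r_def Suc_leI)
      have "\<beta> \<le> f r"
        unfolding \<beta>_def using r by (intro Min_le) auto
      then have "real q * f m + \<beta> \<le> f n"
        using mult[OF m(1) r(1), of q] n_eq by simp
      moreover have "real q * (c * real m) \<le> real q * f m"
        using fm by (intro mult_left_mono) auto
      moreover have "real q * (c * real m) = c * real n - c * real r"
        using n_eq by (simp add: algebra_simps)
      moreover have "c * real r \<le> \<bar>c\<bar> * real m"
        using r by (intro mult_mono) auto
      ultimately have 1: "c * real n - \<bar>c\<bar> * real m + \<beta> \<le> f n"
        by linarith
      have "(\<bar>c\<bar> * real m - \<beta>) / (\<delta> / 2) \<le> real n"
        using n unfolding N_def by linarith
      then have "\<bar>c\<bar> * real m - \<beta> \<le> (\<delta> / 2) * real n"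
        using \<delta> by (simp add: divide_le_eq mult.commute)
      moreover have "c * real n - (\<delta> / 2) * real n = (L - \<delta>) * real n"
        by (simp add: c_def field_simps)
      ultimately show "(L - \<delta>) * real n \<le> f n"
        using 1 by linarith
    qed
  qed
  show ?thesis
    by (rule that[OF upper lower])
qed

section \<open>The growth constant\<close>

text \<open>Otherwise an arc of the connected \<open>G\<close> leaves \<open>pverts G'\<close>. In
  the second decomposition the only such arc goes from \<open>u\<close> to \<open>v\<close>, but
  \<open>v\<close> lies in \<open>H\<close> and not in \<open>G\<close>.\<close>

lemma join_determines_part:
  assumes G: "pair_graph G" "cut_connected G" and G': "pair_graph G'" and H': "pair_graph H'"
    and disj: "pverts G \<inter> pverts H = {}" "pverts G' \<inter> pverts H' = {}"
    and u: "u \<in> pverts G" "u \<in> pverts G'" and v: "v \<in> pverts H" "v \<in> pverts H'"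
    and eq: "join u v G H = join u v G' H'"
  shows "pverts G \<subseteq> pverts G'"
proof (rule ccontr)
  assume "\<not> ?thesis"
  then have S: "pverts G \<inter> pverts G' \<noteq> {}" "pverts G \<inter> pverts G' \<subset> pverts G"
    using u by auto
  obtain p q where pq: "p \<in> pverts G \<inter> pverts G'" "q \<in> pverts G" "q \<notin> pverts G \<inter> pverts G'" "(p, q) \<in> parcs G"
    by (rule cut_connectedD[OF G(2) S])
  have "(p, q) \<in> parcs (join u v G' H')"
    using pq(4) unfolding eq[symmetric] by simp
  then show False
    using pq disj v u by (auto dest: pair_graph_arcD[OF G'] pair_graph_arcD[OF H'])
qed

lemma join_inj:
  assumes "pair_graph G" "cut_connected G" "pair_graph H" "cut_connected H"
    and "pair_graph G'" "cut_connected G'" "pair_graph H'" "cut_connected H'"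
    and "pverts G \<inter> pverts H = {}" "pverts G' \<inter> pverts H' = {}"
    and "u \<in> pverts G" "u \<in> pverts G'" "v \<in> pverts H" "v \<in> pverts H'"
    and eq: "join u v G H = join u v G' H'"
  shows "G = G' \<and> H = H'"
proof -
  have V: "pverts G = pverts G'"
    using join_determines_part[OF assms(1,2,5,7,9,10,11,12,13,14,15)]
      join_determines_part[OF assms(5,6,1,3,10,9,12,11,14,13) eq[symmetric]] by blast
  have "pverts G \<union> pverts H = pverts G' \<union> pverts H'"
    using arg_cong[OF eq, of pverts] by simp
  then have V': "pverts H = pverts H'"
    using V assms(9,10) by blast
  have parts: "parcs A = parcs (join u v A B) \<inter> pverts A \<times> pverts A" "parcs B = parcs (join u v A B) \<inter> pverts B \<times> pverts B"
    if "pair_graph A" "pair_graph B" "pverts A \<inter> pverts B = {}" "u \<in> pverts A" "v \<in> pverts B" for A B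
    using that(3-5) by (auto dest: pair_graph_arcD[OF that(1)] pair_graph_arcD[OF that(2)])
  show ?thesis
    using parts[OF assms(1,3,9,11,13)] parts[OF assms(5,7,10,12,14)] V V' eq
    by (intro conjI graph_eqI) (simp_all only:)
qed

context addable_class
begin

definition connected_on :: "nat set \<Rightarrow> nat pair_pre_digraph set" where
  "connected_on V = graphs_on V {G \<in> \<G>. cut_connected G}"

lemma connected_on_iff: "G \<in> connected_on V \<longleftrightarrow> G \<in> \<G> \<and> cut_connected G \<and> pverts G = V"
  by (auto simp: connected_on_def graphs_on_def)

sublocale conn: relabel_closed_set "{G \<in> \<G>. cut_connected G}"
  by (rule relabel_closed_set.intro) (auto intro: graph relabel_mem cut_connected_relabel)

definition count :: "nat \<Rightarrow> nat" where
  "count n = card (connected_on {1..n})"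

lemma card_connected_on: "finite V \<Longrightarrow> card (connected_on V) = count (card V)"
  unfolding count_def connected_on_def by (intro conn.card_graphs_on_cong) auto

lemma finite_connected_on: "finite V \<Longrightarrow> finite (connected_on V)"
  unfolding connected_on_def by (rule conn.finite_graphs_on)

text \<open>A complete graph with as many vertices as some nonmember \<open>G0\<close> cannot be in
  the class, since \<open>G0\<close> is a spanning subgraph of a relabelled copy; and an excluded
  complete graph forces sparsity.\<close>

lemma sparse_ex: obtains d :: nat where "d \<ge> 1" "\<And>G. G \<in> \<G> \<Longrightarrow> card (parcs G) \<le> d * card (pverts G)"
proof -
  obtain G0 where G0: "pair_graph G0" "G0 \<notin> \<G>"
    using proper by blast
  have no: "complete S \<notin> \<G>" if S: "finite S" "card S = card (pverts G0)" for S
  proof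
    assume mem: "complete S \<in> \<G>"
    obtain f where f: "bij_betw f S (pverts G0)"
      using S pair_graphD(1)[OF G0(1)] finite_same_card_bij by blast
    then have inj: "inj_on f S" and img: "f ` S = pverts G0"
      by (auto simp: bij_betw_def)
    have "relabel f (complete S) \<in> \<G>"
      using relabel_mem[OF mem] inj by simp
    moreover have "parcs G0 \<subseteq> parcs (relabel f (complete S))"
    proof (rule subrelI)
      fix x y assume xy: "(x, y) \<in> parcs G0"
      then have "x \<in> f ` S" "y \<in> f ` S" "x \<noteq> y"
        using img pair_graph_arcD[OF G0(1)] by auto
      then obtain a b where "a \<in> S" "b \<in> S" "x = f a" "y = f b" "a \<noteq> b"
        by auto
      then show "(x, y) \<in> parcs (relabel f (complete S))"
        by (auto intro!: map_prod_imageI)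
    qed
    ultimately show False
      using spanning_subgraph_mem[OF _ G0(1)] G0(2) img by (metis complete_simps(1) relabel_simps(1))
  qed
  show ?thesis
    by (rule that[of "2 ^ card (pverts G0)"]) (use few_arcs[OF no] in auto)
qed

lemma count_bound: obtains K :: nat where "K \<ge> 1" "\<And>n. count n \<le> fact n * K ^ (n + 1)"
proof -
  obtain d where d: "\<And>G. G \<in> \<G> \<Longrightarrow> card (parcs G) \<le> d * card (pverts G)"
    using sparse_ex by metis
  interpret small_class \<G> d
    by unfold_locales (rule d)
  show ?thesis
  proof (rule small)
    fix C :: nat
    assume C: "C \<ge> 1" "\<And>V :: nat set. finite V \<Longrightarrow> card (graphs_on V \<G>) \<le> fact (card V) * C ^ (card V + 1)"
    have "count n \<le> fact n * C ^ (n + 1)" for n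
    proof -
      have "count n \<le> card (graphs_on {1..n} \<G>)"
        unfolding count_def connected_on_def
        by (intro card_mono finite_graphs_on) (auto simp: graphs_on_def)
      also have "\<dots> \<le> fact n * C ^ (n + 1)"
        using C(2)[of "{1..n}"] by simp
      finally show ?thesis .
    qed
    then show thesis
      using that C(1) by blast
  qed
qed

text \<open>An \<open>m\<close>-subset \<open>A\<close>, connected graphs on \<open>A\<close> and on
  its complement, and end vertices \<open>u\<close>, \<open>v\<close> give a connected graph with a
  marked arc, from which \<open>join_inj\<close> recovers all choices. Sparsity bounds the number of
  arcs that can be marked.\<close>

lemma count_superadditive:
  assumes d: "\<And>G. G \<in> \<G> \<Longrightarrow> card (parcs G) \<le> d * card (pverts G)"
  shows "((m + n) choose m) * (m * n * count m * count n) \<le> d * (m + n) * count (m + n)"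
proof -
  define V where "V = {1..m + n}"
  have V: "finite V" "card V = m + n"
    by (auto simp: V_def)
  define F where "F A = connected_on A \<times> connected_on (V - A) \<times> A \<times> (V - A)" for A
  define \<A> where "\<A> = {A. A \<subseteq> V \<and> card A = m}"
  have fin\<A>: "finite \<A>"
    using V by (auto simp: \<A>_def)
  have A: "finite A" "A \<subseteq> V" "card A = m" "card (V - A) = n" if "A \<in> \<A>" for A
    using that V finite_subset[of A V] by (auto simp: \<A>_def card_Diff_subset)
  have finF: "finite (F A)" and cardF: "card (F A) = m * n * count m * count n" if "A \<in> \<A>" for A
    using A[OF that] V(1) by (auto simp: F_def finite_connected_on card_connected_on card_cartesian_product)
  let ?\<psi> = "\<lambda>(A :: nat set, G, H, u, v). (join u v G H, (u, v))"
  have "inj_on ?\<psi> (Sigma \<A> F)"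
  proof (rule inj_onI)
    fix p p' assume p: "p \<in> Sigma \<A> F" "p' \<in> Sigma \<A> F" "?\<psi> p = ?\<psi> p'"
    obtain A G H u v where p1: "p = (A, G, H, u, v)"
      by (rule prod_cases5)
    obtain A' G' H' u' v' where p2: "p' = (A', G', H', u', v')"
      by (rule prod_cases5)
    have 1: "(G, H, u, v) \<in> F A" and 2: "(G', H', u', v') \<in> F A'"
      and eq: "join u v G H = join u' v' G' H'" "u = u'" "v = v'"
      using p unfolding p1 p2 by auto
    have "G = G' \<and> H = H'"
      by (rule join_inj[of G H G' H' u v]) (use 1 2 eq in \<open>auto simp: F_def connected_on_iff graph\<close>)
    then show "p = p'"
      using 1 2 eq unfolding p1 p2 by (auto simp: F_def connected_on_iff)
  qed
  moreover have "?\<psi> ` Sigma \<A> F \<subseteq> Sigma (connected_on V) parcs"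
  proof clarify
    fix A G H u v assume AA: "A \<in> \<A>" and 1: "(G, H, u, v) \<in> F A"
    then have "G \<in> \<G>" "cut_connected G" "pverts G = A" "H \<in> \<G>" "cut_connected H" "pverts H = V - A" "u \<in> A" "v \<in> V - A"
      by (auto simp: F_def connected_on_iff)
    then have "join u v G H \<in> \<G>" "cut_connected (join u v G H)"
      by (auto intro!: join_mem cut_connected_join)
    then show "join u v G H \<in> connected_on V \<and> (u, v) \<in> parcs (join u v G H)"
      using A[OF AA] \<open>pverts G = A\<close> \<open>pverts H = V - A\<close> by (auto simp: connected_on_iff)
  qed
  moreover have "finite (Sigma (connected_on V) parcs)"
    using V(1) by (intro finite_SigmaI finite_connected_on) (auto simp: connected_on_iff dest: pair_graphD(2)[OF graph])
  ultimately have "card (Sigma \<A> F) \<le> card (Sigma (connected_on V) parcs)"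
    by (rule card_inj_on_le)
  also have "card (Sigma \<A> F) = (\<Sum>A\<in>\<A>. card (F A))"
    using fin\<A> finF by (intro card_SigmaI) auto
  also have "\<dots> = (\<Sum>A\<in>\<A>. m * n * count m * count n)"
    using cardF by (intro sum.cong) auto
  also have "\<dots> = ((m + n) choose m) * (m * n * count m * count n)"
    using n_subsets[OF V(1), of m] V(2) by (simp add: \<A>_def)
  also have "card (Sigma (connected_on V) parcs) \<le> card (connected_on V) * (d * (m + n))"
  proof (rule card_Sigma_le)
    show "finite (connected_on V)"
      by (rule finite_connected_on[OF V(1)])
    show "finite (parcs G)" "card (parcs G) \<le> d * (m + n)" if "G \<in> connected_on V" for G
      using that d[of G] V(2) pair_graphD(2)[OF graph] by (auto simp: connected_on_iff)
  qed
  finally show ?thesis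
    using card_connected_on[OF V(1)] V(2) by (simp add: algebra_simps)
qed

lemma count_1: "count 1 \<ge> 1"
proof -
  have "\<lparr>pverts = {1}, parcs = {}\<rparr> \<in> connected_on {1..1}"
    using singleton_mem by (auto simp: connected_on_iff cut_connected_def)
  then have "connected_on {1..1} \<noteq> {}"
    by blast
  then show ?thesis
    unfolding count_def using finite_connected_on[of "{1..1}"] by (simp add: Suc_le_eq card_gt_0_iff)
qed

lemma growth:
  obtains d L :: real where "d > 0" "\<And>n. 1 \<le> n \<Longrightarrow> count n > 0"
    "\<And>n. 1 \<le> n \<Longrightarrow> ln (real n * real (count n) / (d * fact n)) \<le> L * real n"
    "\<And>\<delta>. 0 < \<delta> \<Longrightarrow> \<forall>\<^sub>F n in sequentially. (L - \<delta>) * real n \<le> ln (real n * real (count n) / (d * fact n))"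
proof -
  obtain d :: nat where d1: "d \<ge> 1" and d: "\<And>G. G \<in> \<G> \<Longrightarrow> card (parcs G) \<le> d * card (pverts G)"
    using sparse_ex by metis
  obtain K where K: "K \<ge> 1" "\<And>n. count n \<le> fact n * K ^ (n + 1)"
    using count_bound by metis
  \<comment> \<open>The factor \<open>n\<close> stands for the choice of an end vertex, and
    \<open>d\<close> for the arcs per vertex that can be marked; so normalised, the counting
    inequality is exact supermultiplicativity.\<close>
  define b where "b n = real n * real (count n) / (real d * fact n)" for n
  have super: "b m * b n \<le> b (m + n)" if "1 \<le> m" "1 \<le> n" for m n
  proof -
    let ?C = "real ((m + n) choose m)"
    have "real (((m + n) choose m) * (m * n * count m * count n)) \<le> real (d * (m + n) * count (m + n))"
      using count_superadditive[OF d, of m n] by (simp only: of_nat_le_iff)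
    then have "?C * (real m * real n * real (count m) * real (count n)) \<le> real d * real (m + n) * real (count (m + n))"
      by simp
    moreover have "?C = fact (m + n) / (fact m * fact n)"
      by (subst binomial_fact) auto
    ultimately have "fact (m + n) * (real m * real n * real (count m) * real (count n)) / (fact m * fact n) \<le> real d * real (m + n) * real (count (m + n))"
      by simp
    then have "fact (m + n) * (real m * real n * real (count m) * real (count n)) / (fact m * fact n) / (real d * real d * fact (m + n))
        \<le> real d * real (m + n) * real (count (m + n)) / (real d * real d * fact (m + n))"
      by (intro divide_right_mono) auto
    moreover have "fact (m + n) * (real m * real n * real (count m) * real (count n)) / (fact m * fact n) / (real d * real d * fact (m + n)) = b m * b n"
      by (simp add: b_def mult_ac)
    moreover have "real d * real (m + n) * real (count (m + n)) / (real d * real d * fact (m + n)) = b (m + n)"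
      using d1 by (simp add: b_def)
    ultimately show ?thesis by simp
  qed
  have b1: "b 1 > 0"
    using count_1 d1 by (simp add: b_def)
  have pos: "b n > 0" if "1 \<le> n" for n
    using that
  proof (induction n rule: nat_induct_at_least)
    case (Suc n)
    have "0 < b n * b 1"
      using Suc b1 by simp
    also have "\<dots> \<le> b (n + 1)"
      using Suc by (intro super) auto
    finally show ?case by simp
  qed (use b1 in simp)
  have count_pos: "count n > 0" if "1 \<le> n" for n
    using pos[OF that] by (cases "count n") (auto simp: b_def)
  \<comment> \<open>The bound on the size of the whole class enters here, to make the growth
    constant finite.\<close>
  have ln_bound: "ln (b n) \<le> (2 * ln (real K) + 1) * real n" if n: "1 \<le> n" for n
  proof -
    have "real (count n) \<le> fact n * real K ^ (n + 1)"
      using K(2)[of n] by (metis of_nat_fact of_nat_le_iff of_nat_mult of_nat_power)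
    then have "real n * real (count n) \<le> real n * (fact n * real K ^ (n + 1))"
      by (intro mult_left_mono) auto
    then have "b n \<le> real n * (fact n * real K ^ (n + 1)) / (1 * fact n)"
      unfolding b_def using d1 K(1) by (intro frac_le) auto
    also have "\<dots> = real n * real K ^ (n + 1)"
      by simp
    finally have "ln (b n) \<le> ln (real n * real K ^ (n + 1))"
      using pos[OF n] by (subst ln_le_cancel_iff) auto
    also have "\<dots> = ln (real n) + real (n + 1) * ln (real K)"
      using n K(1) by (simp add: ln_mult ln_realpow algebra_simps)
    also have "ln (real n) \<le> real n"
      using n ln_le_minus_one[of "real n"] by simp
    also have "real (n + 1) * ln (real K) \<le> (2 * real n) * ln (real K)"
      using n K(1) by (intro mult_right_mono) auto
    finally show ?thesis
      by (simp add: algebra_simps)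
  qed
  have ln_super: "ln (b m) + ln (b n) \<le> ln (b (m + n))" if "1 \<le> m" "1 \<le> n" for m n
  proof -
    have "ln (b m) + ln (b n) = ln (b m * b n)"
      using pos[OF that(1)] pos[OF that(2)] by (simp add: ln_mult)
    also have "\<dots> \<le> ln (b (m + n))"
      using pos[OF that(1)] pos[OF that(2)] super[OF that] by (intro ln_mono) auto
    finally show ?thesis .
  qed
  show thesis
  proof (rule fekete[of "\<lambda>n. ln (b n)", OF ln_super ln_bound])
    fix L
    assume L: "\<And>n. 1 \<le> n \<Longrightarrow> ln (b n) \<le> L * real n"
      "\<And>\<delta>. 0 < \<delta> \<Longrightarrow> \<forall>\<^sub>F n in sequentially. (L - \<delta>) * real n \<le> ln (b n)"
    show thesis
      by (rule that[of "real d" L]) (use L count_pos d1 in \<open>auto simp: b_def\<close>)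
  qed
qed

end

section \<open>Pendant copies\<close>

lemma pendantD:
  assumes "pendant M r G W"
  obtains f y where "inj_on f (pverts M)" "W = f ` pverts M" "W \<subseteq> pverts G" "induce W G = relabel f M"
    "y \<in> pverts G - W" "parcs G \<inter> W \<times> (- W) = {(f r, y)}"
  using assms unfolding pendant_def by blast

lemma pendantI:
  assumes "inj_on f (pverts M)" "W = f ` pverts M" "W \<subseteq> pverts G" "induce W G = relabel f M"
    "y \<in> pverts G - W" "parcs G \<inter> W \<times> (- W) = {(f r, y)}"
  shows "pendant M r G W"
  unfolding pendant_def by (intro exI[of _ f] exI[of _ y] conjI assms)

lemma pendant_leaving_arc:
  assumes "pendant M r G W"
  obtains p q where "\<forall>a b. (a, b) \<in> parcs G \<longrightarrow> a \<in> W \<longrightarrow> b \<notin> W \<longrightarrow> a = p \<and> b = q"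
  by (rule pendantD[OF assms]) blast

lemma pendant_induce_connected:
  assumes "pendant M r G W" "pair_graph M" "cut_connected M"
  shows "cut_connected (induce W G)"
  by (rule pendantD[OF assms(1)]) (simp add: cut_connected_relabel assms(2,3) del: induce_simps relabel_simps)

lemma pendant_card:
  assumes "pendant M r G W"
  shows "W \<subseteq> pverts G" "card W = card (pverts M)"
proof -
  obtain f where "inj_on f (pverts M)" "W = f ` pverts M" "W \<subseteq> pverts G"
    by (rule pendantD[OF assms])
  then show "W \<subseteq> pverts G" "card W = card (pverts M)"
    by (auto simp: card_image)
qed

text \<open>Distinct copies that meet have equal size, so neither contains the other. As each is
  connected, an arc inside \<open>W\<close> leaves \<open>W'\<close>, so the unique link of
  \<open>W'\<close> ends in \<open>W\<close>, and vice versa. Then no arc leaves the union, which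
  misses a vertex because the graph is large, contrary to connectedness.\<close>

lemma pendant_disjoint:
  assumes M: "pair_graph M" "cut_connected M" and G: "pair_graph G" "cut_connected G"
    and W: "pendant M r G W" "pendant M r G W'" and large: "2 * card (pverts M) < card (pverts G)"
    and meet: "W \<inter> W' \<noteq> {}"
  shows "W = W'"
proof (rule ccontr)
  assume neq: "W \<noteq> W'"
  note c = pendant_card[OF W(1)] and c' = pendant_card[OF W(2)]
  have fin: "finite W" "finite W'"
    using c c' pair_graphD(1)[OF G(1)] finite_subset by blast+
  have nsub: "\<not> W \<subseteq> W'" "\<not> W' \<subseteq> W"
    using card_subset_eq[OF fin(2), of W] card_subset_eq[OF fin(1), of W'] neq c c' by auto
  have cc: "cut_connected (induce W G)" "cut_connected (induce W' G)"
    using pendant_induce_connected[OF _ M] W by auto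
  obtain p q where pq: "\<forall>a b. (a, b) \<in> parcs G \<longrightarrow> a \<in> W \<longrightarrow> b \<notin> W \<longrightarrow> a = p \<and> b = q"
    by (rule pendant_leaving_arc[OF W(1)])
  obtain p' q' where pq': "\<forall>a b. (a, b) \<in> parcs G \<longrightarrow> a \<in> W' \<longrightarrow> b \<notin> W' \<longrightarrow> a = p' \<and> b = q'"
    by (rule pendant_leaving_arc[OF W(2)])
  have S: "W \<inter> W' \<noteq> {}" "W \<inter> W' \<subset> pverts (induce W G)" "W \<inter> W' \<subset> pverts (induce W' G)"
    using meet nsub c c' by auto
  obtain a b where ab: "a \<in> W \<inter> W'" "b \<in> pverts (induce W G)" "b \<notin> W \<inter> W'" "(a, b) \<in> parcs (induce W G)"
    by (rule cut_connectedD[OF cc(1) S(1,2)])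
  obtain a' b' where ab': "a' \<in> W \<inter> W'" "b' \<in> pverts (induce W' G)" "b' \<notin> W \<inter> W'" "(a', b') \<in> parcs (induce W' G)"
    by (rule cut_connectedD[OF cc(2) S(1,3)])
  have 1: "q' \<in> W" 
    using pq'[rule_format, of a b] ab by auto
  have 2: "q \<in> W'"
    using pq[rule_format, of a' b'] ab' by auto
  have "card (W \<union> W') \<le> 2 * card (pverts M)"
    using card_Un_le[of W W'] c c' by simp
  then have "W \<union> W' \<noteq> pverts G"
    using large by auto
  then have T: "W \<union> W' \<noteq> {}" "W \<union> W' \<subset> pverts G"
    using meet c c' by auto
  obtain x y where xy: "x \<in> W \<union> W'" "y \<in> pverts G" "y \<notin> W \<union> W'" "(x, y) \<in> parcs G"
    by (rule cut_connectedD[OF G(2) T])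
  show False
    using xy pq[rule_format, of x y] pq'[rule_format, of x y] 1 2 by auto
qed

lemma pendant_relabel:
  assumes W: "pendant M r G W" and M: "pair_graph M" and r: "r \<in> pverts M" and G: "pair_graph G" and g: "inj_on g (pverts G)"
  shows "pendant M r (relabel g G) (g ` W)"
proof -
  obtain f y where f: "inj_on f (pverts M)" "W = f ` pverts M" "W \<subseteq> pverts G" "induce W G = relabel f M"
    "y \<in> pverts G - W" "parcs G \<inter> W \<times> (- W) = {(f r, y)}"
    by (rule pendantD[OF W])
  have gW: "g a \<in> g ` W \<longleftrightarrow> a \<in> W" if "a \<in> pverts G" for a
    using inj_on_image_mem_iff[OF g that f(3)] .
  have arcs: "parcs (relabel g G) \<inter> g ` A \<times> B = map_prod g g ` (parcs G \<inter> A \<times> {b. g b \<in> B})" if "A \<subseteq> pverts G" for A B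
  proof (intro equalityI subrelI)
    fix p q assume pq: "(p, q) \<in> parcs (relabel g G) \<inter> g ` A \<times> B"
    then have "(p, q) \<in> map_prod g g ` parcs G" "p \<in> g ` A" "q \<in> B"
      by simp_all
    then obtain a b where "(a, b) \<in> parcs G" "p = g a" "q = g b"
      by auto
    with \<open>p \<in> g ` A\<close> \<open>q \<in> B\<close> have ab: "(a, b) \<in> parcs G" "p = g a" "q = g b" "g a \<in> g ` A" "g b \<in> B"
      by simp_all
    then have "a \<in> A"
      using inj_on_image_mem_iff[OF g _ that] pair_graph_arcD(1)[OF G ab(1)] by blast
    with ab show "(p, q) \<in> map_prod g g ` (parcs G \<inter> A \<times> {b. g b \<in> B})"
      by (auto intro!: map_prod_imageI)
  qed auto
  show ?thesis
    unfolding pendant_def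
  proof (intro exI conjI)
    show "inj_on (g \<circ> f) (pverts M)"
      using f(1-3) g by (auto intro: comp_inj_on inj_on_subset)
    show "g ` W = (g \<circ> f) ` pverts M"
      using f(2) by (simp add: image_comp)
    show "g ` W \<subseteq> pverts (relabel g G)"
      using f(3) by auto
    show "g y \<in> pverts (relabel g G) - g ` W"
      using f(5) gW by auto
    have "induce (g ` W) (relabel g G) = relabel g (induce W G)"
    proof (rule graph_eqI)
      show "pverts (induce (g ` W) (relabel g G)) = pverts (relabel g (induce W G))"
        using f(3) by auto
      have "parcs G \<inter> W \<times> {b. g b \<in> g ` W} = parcs G \<inter> W \<times> W"
        using gW by (auto dest: pair_graph_arcD[OF G])
      then show "parcs (induce (g ` W) (relabel g G)) = parcs (relabel g (induce W G))"
        using arcs[OF f(3), of "g ` W"] by simp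
    qed
    then show "induce (g ` W) (relabel g G) = relabel (g \<circ> f) M"
      by (simp only: f(4) relabel_relabel)
    have "parcs G \<inter> W \<times> {b. g b \<in> - g ` W} = parcs G \<inter> W \<times> (- W)"
      using gW by (auto dest: pair_graph_arcD[OF G])
    then show "parcs (relabel g G) \<inter> g ` W \<times> (- g ` W) = {((g \<circ> f) r, g y)}"
      using arcs[OF f(3), of "- g ` W"] f(6) by simp
  qed
qed

section \<open>Attaching pendant copies\<close>

locale pendant_class = addable_class +
  fixes M :: "nat pair_pre_digraph" and r :: nat
  assumes M: "M \<in> \<G>" "cut_connected M" and r: "r \<in> pverts M"
begin

abbreviation "h \<equiv> card (pverts M)"

lemma h_pos: "h > 0"
  using r pair_graphD(1)[OF graph[OF M(1)]] by (auto simp: card_gt_0_iff)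

definition pend :: "nat pair_pre_digraph \<Rightarrow> nat set set" where
  "pend G = {W. pendant M r G W}"

text \<open>The admissible attachment points: a new edge at a vertex of an old copy would give that
  copy a second link.\<close>

definition core :: "nat pair_pre_digraph \<Rightarrow> nat set" where
  "core G = pverts G - \<Union> (pend G)"

lemma finite_pend: "G \<in> \<G> \<Longrightarrow> finite (pend G)"
  by (rule finite_subset[of "pend G" "Pow (pverts G)"])
    (auto simp: pend_def pair_graphD(1)[OF graph] dest: subsetD[OF pendant_card(1)])

text \<open>One embedding is fixed for each \<open>W\<close>, so that the attached graph depends on
  \<open>W\<close>, \<open>G\<close> and \<open>x\<close> alone and no further choice has to be
  recovered.\<close>

definition copy :: "nat set \<Rightarrow> nat \<Rightarrow> nat" where
  "copy W = (SOME f. bij_betw f (pverts M) W)"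

lemma copy:
  assumes "finite W" "card W = h"
  shows "inj_on (copy W) (pverts M)" "copy W ` pverts M = W"
proof -
  have "\<exists>f. bij_betw f (pverts M) W"
    using assms pair_graphD(1)[OF graph[OF M(1)]] finite_same_card_bij by metis
  then have "bij_betw (copy W) (pverts M) W"
    unfolding copy_def by (rule someI_ex)
  then show "inj_on (copy W) (pverts M)" "copy W ` pverts M = W"
    by (auto simp: bij_betw_def)
qed

definition attach :: "nat set \<Rightarrow> nat pair_pre_digraph \<Rightarrow> nat \<Rightarrow> nat pair_pre_digraph" where
  "attach W G x = join x (copy W r) G (relabel (copy W) M)"

context
  fixes W U :: "nat set" and G :: "nat pair_pre_digraph" and x :: nat
  assumes W: "finite W" "card W = h" and G: "G \<in> connected_on U" "W \<inter> U = {}" "h < card U" and x: "x \<in> core G"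
begin

lemma attach_simps:
  shows "pair_graph G" "cut_connected G" "pverts G = U" "x \<in> U"
    and "copy W r \<in> W" "pverts (attach W G x) = U \<union> W"
    and "parcs (attach W G x) = parcs G \<union> parcs (relabel (copy W) M) \<union> {(x, copy W r), (copy W r, x)}"
    and "parcs (relabel (copy W) M) \<subseteq> W \<times> W" "parcs G \<subseteq> U \<times> U"
proof -
  show GU: "pair_graph G" "cut_connected G" "pverts G = U" "x \<in> U"
    using G(1) x graph by (auto simp: connected_on_iff core_def)
  show "copy W r \<in> W" "pverts (attach W G x) = U \<union> W"
    using copy[OF W] r GU by (auto simp: attach_def)
  show "parcs (attach W G x) = parcs G \<union> parcs (relabel (copy W) M) \<union> {(x, copy W r), (copy W r, x)}"
    by (simp add: attach_def)
  show "parcs (relabel (copy W) M) \<subseteq> W \<times> W"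
    using relabel_subgraph_parcs[OF graph[OF M(1)], of "copy W"] copy(2)[OF W] by simp
  show "parcs G \<subseteq> U \<times> U"
    using GU(3) by (auto dest: pair_graph_arcD[OF GU(1)])
qed

lemma attach_mem: "attach W G x \<in> connected_on (U \<union> W)"
proof -
  let ?H = "relabel (copy W) M"
  have H: "?H \<in> \<G>" "cut_connected ?H" "pverts ?H = W"
    using relabel_mem[OF M(1)] cut_connected_relabel[OF graph[OF M(1)] M(2)] copy[OF W] by auto
  have GG: "G \<in> \<G>"
    using G(1) by (simp add: connected_on_iff)
  have disj: "pverts G \<inter> pverts ?H = {}" "x \<in> pverts G" "copy W r \<in> pverts ?H"
    using G(2) attach_simps(3-5) H(3) by auto
  have "attach W G x \<in> \<G>" "cut_connected (attach W G x)"
    unfolding attach_def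
    using join_mem[OF GG H(1) attach_simps(2) H(2) disj] cut_connected_join[OF attach_simps(2) H(2) disj(2,3)] by auto
  then show ?thesis
    using attach_simps(6) by (simp add: connected_on_iff)
qed

lemma induce_attach:
  shows "induce W (attach W G x) = relabel (copy W) M" "induce (- W) (attach W G x) = G"
    and "W' \<subseteq> U \<Longrightarrow> induce W' (attach W G x) = induce W' G"
    and "parcs (attach W G x) \<inter> W \<times> (- W) = {(copy W r, x)}"
proof -
  note A = attach_simps
  have x: "x \<notin> W" "x \<in> U" "copy W r \<notin> U" "copy W r \<in> W"
    using A(4,5) G(2) by blast+
  show "induce W (attach W G x) = relabel (copy W) M"
  proof (rule graph_eqI)
    show "pverts (induce W (attach W G x)) = pverts (relabel (copy W) M)"
      unfolding induce_simps(1) A(6) relabel_simps(1) copy(2)[OF W] by blast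
    show "parcs (induce W (attach W G x)) = parcs (relabel (copy W) M)"
      unfolding induce_simps(2) A(7) using A(8,9) x G(2) by blast
  qed
  show "induce (- W) (attach W G x) = G"
  proof (rule graph_eqI)
    show "pverts (induce (- W) (attach W G x)) = pverts G"
      unfolding induce_simps(1) A(6) A(3) using G(2) by blast
    show "parcs (induce (- W) (attach W G x)) = parcs G"
      unfolding induce_simps(2) A(7) using A(8,9) x G(2) by blast
  qed
  show "induce W' (attach W G x) = induce W' G" if "W' \<subseteq> U"
  proof (rule graph_eqI)
    show "pverts (induce W' (attach W G x)) = pverts (induce W' G)"
      unfolding induce_simps(1) A(6) A(3) using that G(2) by blast
    show "parcs (induce W' (attach W G x)) = parcs (induce W' G)"
      unfolding induce_simps(2) A(7) using A(8) x G(2) that by blast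
  qed
  show "parcs (attach W G x) \<inter> W \<times> (- W) = {(copy W r, x)}"
    unfolding A(7) using A(8,9) x G(2) by blast
qed

text \<open>Old copies avoid the core vertex \<open>x\<close> and keep their single link. Any copy
  other than \<open>W\<close> is disjoint from \<open>W\<close>, as \<open>h < card U\<close> makes
  the graph large enough for \<open>pendant_disjoint\<close>; it thus lies in \<open>G\<close>, and
  connectedness of \<open>G\<close> shows that its link does so too.\<close>

lemma pend_attach: "pend (attach W G x) = insert W (pend G)" "W \<notin> pend G"
proof -
  let ?A = "attach W G x"
  note A = attach_simps
  have finU: "finite U"
    using pair_graphD(1)[OF A(1)] A(3) by simp
  have WA: "pendant M r ?A W"
    unfolding pendant_def
    by (intro exI[of _ "copy W"] exI[of _ x] conjI copy(1)[OF W] induce_attach(1,4))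
      (use copy(2)[OF W] A(4,6) G(2) in auto)
  have ne: "W \<noteq> {}"
    using W(2) h_pos by auto
  show "W \<notin> pend G"
    using pendant_card(1)[of M r G W] ne G(2) A(3) by (auto simp: pend_def)
  have old: "pendant M r ?A W'" if W': "pendant M r G W'" for W'
  proof -
    obtain f y where f: "inj_on f (pverts M)" "W' = f ` pverts M" "W' \<subseteq> pverts G" "induce W' G = relabel f M"
      "y \<in> pverts G - W'" "parcs G \<inter> W' \<times> (- W') = {(f r, y)}"
      by (rule pendantD[OF W'])
    have "x \<notin> W'"
      using x W' by (auto simp: core_def pend_def)
    have W'U: "W' \<subseteq> U"
      using f(3) A(3) by simp
    have "parcs ?A \<inter> W' \<times> (- W') = parcs G \<inter> W' \<times> (- W')"
    proof (intro equalityI subrelI)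
      fix a b assume "(a, b) \<in> parcs ?A \<inter> W' \<times> (- W')"
      then have ab: "(a, b) \<in> parcs ?A" "a \<in> W'" "b \<notin> W'"
        by simp_all
      have "a \<notin> W" "a \<noteq> x"
        using ab(2) W'U G(2) \<open>x \<notin> W'\<close> by blast+
      then have "(a, b) \<in> parcs G"
        using ab(1) A(5,8) unfolding A(7) by blast
      with ab show "(a, b) \<in> parcs G \<inter> W' \<times> (- W')"
        by simp
    next
      fix a b assume "(a, b) \<in> parcs G \<inter> W' \<times> (- W')"
      then show "(a, b) \<in> parcs ?A \<inter> W' \<times> (- W')"
        unfolding A(7) by simp
    qed
    then have arcs: "parcs ?A \<inter> W' \<times> (- W') = {(f r, y)}"
      using f(6) by (rule trans)
    have "W' \<subseteq> pverts ?A" "y \<in> pverts ?A - W'"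
      using W'U f(5) A(3,6) by auto
    moreover have "induce W' ?A = relabel f M"
      by (simp only: induce_attach(3)[OF W'U] f(4))
    ultimately show ?thesis
      by (intro pendantI[OF f(1,2) _ _ _ arcs])
  qed
  have new: "pendant M r G W'" if W': "pendant M r ?A W'" "W' \<noteq> W" for W'
  proof -
    have "card (U \<union> W) = card U + card W"
      using finU W(1) G(2) by (intro card_Un_disjoint) auto
    then have large: "2 * h < card (pverts ?A)"
      using A(6) G(3) W(2) by simp
    have "?A \<in> \<G>" "cut_connected ?A"
      using attach_mem by (auto simp: connected_on_iff)
    then have "W' \<inter> W = {}"
      using pendant_disjoint[OF graph[OF M(1)] M(2) graph _ W'(1) WA large] W'(2) by blast
    then have W'U: "W' \<subseteq> U"
      using pendant_card(1)[OF W'(1)] A(6) by auto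
    obtain f y where f: "inj_on f (pverts M)" "W' = f ` pverts M" "W' \<subseteq> pverts ?A" "induce W' ?A = relabel f M"
      "y \<in> pverts ?A - W'" "parcs ?A \<inter> W' \<times> (- W') = {(f r, y)}"
      by (rule pendantD[OF W'(1)])
    have S: "W' \<noteq> {}" "W' \<subset> pverts G"
      using W'U A(3) G(3) pendant_card(2)[OF W'(1)] h_pos by auto
    obtain p q where pq: "p \<in> W'" "q \<in> pverts G" "q \<notin> W'" "(p, q) \<in> parcs G"
      by (rule cut_connectedD[OF A(2) S])
    then have "(p, q) \<in> parcs ?A \<inter> W' \<times> (- W')"
      using A(7) by auto
    then have eq: "p = f r" "q = y"
      unfolding f(6) by auto
    have "parcs G \<inter> W' \<times> (- W') \<subseteq> parcs ?A \<inter> W' \<times> (- W')"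
      using A(7) by auto
    then have arcs: "parcs G \<inter> W' \<times> (- W') = {(f r, y)}"
      unfolding f(6) using pq eq by auto
    have "W' \<subseteq> pverts G" "y \<in> pverts G - W'"
      using W'U A(3) pq(2,3) eq(2) by auto
    moreover have "induce W' G = relabel f M"
      using f(4) by (simp only: induce_attach(3)[OF W'U])
    ultimately show ?thesis
      by (intro pendantI[OF f(1,2) _ _ _ arcs])
  qed
  show "pend ?A = insert W (pend G)"
    using WA old new by (auto simp: pend_def)
qed

text \<open>The core keeps its size during repeated attachment, so each copy has the same number of
  attachment points to choose from.\<close>

lemma core_attach: "core (attach W G x) = core G"
  unfolding core_def pend_attach(1) attach_simps(6) using G(2) attach_simps(3) by auto

end

definition pendant_free :: "nat set \<Rightarrow> nat pair_pre_digraph set" where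
  "pendant_free V = graphs_on V {G \<in> \<G>. cut_connected G \<and> pend G = {}}"

text \<open>A pendant copy in the relabelled graph would be carried back by the inverse
  relabelling.\<close>

sublocale free: relabel_closed_set "{G \<in> \<G>. cut_connected G \<and> pend G = {}}"
proof (rule relabel_closed_set.intro)
  fix G :: "nat pair_pre_digraph" and f :: "nat \<Rightarrow> nat"
  assume G: "G \<in> {G \<in> \<G>. cut_connected G \<and> pend G = {}}" and f: "inj_on f (pverts G)"
  let ?H = "relabel f G" and ?g = "the_inv_into (pverts G) f"
  have Gg: "pair_graph G"
    using G graph by simp
  have inv: "relabel ?g ?H = G"
    unfolding relabel_relabel by (intro relabel_ident Gg) (simp add: the_inv_into_f_f[OF f])
  have "pend ?H = {}"
  proof (rule ccontr)
    assume "pend ?H \<noteq> {}"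
    then obtain W where "pendant M r ?H W"
      by (auto simp: pend_def)
    then have "pendant M r (relabel ?g ?H) (?g ` W)"
      using pendant_relabel graph[OF M(1)] r pair_graph_relabel[OF Gg f] inj_on_the_inv_into[OF f]
      by (metis relabel_simps(1))
    then show False
      using G unfolding inv by (auto simp: pend_def)
  qed
  then show "?H \<in> {G \<in> \<G>. cut_connected G \<and> pend G = {}}"
    using G f relabel_mem cut_connected_relabel[OF Gg] by auto
qed (use graph in auto)

definition with_pendants :: "nat set \<Rightarrow> nat \<Rightarrow> nat \<Rightarrow> nat pair_pre_digraph set" where
  "with_pendants V n j = {G \<in> connected_on V. card (pend G) = j \<and> card (core G) = n}"

text \<open>Pendant copies are disjoint, so attaching \<open>W\<close> to the core creates exactly the pendant copy \<open>W\<close>;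
  hence \<open>G\<close>, \<open>x\<close> and \<open>W\<close> can be recovered from the resulting graph by pointing at one of its
  pendant copies.\<close>

lemma card_with_pendants_Suc:
  assumes V: "finite V" "card V = n + h * Suc j" and n: "h < n"
    and lower: "\<And>U. finite U \<Longrightarrow> card U = n + h * j \<Longrightarrow> l \<le> card (with_pendants U n j)"
  shows "((n + h * Suc j) choose h) * (l * n) \<le> Suc j * card (with_pendants V n (Suc j))"
proof -
  define \<W> where "\<W> = {W. W \<subseteq> V \<and> card W = h}"
  define F where "F W = Sigma (with_pendants (V - W) n j) core" for W
  have fin\<W>: "finite \<W>"
    using V by (auto simp: \<W>_def)
  have W: "finite W" "W \<subseteq> V" "card W = h" "card (V - W) = n + h * j" if "W \<in> \<W>" for W
    using that V finite_subset[of W V] by (auto simp: \<W>_def card_Diff_subset)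
  have fin_wp: "finite (with_pendants U n i)" if "finite U" for U i
    using finite_connected_on[OF that] by (simp add: with_pendants_def)
  have fin_core: "finite (core G)" "card (core G) = n" if "G \<in> with_pendants U n i" for G U i
    using that pair_graphD(1)[OF graph] by (auto simp: with_pendants_def connected_on_iff core_def)
  have finF: "finite (F W)" and cardF: "l * n \<le> card (F W)" if WW: "W \<in> \<W>" for W
  proof -
    have fin: "finite (V - W)"
      using V by simp
    show "finite (F W)"
      unfolding F_def using fin_wp[OF fin] fin_core by (intro finite_SigmaI) auto
    have "card (F W) = (\<Sum>G\<in>with_pendants (V - W) n j. card (core G))"
      unfolding F_def using fin_wp[OF fin] fin_core by (intro card_SigmaI) auto
    also have "\<dots> = card (with_pendants (V - W) n j) * n"
      using fin_core by simp
    finally show "l * n \<le> card (F W)"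
      using lower[OF fin W(4)[OF WW]] by simp
  qed
  have args: "finite W \<and> card W = h \<and> G \<in> connected_on (V - W) \<and> W \<inter> (V - W) = {} \<and> h < card (V - W) \<and> x \<in> core G"
    "card (pend G) = j" "card (core G) = n"
    if "W \<in> \<W>" "(G, x) \<in> F W" for W G x
    using that W[OF that(1)] n by (auto simp: F_def with_pendants_def)
  let ?\<psi> = "\<lambda>(W, G, x). (attach W G x, W)"
  have "inj_on ?\<psi> (Sigma \<W> F)"
  proof (rule inj_onI)
    fix p p' assume p: "p \<in> Sigma \<W> F" "p' \<in> Sigma \<W> F" "?\<psi> p = ?\<psi> p'"
    obtain W G x where p1: "p = (W, G, x)"
      by (rule prod_cases3)
    obtain W' G' x' where p2: "p' = (W', G', x')"
      by (rule prod_cases3)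
    have 1: "W \<in> \<W>" "(G, x) \<in> F W" and 2: "W' \<in> \<W>" "(G', x') \<in> F W'" and eq: "attach W G x = attach W' G' x'" "W = W'"
      using p unfolding p1 p2 by auto
    have a: "finite W" "card W = h" "G \<in> connected_on (V - W)" "W \<inter> (V - W) = {}" "h < card (V - W)" "x \<in> core G"
      and a': "G' \<in> connected_on (V - W)" "x' \<in> core G'"
      using args(1)[OF 1] args(1)[OF 2] eq(2) by auto
    have "G = G'"
      using induce_attach(2)[OF a] induce_attach(2)[OF a(1,2) a'(1) a(4,5) a'(2)] eq by simp
    moreover have "{(copy W r, x)} = {(copy W r, x')}"
      using induce_attach(4)[OF a] induce_attach(4)[OF a(1,2) a'(1) a(4,5) a'(2)] eq by simp
    ultimately show "p = p'"
      using eq unfolding p1 p2 by simp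
  qed
  moreover have "?\<psi> ` Sigma \<W> F \<subseteq> Sigma (with_pendants V n (Suc j)) pend"
  proof clarify
    fix W G x assume 1: "W \<in> \<W>" "(G, x) \<in> F W"
    have a: "finite W" "card W = h" "G \<in> connected_on (V - W)" "W \<inter> (V - W) = {}" "h < card (V - W)" "x \<in> core G"
      using args(1)[OF 1] by auto
    have "V - W \<union> W = V"
      using W(2)[OF 1(1)] by auto
    then have "attach W G x \<in> connected_on V"
      using attach_mem[OF a] by simp
    moreover have "card (pend (attach W G x)) = Suc j"
      using pend_attach[OF a] args(2)[OF 1] finite_pend[of G] a(3) by (simp add: connected_on_iff)
    moreover have "card (core (attach W G x)) = n"
      using core_attach[OF a] args(3)[OF 1] by simp
    moreover have "W \<in> pend (attach W G x)"
      using pend_attach(1)[OF a] by simp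
    ultimately show "attach W G x \<in> with_pendants V n (Suc j) \<and> W \<in> pend (attach W G x)"
      by (simp add: with_pendants_def)
  qed
  moreover have fin_pend: "finite (pend G)" "card (pend G) \<le> Suc j" if "G \<in> with_pendants V n (Suc j)" for G
    using that finite_pend by (auto simp: with_pendants_def connected_on_iff)
  moreover have "finite (Sigma (with_pendants V n (Suc j)) pend)"
    using fin_wp[OF V(1)] fin_pend by (intro finite_SigmaI) auto
  ultimately have "card (Sigma \<W> F) \<le> card (Sigma (with_pendants V n (Suc j)) pend)"
    by (intro card_inj_on_le)
  also have "\<dots> \<le> card (with_pendants V n (Suc j)) * Suc j"
    using fin_wp[OF V(1)] fin_pend by (intro card_Sigma_le) auto
  finally have upper: "card (Sigma \<W> F) \<le> card (with_pendants V n (Suc j)) * Suc j" .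
  have "((n + h * Suc j) choose h) * (l * n) = (\<Sum>W\<in>\<W>. l * n)"
    using n_subsets[OF V(1), of h] V(2) by (simp add: \<W>_def)
  also have "\<dots> \<le> (\<Sum>W\<in>\<W>. card (F W))"
    using cardF by (intro sum_mono) auto
  also have "\<dots> = card (Sigma \<W> F)"
    using fin\<W> finF by (intro card_SigmaI[symmetric]) auto
  finally show ?thesis
    using upper by (simp add: mult.commute)
qed

text \<open>One more attachment multiplies the bound by \<open>n\<close> and a binomial coefficient
  and divides it by \<open>Suc j\<close>, the number of copies that may have come last. The
  binomials telescope to a quotient of factorials, the divisors to \<open>fact j\<close>.\<close>

lemma card_with_pendants:
  assumes n: "h < n" and V: "finite V" "card V = n + h * j"
  shows "real (card (pendant_free {1..n})) / fact n * fact (n + h * j) * (real n / fact h) ^ j / fact j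
    \<le> real (card (with_pendants V n j))"
  using V
proof (induction j arbitrary: V)
  case 0
  have "pendant_free V \<subseteq> with_pendants V n 0"
    using 0 by (auto simp: pendant_free_def graphs_on_def with_pendants_def connected_on_iff core_def)
  then have "card (pendant_free V) \<le> card (with_pendants V n 0)"
    using finite_connected_on[OF 0(1)] by (intro card_mono) (auto simp: with_pendants_def)
  moreover have "card (pendant_free V) = card (pendant_free {1..n})"
    unfolding pendant_free_def using 0 by (intro free.card_graphs_on_cong) auto
  ultimately show ?case
    by simp
next
  case (Suc j)
  let ?N = "n + h * Suc j"
  define l where "l = real (card (pendant_free {1..n})) / fact n * fact (n + h * j) * (real n / fact h) ^ j / fact j"
  \<comment> \<open>\<open>card_with_pendants_Suc\<close> takes a natural number as lower bound, so
    the real one is rounded up; this is sound because it bounds integers.\<close>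
  define l' where "l' = nat \<lceil>l\<rceil>"
  have "l' \<le> card (with_pendants U n j)" if "finite U" "card U = n + h * j" for U
    using Suc.IH[OF that] by (simp add: l'_def l_def nat_ceiling_le_eq)
  from card_with_pendants_Suc[OF Suc.prems n this]
  have "real ((?N choose h) * (l' * n)) \<le> real (Suc j * card (with_pendants V n (Suc j)))"
    by (simp only: of_nat_le_iff)
  then have 1: "real (?N choose h) * (real l' * real n) \<le> real (Suc j) * real (card (with_pendants V n (Suc j)))"
    by (simp only: of_nat_mult)
  have "l \<le> real l'"
    unfolding l'_def by linarith
  then have "real (?N choose h) * (l * real n) \<le> real (?N choose h) * (real l' * real n)"
    by (intro mult_left_mono mult_right_mono) auto
  with 1 have 2: "real (?N choose h) * (l * real n) \<le> real (Suc j) * real (card (with_pendants V n (Suc j)))"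
    by linarith
  have binom: "real (?N choose h) = fact ?N / (fact h * fact (n + h * j))"
    by (subst binomial_fact) (auto simp: algebra_simps)
  have "real (card (pendant_free {1..n})) / fact n * fact ?N * (real n / fact h) ^ Suc j / fact (Suc j)
      = real (?N choose h) * (l * real n) / real (Suc j)"
    unfolding binom l_def by (simp add: field_simps)
  also have "\<dots> \<le> real (card (with_pendants V n (Suc j)))"
    using 2 by (simp add: divide_le_eq mult.commute del: of_nat_Suc)
  finally show ?case .
qed

text \<open>Forgetting which copies were attached and using \<open>fact j \<le> j ^ j\<close> leaves
  a pure \<open>j\<close>-th power, ready for logarithms.\<close>

lemma count_ge_pendant_free:
  assumes "h < n" "1 \<le> j"
  shows "real (card (pendant_free {1..n})) / fact n * (real n / (fact h * real j)) ^ j \<le> real (count (n + h * j)) / fact (n + h * j)"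
proof -
  let ?V = "{1..n + h * j}"
  let ?D = "real (card (pendant_free {1..n})) / fact n"
  have "?D * fact (n + h * j) * (real n / fact h) ^ j / fact j \<le> real (card (with_pendants ?V n j))"
    by (rule card_with_pendants[OF assms(1)]) auto
  also have "\<dots> \<le> real (count (n + h * j))"
    unfolding count_def using finite_connected_on[of ?V] by (auto intro!: card_mono simp: with_pendants_def)
  finally have "?D * ((real n / fact h) ^ j / fact j) \<le> real (count (n + h * j)) / fact (n + h * j)"
    by (simp add: pos_le_divide_eq mult.commute mult.left_commute)
  moreover have "(real n / (fact h * real j)) ^ j \<le> (real n / fact h) ^ j / fact j"
  proof -
    have "(fact j :: real) \<le> real j ^ j"
      using fact_le_power[of j, where 'a = real] by simp
    then have "(real n / fact h) ^ j / real j ^ j \<le> (real n / fact h) ^ j / fact j"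
      using assms(2) by (intro divide_left_mono) auto
    then show ?thesis
      by (simp add: power_divide power_mult_distrib)
  qed
  then have "?D * (real n / (fact h * real j)) ^ j \<le> ?D * ((real n / fact h) ^ j / fact j)"
    by (intro mult_left_mono) auto
  ultimately show ?thesis by linarith
qed

text \<open>If graphs without pendant copies were not rare, attaching \<open>\<alpha>n\<close> pendant copies to each of them
  would produce more graphs than the growth constant allows, for a suitably small \<open>\<alpha>\<close>.\<close>

lemma pendant_free_rare:
  "(\<lambda>n. real (card (pendant_free {1..n})) / real (count n)) \<longlonglongrightarrow> 0"
proof (rule growth)
  fix d L :: real
  assume d: "d > 0" and pos: "\<And>n. 1 \<le> n \<Longrightarrow> count n > 0"
    and upper: "\<And>n. 1 \<le> n \<Longrightarrow> ln (real n * real (count n) / (d * fact n)) \<le> L * real n"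
    and lower: "\<And>\<delta>. 0 < \<delta> \<Longrightarrow> \<forall>\<^sub>F n in sequentially. (L - \<delta>) * real n \<le> ln (real n * real (count n) / (d * fact n))"
  \<comment> \<open>Then \<open>1 / (fact h * \<alpha>)\<close> is \<open>exp (L * h + 2)\<close>:
    each of the nearly \<open>\<alpha> * n\<close> attached copies gains at least this factor, while
    the growth rate allows \<open>exp (L * h)\<close> for its \<open>h\<close> vertices. The surplus
    \<open>2 * j\<close> in the exponent has to beat the defect \<open>\<alpha> * n\<close> of the
    lower growth bound.\<close>
  define \<alpha> where "\<alpha> = exp (- (L * real h) - 2) / fact h"
  have \<alpha>: "\<alpha> > 0"
    by (simp add: \<alpha>_def)
  have ln\<alpha>: "ln (1 / (fact h * \<alpha>)) = L * real h + 2"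
    by (simp add: \<alpha>_def ln_div)
  show ?thesis
  proof (rule LIMSEQ_I, goal_cases)
    case (1 \<epsilon>)
    \<comment> \<open>Taken from the final contradiction: since \<open>j > \<alpha> * n - 1\<close>,
      surplus minus defect exceeds \<open>\<alpha> * n - 2\<close>, and this must outgrow
      \<open>ln n - ln \<epsilon>\<close>.\<close>
    have "\<forall>\<^sub>F n in sequentially. ln (real n) + 2 - ln \<epsilon> < \<alpha> * real n"
      using \<alpha> by real_asymp
    moreover have "\<forall>\<^sub>F n in sequentially. 1 \<le> \<alpha> * real n"
      using \<alpha> by real_asymp
    moreover have "\<forall>\<^sub>F n in sequentially. h < n"
      by (rule eventually_gt_at_top)
    moreover have "\<forall>\<^sub>F n in sequentially. (L - \<alpha>) * real n \<le> ln (real n * real (count n) / (d * fact n))"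
      by (rule lower[OF \<alpha>])
    ultimately have "\<forall>\<^sub>F n in sequentially. real (card (pendant_free {1..n})) / real (count n) < \<epsilon>"
    proof eventually_elim
      case (elim n)
      have n: "1 \<le> n"
        using elim(3) by simp
      define j where "j = nat \<lfloor>\<alpha> * real n\<rfloor>"
      have j: "1 \<le> j" "real j \<le> \<alpha> * real n" "\<alpha> * real n < real j + 1"
        using elim(2) \<alpha> unfolding j_def by linarith+
      let ?N = "n + h * j"
      have N: "1 \<le> ?N" "count ?N > 0"
        using n pos by auto
      show ?case
      proof (rule ccontr)
        assume "\<not> ?case"
        then have "\<epsilon> * real (count n) \<le> real (card (pendant_free {1..n}))"
          using pos[OF n] by (simp add: not_less le_divide_eq)
        then have "\<epsilon> * real (count n) / fact n \<le> real (card (pendant_free {1..n})) / fact n"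
          by (intro divide_right_mono) auto
        then have "\<epsilon> * real (count n) / fact n * (real n / (fact h * real j)) ^ j \<le> real (count ?N) / fact ?N"
          using count_ge_pendant_free[OF elim(3) j(1)] by (smt (verit) divide_nonneg_nonneg mult_right_mono of_nat_0_le_iff fact_ge_zero mult_nonneg_nonneg zero_le_power)
        moreover have "1 / (fact h * \<alpha>) \<le> real n / (fact h * real j)"
          using j \<alpha> by (simp add: field_simps)
        then have "(1 / (fact h * \<alpha>)) ^ j \<le> (real n / (fact h * real j)) ^ j"
          using \<alpha> by (intro power_mono) auto
        then have "\<epsilon> * real (count n) / fact n * (1 / (fact h * \<alpha>)) ^ j \<le>
            \<epsilon> * real (count n) / fact n * (real n / (fact h * real j)) ^ j"
          using 1 by (intro mult_left_mono) auto
        ultimately have "\<epsilon> * real (count n) / fact n * (1 / (fact h * \<alpha>)) ^ j \<le> real (count ?N) / fact ?N"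
          by linarith
        then have "\<epsilon> * (real n * real (count n) / (d * fact n)) * (1 / (fact h * \<alpha>)) ^ j / real n \<le>
            real (count ?N) / (d * fact ?N)"
          using d n by (simp add: field_simps)
        also have "\<dots> \<le> real ?N * real (count ?N) / (d * fact ?N)"
        proof -
          have "1 \<le> real ?N"
            using of_nat_mono[OF N(1), where 'a = real] by (simp only: of_nat_1)
          then have "1 * real (count ?N) \<le> real ?N * real (count ?N)"
            by (rule mult_right_mono) simp
          then show ?thesis
            using d by (intro divide_right_mono) (simp_all only: mult_1, simp)
        qed
        finally have le: "\<epsilon> * (real n * real (count n) / (d * fact n)) * (1 / (fact h * \<alpha>)) ^ j / real n \<le>
            real ?N * real (count ?N) / (d * fact ?N)" .
        have "0 < \<epsilon> * (real n * real (count n) / (d * fact n)) * (1 / (fact h * \<alpha>)) ^ j / real n"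
          using d n 1 \<alpha> pos[OF n] by simp
        from ln_le_cancel_iff[THEN iffD2, OF this less_le_trans[OF this le] le]
        have "ln (\<epsilon> * (real n * real (count n) / (d * fact n)) * (1 / (fact h * \<alpha>)) ^ j / real n) \<le>
            ln (real ?N * real (count ?N) / (d * fact ?N))" .
        moreover have "ln (\<epsilon> * (real n * real (count n) / (d * fact n)) * (1 / (fact h * \<alpha>)) ^ j / real n) =
            ln \<epsilon> + ln (real n * real (count n) / (d * fact n)) + real j * (L * real h + 2) - ln (real n)"
        proof -
          define X where "X = real n * real (count n) / (d * fact n)"
          define Y where "Y = 1 / (fact h * \<alpha>)"
          have XY: "X > 0" "Y > 0"
            using d n \<alpha> pos[OF n] by (auto simp: X_def Y_def)
          have "ln (\<epsilon> * X * Y ^ j / real n) = ln \<epsilon> + ln X + real j * ln Y - ln (real n)"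
            using XY 1 n by (simp add: ln_div ln_mult ln_realpow)
          then show ?thesis
            using ln\<alpha> by (simp add: X_def Y_def)
        qed
        moreover have "ln (real ?N * real (count ?N) / (d * fact ?N)) \<le> L * real ?N"
          by (rule upper[OF N(1)])
        ultimately have "ln \<epsilon> + (L - \<alpha>) * real n + real j * (L * real h + 2) - ln (real n) \<le> L * real ?N"
          using elim(4) by linarith
        then have "ln \<epsilon> - \<alpha> * real n + 2 * real j - ln (real n) \<le> 0"
          by (simp add: algebra_simps)
        then show False
          using elim(1) j(3) by linarith
      qed
    qed
    then show ?case
      unfolding eventually_sequentially by auto
  qed
qed

end

section \<open>The zero-one law\<close>

lemma addable_class_intro:
  fixes \<G> :: "nat pair_pre_digraph set"
  assumes "graph_class \<G>" and "addable \<G>" and "minor_closed \<G>"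
    and "\<G> \<noteq> {G. pair_graph G}" and "\<exists>G\<in>\<G>. pverts G \<noteq> {}"
  shows "addable_class \<G>"
proof -
  have graph: "pair_graph G" if "G \<in> \<G>" for G
    using assms(1) that by (simp add: graph_class_def)
  have relabel: "relabel f G \<in> \<G>" if "G \<in> \<G>" "inj_on f (pverts G)" for f G
    using assms(1) digraph_iso_relabel[OF graph[OF that(1)] that(2)] that(1)
    unfolding graph_class_def by blast
  have minor: "H \<in> \<G>" if "G \<in> \<G>" "minor_step G H" for G H
  proof -
    have H: "pair_graph H"
      using pair_graph_minor_step[OF graph[OF that(1)] that(2)] .
    have "digraph_iso (with_proj H) (with_proj H)"
      using digraph_iso_relabel[OF H, of id] relabel_ident[OF H, of id] by simp
    then have "is_minor H G"
      using that(2) unfolding is_minor_def by blast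
    then show ?thesis
      using assms(3) that(1) unfolding minor_closed_def by blast
  qed
  have join: "join u v G H \<in> \<G>"
    if G: "G \<in> \<G>" "cut_connected G" and H: "H \<in> \<G>" "cut_connected H"
      and disj: "pverts G \<inter> pverts H = {}" and u: "u \<in> pverts G" and v: "v \<in> pverts H" for G H u v
  proof -
    have comp: "components (graph_union G H) = {G, H}"
      by (rule components_disjoint_union[OF graph[OF G(1)] G(2) graph[OF H(1)] H(2) disj])
    have "graph_union G H \<in> \<G>"
      using assms(2) pair_graph_union[OF graph[OF G(1)] graph[OF H(1)]] G(1) H(1)
      unfolding addable_def decomposable_def by (simp add: comp)
    moreover have "G \<noteq> H"
      using disj u by auto
    ultimately show ?thesis
      using assms(2) u v unfolding addable_def join_def by (auto simp: comp)
  qed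
  show ?thesis
  proof (intro addable_class.intro addable_class_axioms.intro minor_closed_set.intro relabel_closed_set.intro)
    show "\<exists>G. pair_graph G \<and> G \<notin> \<G>"
      using assms(4) graph by blast
  qed (fact graph relabel minor assms(5) | rule join; assumption)+
qed

text \<open>The last hypothesis excludes the class whose only member is the null graph: it is
  addable and minor-closed but has no connected member, so there is no random graph to speak
  of.\<close>

theorem theorem1p1:
  fixes \<G> :: "nat pair_pre_digraph set"
  assumes "graph_class \<G>"
    and "addable \<G>"
    and "minor_closed \<G>"
    and "\<G> \<noteq> {G. pair_graph G}"
    and "\<exists>G\<in>\<G>. pverts G \<noteq> {}"
  shows "\<forall>\<phi>. mso_sentence \<phi> \<longrightarrow>
    (\<exists>L\<in>{0, 1::real}.
      (\<lambda>n. measure_pmf.prob (pmf_of_set (connected_members \<G> n)) {G. G \<Turnstile> \<phi>})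
        \<longlonglongrightarrow> L)"
proof (intro allI impI)
  fix \<phi>
  assume "mso_sentence \<phi>"
  interpret addable_class \<G>
    by (rule addable_class_intro[OF assms])
  let ?p = "\<lambda>n. measure_pmf.prob (pmf_of_set (connected_members \<G> n)) {G. G \<Turnstile> \<phi>}"
  show "\<exists>L\<in>{0, 1::real}. ?p \<longlonglongrightarrow> L"
  proof (rule universal_star[OF \<open>mso_sentence \<phi>\<close>])
    fix M r
    assume M: "M \<in> \<G>" "cut_connected M" "r \<in> pverts M"
      and sat: "\<And>G W. G \<in> \<G> \<Longrightarrow> cut_connected G \<Longrightarrow> pendant M r G W \<Longrightarrow> G \<Turnstile> \<phi> \<longleftrightarrow> M \<Turnstile> \<phi>"
    interpret pendant_class \<G> M r
      by unfold_locales (fact M)+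
    let ?C = "\<lambda>n. connected_on {1..n}" and ?D = "\<lambda>n. pendant_free {1..n}"
    let ?q = "\<lambda>n. real (card (?D n)) / real (count n)"
    have C: "connected_members \<G> n = ?C n" for n
      using connected_iff_cut_connected[OF graph] by (auto simp: connected_members_def connected_on_iff)
    have fin: "finite (?C n)" for n
      by (rule finite_connected_on) simp
    have D: "?D n \<subseteq> ?C n" for n
      by (auto simp: pendant_free_def graphs_on_def connected_on_iff)
    \<comment> \<open>Off the rare pendant-free graphs the truth value of \<open>\<phi>\<close> is
      that in \<open>M\<close>, which decides between the limits 1 and 0.\<close>
    have sat': "G \<Turnstile> \<phi> \<longleftrightarrow> M \<Turnstile> \<phi>" if "G \<in> ?C n - ?D n" for G n
      using that sat[of G] by (auto simp: pendant_free_def graphs_on_def connected_on_iff pend_def)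
    \<comment> \<open>For \<open>n = 0\<close> there is no connected graph and the uniform
      distribution on the empty set has no meaning; the limit concerns \<open>1 \<le> n\<close>
      only.\<close>
    have prob: "?p n = real (card (?C n \<inter> {G. G \<Turnstile> \<phi>})) / real (count n)" and pos: "0 < real (count n)" if "1 \<le> n" for n
    proof -
      have "0 < count n"
        using growth that by metis
      then show "0 < real (count n)"
        by simp
      have "?C n \<noteq> {}"
        using \<open>0 < count n\<close> by (auto simp: count_def)
      then show "?p n = real (card (?C n \<inter> {G. G \<Turnstile> \<phi>})) / real (count n)"
        using fin by (simp add: C measure_pmf_of_set count_def)
    qed
    show ?thesis
    proof (cases "M \<Turnstile> \<phi>")
      case True
      have "?p \<longlonglongrightarrow> 1"
      proof (rule tendsto_sandwich)
        show "\<forall>\<^sub>F n in sequentially. 1 - ?q n \<le> ?p n"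
          using eventually_ge_at_top[of 1]
        proof eventually_elim
          case (elim n)
          have "?C n - ?D n \<subseteq> ?C n \<inter> {G. G \<Turnstile> \<phi>}"
            using sat' True by blast
          then have "card (?C n - ?D n) \<le> card (?C n \<inter> {G. G \<Turnstile> \<phi>})"
            using fin by (intro card_mono) auto
          moreover have "card (?C n) = card (?D n) + card (?C n - ?D n)"
            by (rule card_subset_Diff[OF fin D])
          ultimately have "real (count n) - real (card (?D n)) \<le> real (card (?C n \<inter> {G. G \<Turnstile> \<phi>}))"
            by (simp add: count_def)
          then have "(real (count n) - real (card (?D n))) / real (count n) \<le> ?p n"
            unfolding prob[OF elim] using pos[OF elim] by (intro divide_right_mono) auto
          then show ?case
            using pos[OF elim] by (simp add: diff_divide_distrib)
        qed
        show "\<forall>\<^sub>F n in sequentially. ?p n \<le> 1"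
          by simp
        show "(\<lambda>n. 1 - ?q n) \<longlonglongrightarrow> 1"
          using tendsto_diff[OF tendsto_const[of 1] pendant_free_rare] by simp
      qed simp
      then show ?thesis by blast
    next
      case False
      have "?p \<longlonglongrightarrow> 0"
      proof (rule tendsto_sandwich)
        show "\<forall>\<^sub>F n in sequentially. 0 \<le> ?p n"
          by simp
        show "\<forall>\<^sub>F n in sequentially. ?p n \<le> ?q n"
          using eventually_ge_at_top[of 1]
        proof eventually_elim
          case (elim n)
          have "?C n \<inter> {G. G \<Turnstile> \<phi>} \<subseteq> ?D n"
            using sat' False by blast
          then have "card (?C n \<inter> {G. G \<Turnstile> \<phi>}) \<le> card (?D n)"
            using finite_subset[OF D fin] by (intro card_mono) auto
          then show ?case
            unfolding prob[OF elim] using pos[OF elim] by (intro divide_right_mono) auto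
        qed
      qed (use pendant_free_rare in simp_all)
      then show ?thesis by blast
    qed
  qed
qed

end
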